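(* Let $n,N,R\in\mathbb{N}$ and $\lambda>0$. Let $\mathcal{B}\subset\mathbb{R}^n$ be a bounded set containing the origin, with uniform probability measure $\bar\mu_{\mathcal{B}}$. Let $\Upsilon\subset(\mathbb{R}^n\setminus\{0\})\times\mathbb{R}$ be a (known) bounded parameter set, with $\lambda$-expanded set $\Upsilon_\lambda$. Let $\sigma:\mathbb{R}\to\mathbb{R}$ be a nonlinear, almost everywhere continuous function which satisfies at least one of the following conditions, with a positive scalar $\mathscr{D}_\sigma$ or $\mathcal{L}_\sigma$: (1) $|\sigma(u)-\sigma(v)|\le \mathscr{D}_\sigma$ for all $u,v\in\mathcal{I}$; (2) $|\sigma(u)-\sigma(v)|\le \mathcal{L}_\sigma|u-v|$ for all $u,v\in\mathcal{I}$, where $\mathcal{I}=\{\gamma^\top X : \gamma\in\Upsilon,\ x\in\mathcal{B}\}$ and $X=[x_1\ \cdots\ x_n\ 1]^\top$. Let $f:\mathbb{R}^n\to\mathbb{R}$ be continuous on $\mathcal{B}$, and let $\check f(x)=f(x)-\mathscr{a}^\top x-\mathscr{b}$ for some $\mathscr{a}\in\mathbb{R}^n$, $\mathscr{b}\in\mathbb{R}$. Let there exist a base approximation $\widehat f_N(x)=\sum_{i=1}^N\theta_i\,\sigma(\gamma_i^\top X)$ with (unknown) parameters $\gamma_1,\dots,\gamma_N\in\Upsilon$ and (unknown) coefficients $\theta\in\mathbb{R}^N$ with a known bound $\sum_{i=1}^N|\theta_i|\le\mathcal{S}_N$, and assume that $\|\check f-\widehat f_N\|_{\mathcal{B}}\le\varepsilon_N$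 holds for some $\varepsilon_N>0$, which may depend on $N$. The mollified approximation $$\widehat f_{\lambda,N}(x)=\int_{\Upsilon_\lambda}\sum_{i=1}^N\theta_i\,\hat\delta_\lambda^{n+1}(\gamma-\gamma_i)\,\sigma(\gamma^\top X)\,d\gamma$$ satisfies, for any $\lambda>0$, $\|\widehat f_N-\widehat f_{\lambda,N}\|_{\mathcal{B}}\le\mathcal{S}_N\mathscr{D}_\sigma$ if $\sigma$ satisfies (1), and $\|\widehat f_N-\widehat f_{\lambda,N}\|_{\mathcal{B}}\le\mathcal{S}_N\frac{\mathcal{L}_\sigma\sqrt{n+1}}{\lambda}E_{\mathcal{B}}$ if $\sigma$ satisfies (2). Let $\boldsymbol{\gamma}_1,\dots,\boldsymbol{\gamma}_R$ be sampled iid according to any nonzero probability density $P_\lambda$ over $\Upsilon_\lambda$. Then for any $\nu\in(0,1)$, with probability greater than $1-\nu$ there exists a random approximation $\widehat{\mathscr{F}}_R(x;\boldsymbol{\gamma}_1,\dots,\boldsymbol{\gamma}_R)=\sum_{j=1}^R\vartheta_j\,\sigma(\boldsymbol{\gamma}_j^\top X)$ with $$|\vartheta_j|\le\frac{\mathscr{g}_{\lambda\max}}{P_{\lambda\min}R}\quad\text{for all } j\in\{1,\dots,R\},$$ such that: (i) if $\sigma$ satisfies (1), $$\|\check f-\widehat{\mathscr{F}}_R\|_{\mathcal{B}}\le\varepsilon_N+\mathcal{S}_N\mathscr{D}_\sigma\left(1+\frac{\lambda^{n+1}}{\sqrt R}K_{\mathscr{D}_\sigma}(\nu)\right);$$ (ii)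 if $\sigma$ satisfies (2), $$\|\check f-\widehat{\mathscr{F}}_R\|_{\mathcal{B}}\le\varepsilon_N+\mathcal{S}_N\mathcal{L}_\sigma\left(\frac{\sqrt{n+1}}{\lambda}E_{\mathcal{B}}+\frac{\lambda^{n+1}}{\sqrt R}K_{\mathcal{L}_\sigma}(\nu)\right).$$ Here $$K_{\mathscr{D}_\sigma}(\nu)=\frac{\eta^{n+1}}{e^{n+1}P_{\lambda\min}}\left(1+\frac{|\sigma(0)|}{\mathscr{D}_\sigma}+\Big(3+2\frac{|\sigma(0)|}{\mathscr{D}_\sigma}\Big)\sqrt{\tfrac12\log\tfrac1\nu}\right),$$ $$K_{\mathcal{L}_\sigma}(\nu)=\frac{\eta^{n+1}}{e^{n+1}P_{\lambda\min}}\left(\gamma_{\lambda\max}E_{\mathcal{B}}+\frac{|\sigma(0)|}{\mathcal{L}_\sigma}+\Big((D_{\Upsilon\lambda}+2\gamma_{\lambda\max})E_{\mathcal{B}}+2\frac{|\sigma(0)|}{\mathcal{L}_\sigma}\Big)\sqrt{\tfrac12\log\tfrac1\nu}\right).$$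
   Context: For $x\in\mathbb{R}^n$, write $X=[x_1\ \cdots\ x_n\ 1]^\top\in\mathbb{R}^{n+1}$. Parameters are $\gamma=[w_1\ \cdots\ w_n\ b]^\top$ with weight vector $w$ and bias $b\in\mathbb{R}$, so that $\gamma^\top X=w^\top x+b$. $\bar\mu_{\mathcal{B}}$ is the uniform probability measure (normalized Lebesgue measure) on $\mathcal{B}$, and $\|g\|_{\mathcal{B}}=\left(\int_{\mathcal{B}}|g(x)|^2\,\bar\mu_{\mathcal{B}}(dx)\right)^{1/2}$. The constant $E_{\mathcal{B}}$ is $E_{\mathcal{B}}=\left(\int_{\mathcal{B}}\|X\|_2^2\,\bar\mu_{\mathcal{B}}(dx)\right)^{1/2}$. In a random approximation, the coefficients $\vartheta_j$ may depend on the sampled parameters but not on $x$. Mollified delta: for $\lambda>0$ and $\gamma=[w_1\ \cdots\ w_n\ b]^\top\in\mathbb{R}^{n+1}$, $$\hat\delta_\lambda^{n+1}(\gamma)=(\eta\lambda)^{n+1}\prod_{i=1}^n\exp\!\left(\frac{-1}{1-\lambda^2w_i^2}\right)\exp\!\left(\frac{-1}{1-\lambda^2b^2}\right)\quad\text{if }\gamma\in(-\tfrac1\lambda,\tfrac1\lambda)^{n+1},$$ and $\hat\delta_\lambda^{n+1}(\gamma)=0$ otherwise, where $\eta^{-1}=\int_{-1}^1\exp\left(\frac{-1}{1-y^2}\right)dy$. $\lambda$-expanded parameter set: $\Upsilon_\lambda=\overline{\Upsilon}+[-\tfrac1\lambda,\tfrac1\lambda]^{n+1}$ (Minkowski sum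 with the closure of $\Upsilon$); for a rectangular box $\Upsilon$, each side interval $[\alpha,\beta]$ becomes $[\alpha-\frac1\lambda,\beta+\frac1\lambda]$. Constants: $\mathscr{g}_{\lambda\max}=\sum_{i=1}^N|\theta_i|\left(\frac{\eta\lambda}{e}\right)^{n+1}$; $\ P_{\lambda\min}=\inf\{P_\lambda(\gamma):\gamma\in\Upsilon_\lambda\}$, which is understood to be positive since it appears in denominators; $\ D_{\Upsilon\lambda}=\sup\{\|\gamma-\phi\|_2:\gamma,\phi\in\Upsilon_\lambda\}$; $\ \gamma_{\lambda\max}=\sup\{\|\gamma\|_2:\gamma\in\Upsilon_\lambda\}$.
   Formalization: Conditions (1) and (2) are required on the values γᵀX with γ in the expanded set Υ_λ rather than only in Υ; with Υ alone the bounds fail, since σ may be arbitrarily large at points the mollified and random networks evaluate. *)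

theory Defs
  imports "HOL-Probability.Probability"
begin

text \<open>
  A parameter vector \<open>\<gamma> = [w\<^sub>1 \<dots> w\<^sub>n b]\<close> of \<open>\<real>\<^sup>n\<^sup>+\<^sup>1\<close> is the pair \<open>(w, b)\<close>. The norm, the inner product and
  the Lebesgue measure of the product type are the Euclidean ones of \<open>\<real>\<^sup>n\<^sup>+\<^sup>1\<close>, and
  \<open>\<gamma> \<bullet> lift1 x = w \<bullet> x + b\<close>.
\<close>

type_synonym 'n param = "(real^'n) \<times> real"

definition lift1 :: "real^'n \<Rightarrow> 'n::finite param" where
  "lift1 x = (x, 1)"

definition shallow_net ::
    "(real \<Rightarrow> real) \<Rightarrow> nat \<Rightarrow> (nat \<Rightarrow> real) \<Rightarrow> (nat \<Rightarrow> 'n::finite param) \<Rightarrow> real^'n \<Rightarrow> real" where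
  "shallow_net \<sigma> N \<theta> \<gamma> x = (\<Sum>i=1..N. \<theta> i * \<sigma> (\<gamma> i \<bullet> lift1 x))"

text \<open>
  The measure space is restricted to \<open>B\<close>, so that measurability does not depend on values outside \<open>B\<close>.
\<close>

definition unif_meas :: "(real^'n::finite) set \<Rightarrow> (real^'n) measure" where
  "unif_meas B = uniform_measure (lebesgue_on B) B"

definition L2_norm :: "(real^'n::finite) set \<Rightarrow> (real^'n \<Rightarrow> real) \<Rightarrow> real" where
  "L2_norm B g = sqrt (\<integral>x. \<bar>g x\<bar>\<^sup>2 \<partial>unif_meas B)"

text \<open>
  The Bochner integral of a non-integrable function is 0, so a bound on the norm has to assert
  square integrability as well.
\<close>

definition L2_norm_le :: "(real^'n::finite) set \<Rightarrow> (real^'n \<Rightarrow> real) \<Rightarrow> real \<Rightarrow> bool" where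
  "L2_norm_le B g c \<longleftrightarrow>
     g \<in> borel_measurable (unif_meas B) \<and>
     integrable (unif_meas B) (\<lambda>x. \<bar>g x\<bar>\<^sup>2) \<and>
     L2_norm B g \<le> c"

definition E_const :: "(real^'n::finite) set \<Rightarrow> real" where
  "E_const B = sqrt (\<integral>x. (norm (lift1 x))\<^sup>2 \<partial>unif_meas B)"

definition bump_eta :: real where
  "bump_eta = inverse (LINT y:{-1<..<1}|lborel. exp (- 1 / (1 - y\<^sup>2)))"

definition moll_delta :: "real \<Rightarrow> 'n::finite param \<Rightarrow> real" where
  "moll_delta lam \<gamma> =
     (if (\<forall>i. fst \<gamma> $ i \<in> {-1/lam<..<1/lam}) \<and> snd \<gamma> \<in> {-1/lam<..<1/lam}
      then (bump_eta * lam) ^ (CARD('n) + 1)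
           * (\<Prod>i\<in>UNIV. exp (- 1 / (1 - lam\<^sup>2 * (fst \<gamma> $ i)\<^sup>2)))
           * exp (- 1 / (1 - lam\<^sup>2 * (snd \<gamma>)\<^sup>2))
      else 0)"

definition cube :: "real \<Rightarrow> 'n::finite param set" where
  "cube r = {\<kappa>. (\<forall>i. fst \<kappa> $ i \<in> {-r..r}) \<and> snd \<kappa> \<in> {-r..r}}"

definition expanded :: "real \<Rightarrow> 'n::finite param set \<Rightarrow> 'n param set" where
  "expanded lam \<Upsilon> = {\<gamma> + \<kappa> | \<gamma> \<kappa>. \<gamma> \<in> closure \<Upsilon> \<and> \<kappa> \<in> cube (1/lam)}"

definition mollified_net ::
    "real \<Rightarrow> 'n::finite param set \<Rightarrow> (real \<Rightarrow> real) \<Rightarrow> nat \<Rightarrow> (nat \<Rightarrow> real) \<Rightarrow> (nat \<Rightarrow> 'n param)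
      \<Rightarrow> real^'n \<Rightarrow> real" where
  "mollified_net lam \<Upsilon> \<sigma> N \<theta> \<gamma> x =
     (LINT \<phi>:expanded lam \<Upsilon>|lebesgue.
        (\<Sum>i=1..N. \<theta> i * moll_delta lam (\<phi> - \<gamma> i) * \<sigma> (\<phi> \<bullet> lift1 x)))"

text \<open>
  The set \<open>I\<close> on which \<open>\<sigma>\<close> is controlled is taken with \<open>U = expanded lam \<Upsilon>\<close> in the theorem: the mollified
  and the random approximation evaluate \<open>\<sigma>\<close> at \<open>\<gamma> \<bullet> lift1 x\<close> for all \<open>\<gamma> \<in> U\<close>. Conditions on the
  preactivations of \<open>\<Upsilon>\<close> alone would leave these values unconstrained, and the bounds would fail.
\<close>

definition preactivations :: "'n::finite param set \<Rightarrow> (real^'n) set \<Rightarrow> real set" where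
  "preactivations U B = {\<gamma> \<bullet> lift1 x | \<gamma> x. \<gamma> \<in> U \<and> x \<in> B}"

definition oscillation_cond :: "(real \<Rightarrow> real) \<Rightarrow> real set \<Rightarrow> real \<Rightarrow> bool" where
  "oscillation_cond \<sigma> I D \<longleftrightarrow> 0 < D \<and> (\<forall>u\<in>I. \<forall>v\<in>I. \<bar>\<sigma> u - \<sigma> v\<bar> \<le> D)"

definition lipschitz_cond :: "(real \<Rightarrow> real) \<Rightarrow> real set \<Rightarrow> real \<Rightarrow> bool" where
  "lipschitz_cond \<sigma> I L \<longleftrightarrow> 0 < L \<and> (\<forall>u\<in>I. \<forall>v\<in>I. \<bar>\<sigma> u - \<sigma> v\<bar> \<le> L * \<bar>u - v\<bar>)"

definition density_on :: "'n::finite param set \<Rightarrow> ('n param \<Rightarrow> real) \<Rightarrow> bool" where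
  "density_on U P \<longleftrightarrow>
     P \<in> borel_measurable borel \<and> (\<forall>\<gamma>. 0 \<le> P \<gamma>) \<and> (\<forall>\<gamma>. \<gamma> \<notin> U \<longrightarrow> P \<gamma> = 0) \<and>
     (\<integral>\<^sup>+\<gamma>. ennreal (P \<gamma>) \<partial>lborel) = 1"

definition iid_samples ::
    "'w measure \<Rightarrow> nat \<Rightarrow> (nat \<Rightarrow> 'w \<Rightarrow> 'n::finite param) \<Rightarrow> ('n param \<Rightarrow> real) \<Rightarrow> bool" where
  "iid_samples M R \<Gamma> P \<longleftrightarrow>
     prob_space M \<and>
     prob_space.indep_vars M (\<lambda>_. borel) \<Gamma> {1..R} \<and>
     (\<forall>j\<in>{1..R}. distributed M lborel (\<Gamma> j) (\<lambda>\<gamma>. ennreal (P \<gamma>)))"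

definition P_min :: "'n::finite param set \<Rightarrow> ('n param \<Rightarrow> real) \<Rightarrow> real" where
  "P_min U P = (INF \<gamma>\<in>U. P \<gamma>)"

definition gamma_max :: "'n::finite param set \<Rightarrow> real" where
  "gamma_max U = (SUP \<gamma>\<in>U. norm \<gamma>)"

definition g_max :: "'n::finite itself \<Rightarrow> real \<Rightarrow> nat \<Rightarrow> (nat \<Rightarrow> real) \<Rightarrow> real" where
  "g_max _ lam N \<theta> = (\<Sum>i=1..N. \<bar>\<theta> i\<bar> * (bump_eta * lam / exp 1) ^ (CARD('n) + 1))"

definition K_osc ::
    "'n::finite param set \<Rightarrow> ('n param \<Rightarrow> real) \<Rightarrow> (real \<Rightarrow> real) \<Rightarrow> real \<Rightarrow> real \<Rightarrow> real" where
  "K_osc U P \<sigma> D \<nu> =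
     bump_eta ^ (CARD('n) + 1) / (exp 1 ^ (CARD('n) + 1) * P_min U P)
     * (1 + \<bar>\<sigma> 0\<bar> / D + (3 + 2 * (\<bar>\<sigma> 0\<bar> / D)) * sqrt (1/2 * ln (1/\<nu>)))"

definition K_lip ::
    "'n::finite param set \<Rightarrow> (real^'n) set \<Rightarrow> ('n param \<Rightarrow> real) \<Rightarrow> (real \<Rightarrow> real) \<Rightarrow> real \<Rightarrow> real
      \<Rightarrow> real" where
  "K_lip U B P \<sigma> L \<nu> =
     bump_eta ^ (CARD('n) + 1) / (exp 1 ^ (CARD('n) + 1) * P_min U P)
     * (gamma_max U * E_const B + \<bar>\<sigma> 0\<bar> / L
        + ((diameter U + 2 * gamma_max U) * E_const B + 2 * (\<bar>\<sigma> 0\<bar> / L)) * sqrt (1/2 * ln (1/\<nu>)))"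

end

theory Submission
  imports Defs
begin

text \<open>
  Mollification replaces \<open>\<sigma> (\<gamma> i \<bullet> X)\<close> by an average of \<open>\<sigma> (\<phi> \<bullet> X)\<close> over the cube of half-width \<open>1 / lam\<close>
  around \<open>\<gamma> i\<close>, because \<open>moll_delta lam\<close> is a probability density on that cube. The error at \<open>x\<close> is
  therefore at most \<open>\<Sum>\<bar>\<theta> i\<bar>\<close> times the variation of \<open>\<sigma>\<close> over the cube, which is \<open>D\<close> or
  \<open>L * sqrt (n + 1) / lam * \<parallel>X\<parallel>\<close> (lemma \<open>mollification_error\<close>).

  For the random approximation the coefficients may be any function of the samples that respects the
  bound \<open>g_max / (P_min * R)\<close>. The activation is controlled on the preactivations only through
  differences of its values, and \<open>0\<close> need not be a preactivation. The coefficients constructed below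
  therefore sum up to exactly \<open>\<Sum>\<theta> i\<close>, so that adding a constant to \<open>\<sigma>\<close> does not change the error.

  If \<open>\<sigma>\<close> has bounded oscillation, the equal coefficients \<open>(\<Sum>\<theta> i) / R\<close> do, for all samples in \<open>U\<close>. They are
  admissible because a density on a set that contains a cube satisfies \<open>P_min * (2 / lam)^(n+1) \<le> 1\<close>,
  while \<open>bump_eta / e \<ge> 3 / 4 > 1 / 2\<close>.

  If \<open>\<sigma>\<close> is Lipschitz, consider the smallest error \<open>Z\<close> over all admissible coefficient vectors. Moving
  one sample within \<open>U\<close> changes \<open>Z\<close> by at most \<open>(g_max / (P_min * R)) * L * diameter U * E_const B\<close>, so
  McDiarmid's inequality bounds the probability that \<open>Z\<close> exceeds its mean. The mean is estimated with
  explicit coefficients: importance weights for the uniform density on the cubes, moved towards a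
  common value until their sum is right (lemma \<open>reweight_to_mean\<close>). The bias of these weights is the
  mollification error, their fluctuation contributes a standard deviation, and the correction of the
  sum contributes a second one of the same size. The resulting factor 2 is paid for by the choice of
  the kernel: the uniform density on a cube is smaller than the maximum of \<open>moll_delta\<close>, to which
  \<open>g_max\<close> refers, by the factor \<open>(2 * bump_eta / e)^(n+1) \<ge> 2\<close>.

  If \<open>\<sigma>\<close> satisfies both conditions, the same coefficients have to obey both bounds. The bounds do not
  depend on the samples, so it suffices to use the construction that belongs to the smaller one.
\<close>

section \<open>The mean square norm on the domain\<close>

lemma norm_lift1_ge_1: "1 \<le> norm (lift1 x)"
  by (metis lift1_def norm_one norm_snd_le)

locale unif_domain =
  fixes B :: "(real^'n::finite) set"
  assumes bounded_domain: "bounded B" and sets_domain: "B \<in> sets lebesgue"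
    and pos_domain: "emeasure lebesgue B > 0"
begin

lemma emeasure_domain_finite: "emeasure lebesgue B < \<infinity>"
  using sets_domain
  by (metis bounded_set_imp_lmeasurable bounded_domain fmeasurableD2 infinity_ennreal_def less_top)

lemma space_unif [simp]: "space (unif_meas B) = B"
  by (simp add: unif_meas_def)

lemma sets_unif: "sets (unif_meas B) = sets (lebesgue_on B)"
  by (simp add: unif_meas_def)

lemma measurable_unif_iff: "g \<in> borel_measurable (unif_meas B) \<longleftrightarrow> g \<in> borel_measurable (lebesgue_on B)"
  by (simp add: measurable_cong_sets[OF sets_unif refl])

lemma prob_space_unif: "prob_space (unif_meas B)"
  unfolding unif_meas_def
proof (rule prob_space_uniform_measure)
  have "emeasure (lebesgue_on B) B = emeasure lebesgue B"
    using sets_domain by (simp add: emeasure_restrict_space)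
  then show "emeasure (lebesgue_on B) B \<noteq> 0" "emeasure (lebesgue_on B) B \<noteq> \<infinity>"
    using pos_domain emeasure_domain_finite by auto
qed

sublocale unif: prob_space "unif_meas B" by (rule prob_space_unif)

lemma prob_domain [simp]: "unif.prob B = 1"
  using unif.prob_space by simp

lemma measurable_ident_unif [measurable]: "(\<lambda>x. x) \<in> unif_meas B \<rightarrow>\<^sub>M borel"
proof -
  have "(\<lambda>x. x) \<in> lebesgue_on B \<rightarrow>\<^sub>M borel"
    by (intro measurable_restrict_space1 measurable_completion) simp
  then show ?thesis by (simp add: measurable_unif_iff)
qed

lemma borel_measurable_unifI: "g \<in> borel_measurable borel \<Longrightarrow> g \<in> borel_measurable (unif_meas B)"
  using measurable_compose[OF measurable_ident_unif] by blast

lemma lift1_bounded: obtains C where "C > 0" "\<And>x. x \<in> B \<Longrightarrow> norm (lift1 x) \<le> C"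
proof -
  obtain b where b: "\<And>x. x \<in> B \<Longrightarrow> norm x \<le> b" using bounded_domain by (auto simp: bounded_iff)
  have "norm (lift1 x) \<le> \<bar>b\<bar> + 1" if "x \<in> B" for x :: "real^'n"
    using norm_Pair_le[of x "1::real"] b[OF that] by (simp add: lift1_def)
  then show ?thesis by (intro that[of "\<bar>b\<bar> + 1"]) auto
qed

lemma L2_norm_nonneg: "0 \<le> L2_norm B g"
  by (simp add: L2_norm_def)

lemma L2_norm_le_nonneg: "L2_norm_le B g c \<Longrightarrow> 0 \<le> c"
  using L2_norm_nonneg[of g] by (auto simp: L2_norm_le_def)

lemma L2_norm_le_weaken: "L2_norm_le B g c \<Longrightarrow> c \<le> d \<Longrightarrow> L2_norm_le B g d"
  by (auto simp: L2_norm_le_def)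

lemma L2_norm_le_square:
  "L2_norm_le B g c \<longleftrightarrow> 0 \<le> c \<and> g \<in> borel_measurable (unif_meas B) \<and>
     integrable (unif_meas B) (\<lambda>x. (g x)\<^sup>2) \<and> (\<integral>x. (g x)\<^sup>2 \<partial>unif_meas B) \<le> c\<^sup>2"
proof -
  have "L2_norm B g \<le> c \<longleftrightarrow> 0 \<le> c \<and> (\<integral>x. (g x)\<^sup>2 \<partial>unif_meas B) \<le> c\<^sup>2"
    using order_trans[OF L2_norm_nonneg[of g], of c]
    by (auto simp: L2_norm_def intro: real_le_lsqrt dest: sqrt_le_D)
  then show ?thesis by (auto simp: L2_norm_le_def)
qed

lemma L2_norm_le_mono:
  assumes h: "L2_norm_le B h c" and g: "g \<in> borel_measurable (unif_meas B)"
    and le: "\<And>x. x \<in> B \<Longrightarrow> \<bar>g x\<bar> \<le> h x"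
  shows "L2_norm_le B g c"
proof -
  have sq: "(g x)\<^sup>2 \<le> (h x)\<^sup>2" if "x \<in> B" for x
    using le[OF that] by (simp add: abs_le_square_iff[symmetric])
  have h2: "integrable (unif_meas B) (\<lambda>x. (h x)\<^sup>2)" using h by (simp add: L2_norm_le_square)
  have g2: "integrable (unif_meas B) (\<lambda>x. (g x)\<^sup>2)"
    by (rule Bochner_Integration.integrable_bound[OF h2]) (use g sq in auto)
  have "(\<integral>x. (g x)\<^sup>2 \<partial>unif_meas B) \<le> (\<integral>x. (h x)\<^sup>2 \<partial>unif_meas B)"
    by (intro integral_mono g2 h2) (use sq in auto)
  then show ?thesis using h g g2 by (auto simp: L2_norm_le_square)
qed

lemma L2_norm_le_cong:
  assumes "L2_norm_le B h c" and "\<And>x. x \<in> B \<Longrightarrow> g x = h x"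
  shows "L2_norm_le B g c"
proof -
  have "g \<in> borel_measurable (unif_meas B) \<longleftrightarrow> h \<in> borel_measurable (unif_meas B)"
    by (rule measurable_cong) (simp add: assms)
  moreover have "integrable (unif_meas B) (\<lambda>x. (g x)\<^sup>2) \<longleftrightarrow> integrable (unif_meas B) (\<lambda>x. (h x)\<^sup>2)"
    by (rule Bochner_Integration.integrable_cong) (simp_all add: assms)
  moreover have "(\<integral>x. (g x)\<^sup>2 \<partial>unif_meas B) = (\<integral>x. (h x)\<^sup>2 \<partial>unif_meas B)"
    by (rule Bochner_Integration.integral_cong) (simp_all add: assms)
  ultimately show ?thesis using assms(1) by (simp add: L2_norm_le_square)
qed

lemma L2_norm_le_const: "0 \<le> c \<Longrightarrow> L2_norm_le B (\<lambda>_. c) c"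
  by (simp add: L2_norm_le_square unif.prob_space)

lemma borel_measurable_norm_lift1 [measurable]: "(\<lambda>x. norm (lift1 x)) \<in> borel_measurable (unif_meas B)"
  by (intro borel_measurable_unifI borel_measurable_continuous_onI) (auto simp: lift1_def intro!: continuous_intros)

lemma integrable_norm_lift1_square: "integrable (unif_meas B) (\<lambda>x. (norm (lift1 x))\<^sup>2)"
proof -
  obtain C where "C > 0" "\<And>x. x \<in> B \<Longrightarrow> norm (lift1 x) \<le> C" by (rule lift1_bounded) blast
  then have "(norm (lift1 x))\<^sup>2 \<le> C\<^sup>2" if "x \<in> B" for x
    using that by (intro power_mono) auto
  then show ?thesis by (intro unif.integrable_const_bound[where B = "C\<^sup>2"] AE_I2) auto
qed

lemma E_const_square: "(E_const B)\<^sup>2 = (\<integral>x. (norm (lift1 x))\<^sup>2 \<partial>unif_meas B)"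
  by (simp add: E_const_def)

lemma E_const_ge_1: "1 \<le> E_const B"
proof -
  have "(\<integral>x. 1 \<partial>unif_meas B) \<le> (\<integral>x. (norm (lift1 x))\<^sup>2 \<partial>unif_meas B)"
    by (intro integral_mono integrable_norm_lift1_square) (auto simp: norm_lift1_ge_1)
  then show ?thesis by (simp add: E_const_def unif.prob_space)
qed

lemma L2_norm_le_lift1:
  assumes "0 \<le> K" and "g \<in> borel_measurable (unif_meas B)"
    and "\<And>x. x \<in> B \<Longrightarrow> \<bar>g x\<bar> \<le> K * norm (lift1 x)"
  shows "L2_norm_le B g (K * E_const B)"
proof (rule L2_norm_le_mono[OF _ assms(2,3)])
  show "L2_norm_le B (\<lambda>x. K * norm (lift1 x)) (K * E_const B)"
    using assms(1) integrable_norm_lift1_square E_const_ge_1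
    by (auto simp: L2_norm_le_square power_mult_distrib E_const_square)
qed

text \<open>
  The weighted inequality \<open>(a + b)\<^sup>2 \<le> (1 + q/p) a\<^sup>2 + (1 + p/q) b\<^sup>2\<close> is sharp for \<open>a : b = p : q\<close>; it yields the
  triangle inequality without a detour through the Cauchy-Schwarz inequality.
\<close>

lemma square_add_le_weighted:
  fixes a b p q :: real
  assumes "p > 0" "q > 0"
  shows "(a + b)\<^sup>2 \<le> (1 + q / p) * a\<^sup>2 + (1 + p / q) * b\<^sup>2"
proof -
  have "0 \<le> (q * a - p * b)\<^sup>2 / (p * q)" using assms by simp
  also have "\<dots> = (1 + q / p) * a\<^sup>2 + (1 + p / q) * b\<^sup>2 - (a + b)\<^sup>2"
    using assms by (simp add: divide_simps power2_eq_square) algebra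
  finally show ?thesis by simp
qed

lemma weighted_squares_eq:
  fixes p q :: real
  assumes "p > 0" "q > 0"
  shows "(1 + q / p) * p\<^sup>2 + (1 + p / q) * q\<^sup>2 = (p + q)\<^sup>2"
  using assms by (simp add: divide_simps power2_eq_square) algebra

text \<open>
  Choosing the weights from upper bounds \<open>p'\<close>, \<open>q'\<close> of the two norms makes the weighted inequality
  add up to \<open>(p' + q')\<^sup>2\<close>; strict upper bounds keep the quotients defined when a norm is zero.
\<close>

lemma L2_norm_le_add:
  assumes g: "L2_norm_le B g p" and h: "L2_norm_le B h q"
  shows "L2_norm_le B (\<lambda>x. g x + h x) (p + q)"
proof -
  note gm [measurable] = g[unfolded L2_norm_le_square, THEN conjunct2, THEN conjunct1]
  note hm [measurable] = h[unfolded L2_norm_le_square, THEN conjunct2, THEN conjunct1]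
  have g2: "integrable (unif_meas B) (\<lambda>x. (g x)\<^sup>2)" and h2: "integrable (unif_meas B) (\<lambda>x. (h x)\<^sup>2)"
    using g h by (auto simp: L2_norm_le_square)
  have int: "integrable (unif_meas B) (\<lambda>x. (g x + h x)\<^sup>2)"
  proof (rule Bochner_Integration.integrable_bound)
    show "integrable (unif_meas B) (\<lambda>x. 2 * (g x)\<^sup>2 + 2 * (h x)\<^sup>2)" using g2 h2 by simp
    show "AE x in unif_meas B. norm ((g x + h x)\<^sup>2) \<le> norm (2 * (g x)\<^sup>2 + 2 * (h x)\<^sup>2)"
      using square_add_le_weighted[of 1 1] by auto
  qed measurable
  have "L2_norm_le B (\<lambda>x. g x + h x) (p' + q')" if p': "p' > p" and q': "q' > q" for p' q'
  proof -
    have pos: "p' > 0" "q' > 0" using p' q' L2_norm_le_nonneg[OF g] L2_norm_le_nonneg[OF h] by auto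
    have "(\<integral>x. (g x + h x)\<^sup>2 \<partial>unif_meas B)
        \<le> (\<integral>x. (1 + q' / p') * (g x)\<^sup>2 + (1 + p' / q') * (h x)\<^sup>2 \<partial>unif_meas B)"
      using g2 h2 int square_add_le_weighted[OF pos] by (intro integral_mono) auto
    also have "\<dots> = (1 + q' / p') * (\<integral>x. (g x)\<^sup>2 \<partial>unif_meas B)
                   + (1 + p' / q') * (\<integral>x. (h x)\<^sup>2 \<partial>unif_meas B)"
      using g2 h2 by simp
    also have "\<dots> \<le> (1 + q' / p') * p'\<^sup>2 + (1 + p' / q') * q'\<^sup>2"
      using L2_norm_le_weaken[OF g, of p'] L2_norm_le_weaken[OF h, of q'] p' q' pos
      by (intro add_mono mult_left_mono) (auto simp: L2_norm_le_square)
    also have "\<dots> = (p' + q')\<^sup>2" by (rule weighted_squares_eq[OF pos])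
    finally show ?thesis using int pos by (simp add: L2_norm_le_square)
  qed
  from this[of "p + e / 2" "q + e / 2" for e]
  have "L2_norm B (\<lambda>x. g x + h x) \<le> p + q + e" if "e > 0" for e
    using that by (simp add: L2_norm_le_def algebra_simps)
  then have "L2_norm B (\<lambda>x. g x + h x) \<le> p + q" by (rule field_le_epsilon)
  then show ?thesis using int by (simp add: L2_norm_le_def)
qed

end

section \<open>Measurability of hidden units\<close>

text \<open>
  Translating along \<open>v\<close> does not change the measure of the preimage \<open>E\<close> but shifts the argument of \<open>C\<close>.
  The integral of the constant \<open>emeasure lborel E\<close> over all shifts \<open>t\<close> is thus, by Fubini, an integral of
  measures of translates of \<open>C\<close>, that is, zero.
\<close>

lemma null_sets_affine_preimage:
  fixes v :: "'a::euclidean_space" and c :: real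
  assumes v: "v \<noteq> 0" and C: "C \<in> null_sets lborel"
  shows "{y. y \<bullet> v + c \<in> C} \<in> null_sets lborel"
proof -
  have [measurable]: "C \<in> sets borel" using C by auto
  have aff [measurable]: "(\<lambda>y. y \<bullet> v + c) \<in> borel_measurable borel" by measurable
  have E [measurable]: "{y. y \<bullet> v + c \<in> C} \<in> sets borel"
    using measurable_sets[OF aff \<open>C \<in> sets borel\<close>] by (simp add: vimage_def)
  let ?E = "{y. y \<bullet> v + c \<in> C}"
  have shift: "emeasure lborel ?E = (\<integral>\<^sup>+y. indicator C (y \<bullet> v + c + t) \<partial>lborel)" for t
  proof -
    define w where "w = (t / (v \<bullet> v)) *\<^sub>R v"
    have w: "w \<bullet> v = t" using v by (simp add: w_def)
    have "emeasure lborel ?E = (\<integral>\<^sup>+y. indicator C (y \<bullet> v + c) \<partial>(distr lborel borel ((+) w)))"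
      by (simp add: lborel_distr_plus nn_integral_indicator[symmetric] del: nn_integral_indicator)
        (simp add: indicator_def)
    also have "\<dots> = (\<integral>\<^sup>+y. indicator C ((w + y) \<bullet> v + c) \<partial>lborel)"
      by (subst nn_integral_distr) auto
    also have "\<dots> = (\<integral>\<^sup>+y. indicator C (y \<bullet> v + c + t) \<partial>lborel)"
      by (intro nn_integral_cong) (simp add: inner_add_left w algebra_simps)
    finally show ?thesis .
  qed
  have slice: "(\<integral>\<^sup>+t. indicator C (a + t) \<partial>lborel) = 0" for a :: real
  proof -
    have "(\<integral>\<^sup>+t. indicator C (a + t) \<partial>lborel) = (\<integral>\<^sup>+t. indicator C t \<partial>(distr lborel borel ((+) a)))"
      by (subst nn_integral_distr) auto
    also have "\<dots> = emeasure lborel C" by (simp add: lborel_distr_plus)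
    finally show ?thesis using C by auto
  qed
  have "(\<integral>\<^sup>+(t::real). emeasure lborel ?E \<partial>lborel)
      = (\<integral>\<^sup>+(t::real). (\<integral>\<^sup>+y. indicator C (y \<bullet> v + c + t) \<partial>lborel) \<partial>lborel)"
    by (intro nn_integral_cong shift)
  also have "\<dots> = (\<integral>\<^sup>+y. (\<integral>\<^sup>+(t::real). indicator C (y \<bullet> v + c + t) \<partial>lborel) \<partial>lborel)"
    by (intro lborel_pair.Fubini') measurable
  also have "\<dots> = 0" by (simp add: slice)
  finally have "emeasure lborel ?E * \<infinity> = 0" by simp
  then have "emeasure lborel ?E = 0" by (auto simp: ennreal_mult_eq_top_iff)
  then show ?thesis using E by (simp add: null_sets_def)
qed

text \<open>
  An almost everywhere continuous function need not be Borel measurable. Its restriction to the Borel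
  set of its points of continuity is, and this set has a null complement.
\<close>

lemma AE_continuous_borel_representative:
  fixes \<sigma> :: "real \<Rightarrow> real"
  assumes "AE u in lebesgue. isCont \<sigma> u"
  obtains \<tau> C where "\<tau> \<in> borel_measurable borel" "C \<in> null_sets lborel" "\<And>u. u \<notin> C \<Longrightarrow> \<sigma> u = \<tau> u"
proof
  let ?\<tau> = "\<lambda>u. if isCont \<sigma> u then \<sigma> u else 0"
  have "continuous_on {u. isCont \<sigma> u} \<sigma>"
    by (simp add: continuous_at_imp_continuous_on)
  then have "\<sigma> \<in> borel_measurable (restrict_space borel {u. isCont \<sigma> u})"
    by (rule borel_measurable_continuous_on_restrict)
  then show "?\<tau> \<in> borel_measurable borel"
    by (subst measurable_If_restrict_space_iff) auto
  have "AE u in lborel. isCont \<sigma> u" using assms by (simp add: AE_completion_iff)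
  moreover have "{u. \<not> isCont \<sigma> u} \<in> sets lborel" by measurable
  ultimately show "{u. \<not> isCont \<sigma> u} \<in> null_sets lborel"
    by (simp add: AE_iff_null_sets)
qed auto

context unif_domain
begin

text \<open>
  The weight vector \<open>fst \<phi>\<close> may vanish, and then the unit is constant in \<open>x\<close>. Otherwise the null set on
  which \<open>\<sigma>\<close> differs from its Borel representative pulls back to a null set.
\<close>

lemma borel_measurable_unit:
  fixes \<sigma> :: "real \<Rightarrow> real"
  assumes "AE u in lebesgue. isCont \<sigma> u"
  shows "(\<lambda>x. \<sigma> (\<phi> \<bullet> lift1 x)) \<in> borel_measurable (unif_meas B)"
proof (cases "fst \<phi> = 0")
  case True
  then have "(\<lambda>x. \<sigma> (\<phi> \<bullet> lift1 x)) = (\<lambda>_. \<sigma> (snd \<phi>))" by (auto simp: lift1_def inner_prod_def)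
  then show ?thesis by simp
next
  case False
  obtain \<tau> C where \<tau>: "\<tau> \<in> borel_measurable borel" and C: "C \<in> null_sets lborel"
    and eq: "\<And>u. u \<notin> C \<Longrightarrow> \<sigma> u = \<tau> u"
    using AE_continuous_borel_representative[OF assms] by metis
  have "AE x in lborel. x \<bullet> fst \<phi> + snd \<phi> \<notin> C"
    using AE_not_in[OF null_sets_affine_preimage[OF False C, of "snd \<phi>"]] by simp
  then have ae: "AE x in lebesgue. \<tau> (\<phi> \<bullet> lift1 x) = \<sigma> (\<phi> \<bullet> lift1 x)"
    by (intro AE_completion) (auto simp: lift1_def inner_prod_def inner_commute eq)
  have "(\<lambda>x. \<tau> (\<phi> \<bullet> lift1 x)) \<in> borel_measurable borel"
    using \<tau> by (simp add: lift1_def inner_prod_def)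
  then have "(\<lambda>x. \<tau> (\<phi> \<bullet> lift1 x)) \<in> borel_measurable lebesgue"
    by (intro measurable_completion) simp
  then have "(\<lambda>x. \<sigma> (\<phi> \<bullet> lift1 x)) \<in> borel_measurable lebesgue"
    by (rule borel_measurable_AE[OF _ ae])
  then show ?thesis by (simp add: measurable_unif_iff measurable_restrict_space1)
qed

lemma borel_measurable_shallow_net:
  assumes "AE u in lebesgue. isCont \<sigma> u"
  shows "shallow_net \<sigma> N \<theta> \<gamma> \<in> borel_measurable (unif_meas B)"
  unfolding shallow_net_def[abs_def]
  by (intro borel_measurable_sum borel_measurable_times borel_measurable_const borel_measurable_unit assms)

end

section \<open>The bump function and cubes of parameters\<close>

definition bump_mass :: real where
  "bump_mass = (LINT y:{-1<..<1}|lborel. exp (- 1 / (1 - y\<^sup>2)))"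

lemma square_less_1: "- 1 < y \<Longrightarrow> y < 1 \<Longrightarrow> y\<^sup>2 < (1::real)"
  by (simp add: abs_square_less_1 abs_less_iff)

lemma set_integrable_bump: "set_integrable lborel {-1<..<1} (\<lambda>y::real. exp (- 1 / (1 - y\<^sup>2)))"
  unfolding set_integrable_def
proof (rule Bochner_Integration.integrable_bound)
  show "integrable lborel (indicator {-1<..<1::real} :: real \<Rightarrow> real)" by simp
  show "AE y::real in lborel. norm (indicat_real {-1<..<1} y *\<^sub>R exp (- 1 / (1 - y\<^sup>2))) \<le> norm (indicat_real {-1<..<1} y)"
  proof (rule AE_I2)
    fix y :: real
    show "norm (indicat_real {-1<..<1} y *\<^sub>R exp (- 1 / (1 - y\<^sup>2))) \<le> norm (indicat_real {-1<..<1} y)"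
      using square_less_1[of y] by (cases "y \<in> {-1<..<1}") auto
  qed
qed measurable

lemma bump_mass_pos: "bump_mass > 0"
proof -
  have "(LINT y:{-1/2..1/2::real}|lborel. exp (- 4 / 3)) \<le> bump_mass"
    unfolding bump_mass_def set_lebesgue_integral_def
  proof (rule integral_mono)
    show "integrable lborel (\<lambda>y::real. indicat_real {-1<..<1} y *\<^sub>R exp (- 1 / (1 - y\<^sup>2)))"
      using set_integrable_bump unfolding set_integrable_def .
    fix y :: real
    show "indicator {-1/2..1/2} y *\<^sub>R exp (- 4 / 3 :: real) \<le> indicator {-1<..<1} y *\<^sub>R exp (- 1 / (1 - y\<^sup>2))"
    proof (cases "y \<in> {-1/2..1/2}")
      case True
      then have "\<bar>y\<bar> \<le> 1/2" by auto
      then have "\<bar>y\<bar>\<^sup>2 \<le> (1/2)\<^sup>2" by (intro power_mono) auto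
      then have "y\<^sup>2 \<le> 1/4" by (simp add: power2_eq_square)
      then have "1 / (1 - y\<^sup>2) \<le> 4 / 3" by (simp add: field_simps)
      then show ?thesis using True by (simp add: indicator_def)
    qed simp
  qed simp
  moreover have "(LINT y:{-1/2..1/2::real}|lborel. exp (- 4 / 3 :: real)) > 0"
    by (simp add: set_lebesgue_integral_def)
  ultimately show ?thesis by linarith
qed

text \<open>
  For \<open>z = y\<^sup>2 / (1 - y\<^sup>2)\<close> the bound \<open>1 + z \<le> exp z\<close> reads \<open>exp (- 1 / (1 - y\<^sup>2)) \<le> (1 - y\<^sup>2) / e\<close>, and the
  right-hand side integrates to \<open>4 / (3 e)\<close>.
\<close>

lemma bump_mass_le: "bump_mass \<le> 4 / (3 * exp 1)"
proof -
  have bound: "exp (- 1 / (1 - y\<^sup>2)) \<le> (1 - y\<^sup>2) / exp 1" if "y \<in> {-1<..<1}" for y :: real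
  proof -
    have pos: "1 - y\<^sup>2 > 0" using that by (simp add: square_less_1)
    define z where "z = y\<^sup>2 / (1 - y\<^sup>2)"
    have z: "1 + z = 1 / (1 - y\<^sup>2)" using pos by (simp add: z_def field_simps)
    have "1 / (1 - y\<^sup>2) \<le> exp z" using exp_ge_add_one_self[of z] z by simp
    then have "1 / exp z \<le> 1 - y\<^sup>2" using pos by (simp add: field_simps)
    moreover have "exp (- 1 / (1 - y\<^sup>2)) = 1 / exp z / exp 1"
    proof -
      have "- 1 / (1 - y\<^sup>2) = - z + - 1" using z by simp
      then show ?thesis by (simp only: exp_add) (simp add: exp_minus field_simps)
    qed
    ultimately show ?thesis by (simp only: divide_right_mono exp_ge_zero)
  qed
  have ftc: "has_bochner_integral lborel (\<lambda>y. ((1 - y\<^sup>2) / exp 1) * indicator {-1..1::real} y)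
          ((1 - 1 ^ 3 / 3) / exp 1 - (- 1 - (- 1) ^ 3 / 3) / exp 1)"
    by (rule has_bochner_integral_FTC_Icc_real[where F = "\<lambda>y. (y - y ^ 3 / 3) / exp 1"])
      (auto intro!: derivative_eq_intros continuous_intros)
  have "bump_mass \<le> (\<integral>y. ((1 - y\<^sup>2) / exp 1) * indicator {-1..1::real} y \<partial>lborel)"
    unfolding bump_mass_def set_lebesgue_integral_def
  proof (rule integral_mono)
    show "integrable lborel (\<lambda>y::real. indicat_real {-1<..<1} y *\<^sub>R exp (- 1 / (1 - y\<^sup>2)))"
      using set_integrable_bump unfolding set_integrable_def .
    show "integrable lborel (\<lambda>y. ((1 - y\<^sup>2) / exp 1) * indicator {-1..1::real} y)"
      using ftc by (rule integrable.intros)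
    fix y :: real
    show "indicator {-1<..<1} y *\<^sub>R exp (- 1 / (1 - y\<^sup>2)) \<le> ((1 - y\<^sup>2) / exp 1) * indicator {-1..1} y"
      using bound[of y] by (auto simp: indicator_def abs_square_le_1)
  qed
  also have "\<dots> = 4 / (3 * exp 1)"
    using has_bochner_integral_integral_eq[OF ftc] by (simp add: field_simps)
  finally show ?thesis .
qed

lemma bump_eta_eq: "bump_eta = 1 / bump_mass"
  by (simp add: bump_eta_def bump_mass_def inverse_eq_divide)

lemma bump_eta_pos: "bump_eta > 0"
  using bump_mass_pos by (simp add: bump_eta_eq)

lemma bump_eta_ge: "3 / 4 \<le> bump_eta / exp 1"
  using bump_mass_pos bump_mass_le by (simp add: bump_eta_eq field_simps)

text \<open>
  Splits a product over the standard basis of the parameter space into the weight coordinates and the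
  bias coordinate; both the volume of a cube and the mass of \<open>moll_delta\<close> are such products.
\<close>

lemma prod_Basis_param:
  fixes h :: "'n::finite param \<Rightarrow> 'b::comm_monoid_mult"
  shows "(\<Prod>b\<in>Basis. h b) = (\<Prod>i\<in>UNIV. h (axis i 1, 0)) * h (0, 1)"
proof -
  have vec: "(Basis :: (real^'n) set) = (\<lambda>i. axis i 1) ` UNIV"
    by (auto simp: Basis_vec_def)
  have inj: "inj (\<lambda>i::'n. axis i (1::real))" by (auto simp: inj_on_def axis_eq_axis)
  have "(\<Prod>b\<in>(Basis :: 'n param set). h b)
      = (\<Prod>b\<in>(\<lambda>u. (u, 0)) ` (Basis :: (real^'n) set). h b) * (\<Prod>b\<in>(\<lambda>u. (0, u)) ` (Basis :: real set). h b)"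
    unfolding Basis_prod_def by (rule prod.union_disjoint) auto
  also have "(\<Prod>b\<in>(\<lambda>u. (u, 0::real)) ` (Basis :: (real^'n) set). h b) = (\<Prod>i\<in>UNIV. h (axis i 1, 0))"
    by (subst prod.reindex) (auto simp: inj_on_def vec prod.reindex[OF inj])
  also have "(\<Prod>b\<in>(\<lambda>u. (0::real^'n, u)) ` (Basis :: real set). h b) = h (0, 1)"
    by simp
  finally show ?thesis .
qed

text \<open>
  The factor of \<open>moll_delta lam\<close> that belongs to a single coordinate.
\<close>

definition scaled_bump :: "real \<Rightarrow> real \<Rightarrow> real" where
  "scaled_bump lam t = indicator {-1/lam<..<1/lam} t * (bump_eta * lam * exp (- 1 / (1 - lam\<^sup>2 * t\<^sup>2)))"

lemma borel_measurable_scaled_bump [measurable]: "scaled_bump lam \<in> borel_measurable borel"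
  unfolding scaled_bump_def[abs_def] by measurable

lemma scaled_bump_nonneg: "lam > 0 \<Longrightarrow> 0 \<le> scaled_bump lam t"
  using bump_eta_pos by (simp add: scaled_bump_def)

lemma moll_delta_eq_prod:
  fixes \<phi> :: "'n::finite param"
  shows "moll_delta lam \<phi> = (\<Prod>b\<in>Basis. scaled_bump lam (\<phi> \<bullet> b))"
proof -
  have "(\<Prod>b\<in>Basis. scaled_bump lam (\<phi> \<bullet> b)) = (\<Prod>i\<in>UNIV. scaled_bump lam (fst \<phi> $ i)) * scaled_bump lam (snd \<phi>)"
    by (subst prod_Basis_param) (simp add: inner_prod_def inner_axis)
  also have "\<dots> = moll_delta lam \<phi>"
  proof (cases "(\<forall>i. fst \<phi> $ i \<in> {-1/lam<..<1/lam}) \<and> snd \<phi> \<in> {-1/lam<..<1/lam}")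
    case True
    then show ?thesis by (simp add: scaled_bump_def moll_delta_def prod.distrib power_mult_distrib)
  next
    case False
    then have "(\<exists>i. scaled_bump lam (fst \<phi> $ i) = 0) \<or> scaled_bump lam (snd \<phi>) = 0"
      by (auto simp: scaled_bump_def indicator_def)
    then have "(\<Prod>i\<in>UNIV. scaled_bump lam (fst \<phi> $ i)) * scaled_bump lam (snd \<phi>) = 0"
      by auto
    then show ?thesis unfolding moll_delta_def if_not_P[OF False] .
  qed
  finally show ?thesis by simp
qed

lemma nn_integral_scaled_bump:
  assumes lam: "lam > 0" shows "(\<integral>\<^sup>+t. scaled_bump lam t \<partial>lborel) = 1"
proof -
  have "(\<integral>\<^sup>+t. scaled_bump lam t \<partial>lborel) = ennreal \<bar>1 / lam\<bar> * (\<integral>\<^sup>+y. scaled_bump lam (0 + 1 / lam * y) \<partial>lborel)"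
    using lam by (intro nn_integral_real_affine) auto
  also have "(\<integral>\<^sup>+y. scaled_bump lam (0 + 1 / lam * y) \<partial>lborel)
      = (\<integral>\<^sup>+y. ennreal (bump_eta * lam) * ennreal (indicator {-1<..<1} y *\<^sub>R exp (- 1 / (1 - y\<^sup>2))) \<partial>lborel)"
  proof (rule nn_integral_cong)
    fix y :: real
    have "scaled_bump lam (0 + 1 / lam * y) = (bump_eta * lam) * (indicator {-1<..<1} y *\<^sub>R exp (- 1 / (1 - y\<^sup>2)))"
    proof -
      have "1 / lam * y \<in> {-1/lam<..<1/lam} \<longleftrightarrow> y \<in> {-1<..<1}"
        using lam divide_less_cancel[of "- 1" lam y] divide_less_cancel[of y lam 1] by auto
      moreover have "lam\<^sup>2 * (1 / lam * y)\<^sup>2 = y\<^sup>2" using lam by (simp add: power_divide)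
      ultimately show ?thesis by (simp add: scaled_bump_def indicator_def)
    qed
    then show "ennreal (scaled_bump lam (0 + 1 / lam * y))
        = ennreal (bump_eta * lam) * ennreal (indicator {-1<..<1} y *\<^sub>R exp (- 1 / (1 - y\<^sup>2)))"
      using bump_eta_pos lam by (simp add: ennreal_mult)
  qed
  also have "\<dots> = ennreal (bump_eta * lam) * (\<integral>\<^sup>+y. ennreal (indicator {-1<..<1} y *\<^sub>R exp (- 1 / (1 - y\<^sup>2))) \<partial>lborel)"
    by (intro nn_integral_cmult) measurable
  also have "(\<integral>\<^sup>+y. ennreal (indicator {-1<..<1} y *\<^sub>R exp (- 1 / (1 - y\<^sup>2))) \<partial>lborel) = ennreal bump_mass"
    unfolding bump_mass_def set_lebesgue_integral_def
    by (rule nn_integral_eq_integral) (use set_integrable_bump in \<open>auto simp: set_integrable_def\<close>)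
  also have "ennreal \<bar>1 / lam\<bar> * (ennreal (bump_eta * lam) * ennreal bump_mass) = 1"
    using lam bump_mass_pos by (simp add: bump_eta_eq flip: ennreal_mult)
  finally show ?thesis .
qed

lemma cube_eq_cbox: "(cube r :: 'n::finite param set) = cbox ((\<chi> i. - r), - r) ((\<chi> i. r), r)"
proof -
  have "\<kappa> \<in> cube r \<longleftrightarrow> \<kappa> \<in> cbox (\<chi> i. - r) (\<chi> i. r) \<times> cbox (- r) r" for \<kappa> :: "'n param"
    by (cases \<kappa>) (simp add: cube_def mem_box_cart)
  then show ?thesis unfolding cbox_Pair_eq by blast
qed

lemma emeasure_cube:
  assumes "r \<ge> 0"
  shows "emeasure lborel (cube r :: 'n::finite param set) = ennreal ((2 * r) ^ (CARD('n) + 1))"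
proof -
  have "(((\<chi> i. r), r) - ((\<chi> i. - r), - r) :: 'n param) = ((\<chi> i. 2 * r), 2 * r)"
    by (auto simp: vec_eq_iff)
  then have *: "(\<Prod>b\<in>Basis. (((\<chi> i. r), r) - ((\<chi> i. - r), - r) :: 'n param) \<bullet> b) = (2 * r) ^ (CARD('n) + 1)"
    by (simp add: prod_Basis_param inner_axis)
  have "emeasure lborel (cube r :: 'n param set)
      = ennreal (\<Prod>b\<in>Basis. (((\<chi> i. r), r) - ((\<chi> i. - r), - r) :: 'n param) \<bullet> b)"
    unfolding cube_eq_cbox
  proof (rule emeasure_lborel_cbox)
    fix b :: "'n param" assume "b \<in> Basis"
    then have "b = (0, 1) \<or> (\<exists>i. b = (axis i 1, 0))" by (auto simp: Basis_prod_def Basis_vec_def)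
    then show "((\<chi> i. - r), - r) \<bullet> b \<le> ((\<chi> i. r), r) \<bullet> b"
      using assms by (auto simp: inner_axis)
  qed
  then show ?thesis unfolding * .
qed

lemma norm_cube_le:
  assumes "\<kappa> \<in> (cube r :: 'n::finite param set)"
  shows "norm \<kappa> \<le> sqrt (CARD('n) + 1) * r"
proof -
  have r: "r \<ge> 0" using assms by (auto simp: cube_def)
  have sq: "t\<^sup>2 \<le> r\<^sup>2" if "t \<in> {-r..r}" for t
    using that by (intro abs_le_square_iff[THEN iffD1]) auto
  have fst: "(norm (fst \<kappa>))\<^sup>2 = (\<Sum>i\<in>UNIV. (fst \<kappa> $ i)\<^sup>2)"
    by (simp add: norm_vec_def L2_set_def sum_nonneg)
  have "(norm \<kappa>)\<^sup>2 = (\<Sum>i\<in>UNIV. (fst \<kappa> $ i)\<^sup>2) + (snd \<kappa>)\<^sup>2"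
    unfolding fst[symmetric] by (cases \<kappa>) (simp add: norm_Pair)
  also have "\<dots> \<le> (\<Sum>i\<in>(UNIV::'n set). r\<^sup>2) + r\<^sup>2"
    using assms by (intro add_mono sum_mono sq) (auto simp: cube_def)
  also have "\<dots> = (real CARD('n) + 1) * r\<^sup>2"
    by (simp add: distrib_right)
  also have "\<dots> = (sqrt (CARD('n) + 1) * r)\<^sup>2"
    by (simp add: power_mult_distrib)
  finally have "(norm \<kappa>)\<^sup>2 \<le> (sqrt (CARD('n) + 1) * r)\<^sup>2" .
  then show ?thesis by (rule power2_le_imp_le) (simp add: r)
qed

section \<open>Averaging over a cube around a parameter\<close>

definition averaging_kernel :: "real \<Rightarrow> ('n::finite param \<Rightarrow> real) \<Rightarrow> bool" where
  "averaging_kernel r k \<longleftrightarrow>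
     k \<in> borel_measurable borel \<and> (\<forall>\<phi>. 0 \<le> k \<phi>) \<and> (\<forall>\<phi>. \<phi> \<notin> cube r \<longrightarrow> k \<phi> = 0) \<and>
     (\<integral>\<^sup>+\<phi>. k \<phi> \<partial>lborel) = 1"

lemma averaging_kernel_moll_delta:
  assumes lam: "lam > 0"
  shows "averaging_kernel (1 / lam) (moll_delta lam :: 'n::finite param \<Rightarrow> real)"
  unfolding averaging_kernel_def
proof (intro conjI allI impI)
  show "moll_delta lam \<in> borel_measurable (borel :: 'n param measure)"
    unfolding moll_delta_eq_prod[abs_def] by measurable
  show "0 \<le> moll_delta lam \<phi>" for \<phi> :: "'n param"
    unfolding moll_delta_eq_prod by (intro prod_nonneg) (simp add: scaled_bump_nonneg lam)
  show "moll_delta lam \<phi> = 0" if "\<phi> \<notin> cube (1 / lam)" for \<phi> :: "'n param"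
  proof -
    have "\<not> ((\<forall>i. fst \<phi> $ i \<in> {-1/lam<..<1/lam}) \<and> snd \<phi> \<in> {-1/lam<..<1/lam})"
      using that by (auto simp: cube_def intro: less_imp_le)
    then show ?thesis unfolding moll_delta_def by (rule if_not_P)
  qed
  have "(\<integral>\<^sup>+\<phi>. moll_delta lam (\<phi> :: 'n param) \<partial>lborel)
      = (\<integral>\<^sup>+\<phi>. (\<Prod>b\<in>Basis. ennreal (scaled_bump lam (\<phi> \<bullet> b))) \<partial>(lborel :: 'n param measure))"
    by (simp add: moll_delta_eq_prod prod_ennreal scaled_bump_nonneg lam)
  also have "\<dots> = (\<Prod>b\<in>(Basis :: 'n param set). (\<integral>\<^sup>+t. ennreal (scaled_bump lam t) \<partial>lborel))"
    by (rule nn_integral_lborel_prod) auto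
  also have "\<dots> = 1" by (simp add: nn_integral_scaled_bump lam)
  finally show "(\<integral>\<^sup>+\<phi>. moll_delta lam (\<phi> :: 'n param) \<partial>lborel) = 1" .
qed

text \<open>
  The normalised indicator of the cube. Among the averaging kernels on the cube it has the smallest
  maximum, and this is what the coefficient bound of the random approximation calls for.
\<close>

definition uniform_kernel :: "real \<Rightarrow> 'n::finite param \<Rightarrow> real" where
  "uniform_kernel lam \<phi> = (lam / 2) ^ (CARD('n) + 1) * indicator (cube (1 / lam)) \<phi>"

lemma sets_cube [measurable]: "cube r \<in> sets borel"
  unfolding cube_eq_cbox by simp

lemma averaging_kernel_uniform_kernel:
  assumes lam: "lam > 0"
  shows "averaging_kernel (1 / lam) (uniform_kernel lam :: 'n::finite param \<Rightarrow> real)"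
  unfolding averaging_kernel_def
proof (intro conjI allI impI)
  show "uniform_kernel lam \<in> borel_measurable (borel :: 'n param measure)"
    unfolding uniform_kernel_def[abs_def] by measurable
  show "0 \<le> uniform_kernel lam \<phi>" for \<phi> :: "'n param"
    using lam by (simp add: uniform_kernel_def)
  show "uniform_kernel lam \<phi> = 0" if "\<phi> \<notin> cube (1 / lam)" for \<phi> :: "'n param"
    using that by (simp add: uniform_kernel_def)
  let ?d = "CARD('n) + 1"
  have "(\<integral>\<^sup>+\<phi>. uniform_kernel lam (\<phi> :: 'n param) \<partial>lborel)
      = (\<integral>\<^sup>+\<phi>. ennreal ((lam / 2) ^ ?d) * indicator (cube (1 / lam)) \<phi> \<partial>(lborel :: 'n param measure))"
    using lam by (intro nn_integral_cong) (simp add: uniform_kernel_def indicator_def)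
  also have "\<dots> = ennreal ((lam / 2) ^ ?d) * emeasure lborel (cube (1 / lam) :: 'n param set)"
    by (rule nn_integral_cmult_indicator) simp
  also have "\<dots> = ennreal ((lam / 2) ^ ?d * (2 * (1 / lam)) ^ ?d)"
    using lam by (subst emeasure_cube, simp) (rule ennreal_mult[symmetric], auto)
  also have "(lam / 2) ^ ?d * (2 * (1 / lam)) ^ ?d = (lam / 2 * (2 * (1 / lam))) ^ ?d"
    by (rule power_mult_distrib[symmetric])
  also have "lam / 2 * (2 * (1 / lam)) = 1" using lam by simp
  finally show "(\<integral>\<^sup>+\<phi>. uniform_kernel lam (\<phi> :: 'n param) \<partial>lborel) = 1" by simp
qed

lemma averaging_kernel_translate:
  assumes k: "averaging_kernel r k"
  shows "(\<integral>\<^sup>+\<phi>. k (\<phi> - c) \<partial>lborel) = 1"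
proof -
  have [measurable]: "k \<in> borel_measurable borel" and k1: "(\<integral>\<^sup>+\<phi>. k \<phi> \<partial>lborel) = 1"
    using k by (auto simp: averaging_kernel_def)
  have "(\<integral>\<^sup>+\<phi>. k \<phi> \<partial>(distr lborel borel ((+) (- c)))) = (\<integral>\<^sup>+\<phi>. k (- c + \<phi>) \<partial>lborel)"
    by (rule nn_integral_distr) auto
  then show ?thesis by (simp add: lborel_distr_plus k1)
qed

text \<open>
  The closeness of \<open>g\<close> to \<open>v\<close> is required almost everywhere only, so that \<open>g\<close> may be the Borel
  representative of a function which is close to \<open>v\<close> everywhere.
\<close>

lemma averaging_kernel_integral:
  fixes k :: "'n::finite param \<Rightarrow> real" and g :: "'n param \<Rightarrow> real"
  assumes k: "averaging_kernel r k" and g: "g \<in> borel_measurable lborel"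
    and close: "AE \<phi> in lborel. \<phi> - c \<in> cube r \<longrightarrow> \<bar>g \<phi> - v\<bar> \<le> K"
  shows "integrable lborel (\<lambda>\<phi>. k (\<phi> - c) * g \<phi>)"
    and "\<bar>(\<integral>\<phi>. k (\<phi> - c) * g \<phi> \<partial>lborel) - v\<bar> \<le> K"
proof -
  have km [measurable]: "k \<in> borel_measurable borel" and k0: "\<And>\<phi>. 0 \<le> k \<phi>"
    and ks: "\<And>\<phi>. \<phi> \<notin> cube r \<Longrightarrow> k \<phi> = 0"
    using k by (auto simp: averaging_kernel_def)
  note [measurable] = g
  have "(\<integral>\<^sup>+\<phi>. k (\<phi> - c) \<partial>lborel) = 1" by (rule averaging_kernel_translate[OF k])
  then have hk: "has_bochner_integral lborel (\<lambda>\<phi>. k (\<phi> - c)) 1"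
    by (intro has_bochner_integral_nn_integral) (auto simp: k0)
  then have ik: "integrable lborel (\<lambda>\<phi>. k (\<phi> - c))" and k_int: "(\<integral>\<phi>. k (\<phi> - c) \<partial>lborel) = 1"
    by (auto simp: has_bochner_integral_iff)
  have bound: "AE \<phi> in lborel. \<bar>k (\<phi> - c) * (g \<phi> - v)\<bar> \<le> K * k (\<phi> - c)"
    using close
  proof eventually_elim
    case (elim \<phi>)
    then show ?case
      using ks[of "\<phi> - c"] k0[of "\<phi> - c"]
      by (cases "\<phi> - c \<in> cube r") (auto simp: abs_mult mult.commute[of K] intro: mult_left_mono)
  qed
  have id: "integrable lborel (\<lambda>\<phi>. k (\<phi> - c) * (g \<phi> - v))"
  proof (rule Bochner_Integration.integrable_bound)
    show "integrable lborel (\<lambda>\<phi>. K * k (\<phi> - c))" using ik by simp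
    show "AE \<phi> in lborel. norm (k (\<phi> - c) * (g \<phi> - v)) \<le> norm (K * k (\<phi> - c))"
      using bound by eventually_elim auto
  qed measurable
  have eq: "(\<lambda>\<phi>. k (\<phi> - c) * g \<phi>) = (\<lambda>\<phi>. k (\<phi> - c) * (g \<phi> - v) + k (\<phi> - c) * v)"
    by (simp add: algebra_simps)
  show "integrable lborel (\<lambda>\<phi>. k (\<phi> - c) * g \<phi>)"
    unfolding eq using id ik by simp
  have "(\<integral>\<phi>. k (\<phi> - c) * g \<phi> \<partial>lborel) - v = (\<integral>\<phi>. k (\<phi> - c) * (g \<phi> - v) \<partial>lborel)"
    unfolding eq using id ik k_int by simp
  also have "\<bar>\<dots>\<bar> \<le> (\<integral>\<phi>. \<bar>k (\<phi> - c) * (g \<phi> - v)\<bar> \<partial>lborel)"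
    by (rule integral_abs_bound)
  also have "\<dots> \<le> (\<integral>\<phi>. K * k (\<phi> - c) \<partial>lborel)"
    by (intro integral_mono_AE bound) (use id ik in auto)
  also have "\<dots> = K" by (simp add: k_int)
  finally show "\<bar>(\<integral>\<phi>. k (\<phi> - c) * g \<phi> \<partial>lborel) - v\<bar> \<le> K" .
qed

lemma expanded_memI:
  assumes "c \<in> \<Upsilon>" and "\<phi> - c \<in> cube (1 / lam)"
  shows "\<phi> \<in> expanded lam \<Upsilon>"
proof -
  have "\<phi> = c + (\<phi> - c) \<and> c \<in> closure \<Upsilon> \<and> \<phi> - c \<in> cube (1 / lam)"
    using assms subsetD[OF closure_subset] by simp
  then show ?thesis unfolding expanded_def by blast
qed

lemma compact_expanded:
  assumes "bounded \<Upsilon>" shows "compact (expanded lam \<Upsilon>)"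
proof -
  have "compact {x + y |x y. x \<in> closure \<Upsilon> \<and> y \<in> cube (1 / lam)}"
    using assms by (intro compact_sums) (auto simp: cube_eq_cbox compact_closure)
  then show ?thesis by (simp add: expanded_def)
qed

text \<open>
  For fixed \<open>x\<close> the integrand of the mollified network agrees almost everywhere with the one formed with
  a Borel representative \<open>\<tau>\<close> of \<open>\<sigma>\<close>. The integrals over \<open>lborel\<close> of the latter give the measurability
  in \<open>x\<close>, and each of them is an average of values within \<open>K x\<close> of \<open>\<sigma> (\<gamma> i \<bullet> lift1 x)\<close>.
\<close>

lemma (in unif_domain) mollification_error:
  fixes \<sigma> :: "real \<Rightarrow> real" and \<theta> :: "nat \<Rightarrow> real" and \<gamma> :: "nat \<Rightarrow> 'n param"
  assumes lam: "lam > 0" and cont: "AE u in lebesgue. isCont \<sigma> u" and \<Upsilon>: "bounded \<Upsilon>"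
    and \<gamma>: "\<And>i. i \<in> {1..N} \<Longrightarrow> \<gamma> i \<in> \<Upsilon>"
    and close: "\<And>x i \<phi>. x \<in> B \<Longrightarrow> i \<in> {1..N} \<Longrightarrow> \<phi> - \<gamma> i \<in> cube (1 / lam) \<Longrightarrow>
                  \<bar>\<sigma> (\<phi> \<bullet> lift1 x) - \<sigma> (\<gamma> i \<bullet> lift1 x)\<bar> \<le> K x"
  shows "(\<lambda>x. shallow_net \<sigma> N \<theta> \<gamma> x - mollified_net lam \<Upsilon> \<sigma> N \<theta> \<gamma> x) \<in> borel_measurable (unif_meas B)"
    and "\<And>x. x \<in> B \<Longrightarrow>
           \<bar>shallow_net \<sigma> N \<theta> \<gamma> x - mollified_net lam \<Upsilon> \<sigma> N \<theta> \<gamma> x\<bar> \<le> (\<Sum>i=1..N. \<bar>\<theta> i\<bar>) * K x"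
proof -
  let ?U = "expanded lam \<Upsilon>"
  obtain \<tau> C where \<tau> [measurable]: "\<tau> \<in> borel_measurable borel" and C: "C \<in> null_sets lborel"
    and \<sigma>\<tau>: "\<And>u. u \<notin> C \<Longrightarrow> \<sigma> u = \<tau> u"
    using AE_continuous_borel_representative[OF cont] by metis
  note k = averaging_kernel_moll_delta[OF lam, where 'n = 'n]
  have km [measurable]: "moll_delta lam \<in> borel_measurable (borel :: 'n param measure)"
    and ks: "\<And>\<phi> :: 'n param. \<phi> \<notin> cube (1 / lam) \<Longrightarrow> moll_delta lam \<phi> = 0"
    using k by (auto simp: averaging_kernel_def)
  have ae: "AE \<phi> in lborel. \<sigma> (\<phi> \<bullet> lift1 x) = \<tau> (\<phi> \<bullet> lift1 x)" for x :: "real^'n"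
  proof -
    have "lift1 x \<noteq> 0" by (simp add: lift1_def zero_prod_def)
    from AE_not_in[OF null_sets_affine_preimage[OF this C, of 0]] show ?thesis
      by (auto simp: \<sigma>\<tau>)
  qed
  have close\<tau>: "AE \<phi> in lborel. \<phi> - \<gamma> i \<in> cube (1 / lam) \<longrightarrow> \<bar>\<tau> (\<phi> \<bullet> lift1 x) - \<sigma> (\<gamma> i \<bullet> lift1 x)\<bar> \<le> K x"
    if "x \<in> B" "i \<in> {1..N}" for x i
    using ae[of x]
  proof eventually_elim
    case (elim \<phi>)
    then show ?case using close[OF that, of \<phi>] by simp
  qed
  define F where "F x = (\<Sum>i=1..N. \<theta> i * (\<integral>\<phi>. moll_delta lam (\<phi> - \<gamma> i) * \<tau> (\<phi> \<bullet> lift1 x) \<partial>lborel))" for x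
  have F_eq: "mollified_net lam \<Upsilon> \<sigma> N \<theta> \<gamma> x = F x" if x: "x \<in> B" for x
  proof -
    define G where "G \<phi> = (\<Sum>i=1..N. \<theta> i * (moll_delta lam (\<phi> - \<gamma> i) * \<tau> (\<phi> \<bullet> lift1 x)))" for \<phi>
    have G [measurable]: "G \<in> borel_measurable lborel" unfolding G_def[abs_def] by measurable
    let ?H = "\<lambda>\<phi>. indicator ?U \<phi> *\<^sub>R (\<Sum>i=1..N. \<theta> i * moll_delta lam (\<phi> - \<gamma> i) * \<sigma> (\<phi> \<bullet> lift1 x))"
    have "AE \<phi> in lborel. G \<phi> = ?H \<phi>"
      using ae[of x]
    proof eventually_elim
      case (elim \<phi>)
      have "\<theta> i * (moll_delta lam (\<phi> - \<gamma> i) * \<tau> (\<phi> \<bullet> lift1 x))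
          = indicator ?U \<phi> * (\<theta> i * moll_delta lam (\<phi> - \<gamma> i) * \<sigma> (\<phi> \<bullet> lift1 x))" if "i \<in> {1..N}" for i
        using ks[of "\<phi> - \<gamma> i"] expanded_memI[OF \<gamma>[OF that], of \<phi> lam]
        by (cases "\<phi> - \<gamma> i \<in> cube (1 / lam)") (simp_all add: elim)
      then show ?case unfolding G_def real_scaleR_def sum_distrib_left by (rule sum.cong[OF refl])
    qed
    then have GH: "AE \<phi> in lebesgue. G \<phi> = ?H \<phi>" by (rule AE_completion)
    have Gl: "G \<in> borel_measurable lebesgue" using G by (rule measurable_completion)
    have "mollified_net lam \<Upsilon> \<sigma> N \<theta> \<gamma> x = (\<integral>\<phi>. ?H \<phi> \<partial>lebesgue)"
      by (simp add: mollified_net_def set_lebesgue_integral_def)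
    also have "\<dots> = (\<integral>\<phi>. G \<phi> \<partial>lebesgue)"
      using GH borel_measurable_AE[OF Gl GH] Gl by (intro integral_cong_AE) auto
    also have "\<dots> = (\<integral>\<phi>. G \<phi> \<partial>lborel)" by (rule integral_completion[OF G])
    also have "\<dots> = F x"
    proof -
      have "integrable lborel (\<lambda>\<phi>. moll_delta lam (\<phi> - \<gamma> i) * \<tau> (\<phi> \<bullet> lift1 x))" if "i \<in> {1..N}" for i
        by (rule averaging_kernel_integral[OF k _ close\<tau>[OF x that]]) measurable
      then show ?thesis unfolding G_def F_def
        by (subst Bochner_Integration.integral_sum) auto
    qed
    finally show ?thesis .
  qed
  have "(\<lambda>x. F x) \<in> borel_measurable borel"
    unfolding F_def lift1_def by measurable
  then have "F \<in> borel_measurable (unif_meas B)" by (rule borel_measurable_unifI)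
  then have "mollified_net lam \<Upsilon> \<sigma> N \<theta> \<gamma> \<in> borel_measurable (unif_meas B)"
    by (subst measurable_cong[where g = F]) (simp_all add: F_eq)
  then show "(\<lambda>x. shallow_net \<sigma> N \<theta> \<gamma> x - mollified_net lam \<Upsilon> \<sigma> N \<theta> \<gamma> x) \<in> borel_measurable (unif_meas B)"
    using borel_measurable_shallow_net[OF cont, of N \<theta> \<gamma>] by measurable
  fix x assume x: "x \<in> B"
  have "shallow_net \<sigma> N \<theta> \<gamma> x - mollified_net lam \<Upsilon> \<sigma> N \<theta> \<gamma> x
      = (\<Sum>i=1..N. \<theta> i * (\<sigma> (\<gamma> i \<bullet> lift1 x) - (\<integral>\<phi>. moll_delta lam (\<phi> - \<gamma> i) * \<tau> (\<phi> \<bullet> lift1 x) \<partial>lborel)))"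
    by (simp add: F_eq[OF x] F_def shallow_net_def sum_subtractf algebra_simps)
  also have "\<bar>\<dots>\<bar> \<le> (\<Sum>i=1..N. \<bar>\<theta> i\<bar> * K x)"
  proof (rule sum_abs[THEN order_trans], rule sum_mono)
    fix i assume i: "i \<in> {1..N}"
    have "\<bar>(\<integral>\<phi>. moll_delta lam (\<phi> - \<gamma> i) * \<tau> (\<phi> \<bullet> lift1 x) \<partial>lborel) - \<sigma> (\<gamma> i \<bullet> lift1 x)\<bar> \<le> K x"
      by (rule averaging_kernel_integral[OF k _ close\<tau>[OF x i]]) measurable
    then show "\<bar>\<theta> i * (\<sigma> (\<gamma> i \<bullet> lift1 x) - (\<integral>\<phi>. moll_delta lam (\<phi> - \<gamma> i) * \<tau> (\<phi> \<bullet> lift1 x) \<partial>lborel))\<bar>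
        \<le> \<bar>\<theta> i\<bar> * K x"
      by (simp add: abs_mult abs_minus_commute mult_left_mono)
  qed
  finally show "\<bar>shallow_net \<sigma> N \<theta> \<gamma> x - mollified_net lam \<Upsilon> \<sigma> N \<theta> \<gamma> x\<bar> \<le> (\<Sum>i=1..N. \<bar>\<theta> i\<bar>) * K x"
    by (simp add: sum_distrib_right)
qed

section \<open>The bounded differences inequality\<close>

text \<open>
  By induction on the number of coordinates. Integrating out one coordinate leaves a function \<open>g\<close> of the
  others which again has bounded differences, and Hoeffding's lemma for the integrated coordinate
  supplies one factor \<open>exp (l\<^sup>2 * c\<^sup>2 / 8)\<close>.
\<close>

lemma mcdiarmid_exponential_moment:
  fixes F :: "('i \<Rightarrow> 'a) \<Rightarrow> real" and \<mu> :: "'a measure" and c K l :: real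
  assumes \<mu>: "prob_space \<mu>" and J: "finite J" and l: "l > 0"
    and F: "F \<in> borel_measurable (Pi\<^sub>M J (\<lambda>_. \<mu>))"
    and bound: "\<And>x. x \<in> space (Pi\<^sub>M J (\<lambda>_. \<mu>)) \<Longrightarrow> \<bar>F x\<bar> \<le> K"
    and diff: "\<And>x j y. x \<in> space (Pi\<^sub>M J (\<lambda>_. \<mu>)) \<Longrightarrow> j \<in> J \<Longrightarrow> y \<in> space \<mu> \<Longrightarrow>
                 \<bar>F (x(j := y)) - F x\<bar> \<le> c"
  shows "(\<integral>\<^sup>+x. exp (l * (F x - (\<integral>z. F z \<partial>Pi\<^sub>M J (\<lambda>_. \<mu>)))) \<partial>Pi\<^sub>M J (\<lambda>_. \<mu>))
           \<le> ennreal (exp (l\<^sup>2 * (card J * c\<^sup>2) / 8))"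
  using J F bound diff
proof (induction J arbitrary: F rule: finite_induct)
  case empty
  let ?Q = "Pi\<^sub>M ({} :: 'i set) (\<lambda>_. \<mu>)"
  interpret P: prob_space ?Q by (intro prob_space_PiM \<mu>)
  have const: "F x = F (\<lambda>_. undefined)" if "x \<in> space (?Q)" for x
    using that by (simp add: space_PiM)
  have "(\<integral>x. F x \<partial>?Q) = (\<integral>x. F (\<lambda>_. undefined) \<partial>?Q)"
    by (rule Bochner_Integration.integral_cong[OF refl]) (rule const)
  also have "\<dots> = F (\<lambda>_. undefined)" by (simp add: P.prob_space)
  finally have EF: "(\<integral>x. F x \<partial>?Q) = F (\<lambda>_. undefined)" .
  have "(\<integral>\<^sup>+x. exp (l * (F x - (\<integral>z. F z \<partial>?Q))) \<partial>?Q)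
      = (\<integral>\<^sup>+x. 1 \<partial>?Q)"
    unfolding EF by (intro nn_integral_cong) (simp add: space_PiM)
  then show ?case by (simp add: P.emeasure_space_1)
next
  case (insert i J)
  interpret \<mu>: prob_space \<mu> by (rule \<mu>)
  interpret prod: product_sigma_finite "\<lambda>_::'i. \<mu>" ..
  interpret PJ: prob_space "Pi\<^sub>M J (\<lambda>_. \<mu>)" by (intro prob_space_PiM \<mu>)
  interpret PI: prob_space "Pi\<^sub>M (insert i J) (\<lambda>_. \<mu>)" by (intro prob_space_PiM \<mu>)
  note [measurable] = insert.prems(1)
  have upd: "x(i := y) \<in> space (Pi\<^sub>M (insert i J) (\<lambda>_. \<mu>))"
    if "x \<in> space (Pi\<^sub>M J (\<lambda>_. \<mu>))" "y \<in> space \<mu>" for x y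
    using that by (auto simp: space_PiM PiE_def extensional_def Pi_def)
  have meas_upd [measurable]: "(\<lambda>y. F (x(i := y))) \<in> borel_measurable \<mu>"
    if "x \<in> space (Pi\<^sub>M J (\<lambda>_. \<mu>))" for x
  proof -
    have "(\<lambda>y. x(i := y)) \<in> measurable \<mu> (Pi\<^sub>M (insert i J) (\<lambda>_. \<mu>))"
      using that by (intro measurable_fun_upd[where J = J]) auto
    from measurable_compose[OF this insert.prems(1)] show ?thesis .
  qed
  have int_upd: "integrable \<mu> (\<lambda>y. F (x(i := y)))" if "x \<in> space (Pi\<^sub>M J (\<lambda>_. \<mu>))" for x
    using that upd insert.prems(2)
    by (intro \<mu>.integrable_const_bound[where B = K] AE_I2 meas_upd) auto
  define g where "g x = (\<integral>y. F (x(i := y)) \<partial>\<mu>)" for x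
  have meas2 [measurable]: "(\<lambda>(x, y). F (x(i := y))) \<in> borel_measurable (Pi\<^sub>M J (\<lambda>_. \<mu>) \<Otimes>\<^sub>M \<mu>)"
    using measurable_compose[OF measurable_add_dim insert.prems(1)]
    by (simp add: case_prod_beta')
  have g_meas [measurable]: "g \<in> borel_measurable (Pi\<^sub>M J (\<lambda>_. \<mu>))"
    unfolding g_def by measurable
  have g_bound: "\<bar>g x\<bar> \<le> K" if "x \<in> space (Pi\<^sub>M J (\<lambda>_. \<mu>))" for x
  proof -
    have "\<bar>g x\<bar> \<le> (\<integral>y. \<bar>F (x(i := y))\<bar> \<partial>\<mu>)" unfolding g_def by (rule integral_abs_bound)
    also have "\<dots> \<le> (\<integral>y. K \<partial>\<mu>)"
      using int_upd[OF that] upd[OF that] insert.prems(2) by (intro integral_mono) auto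
    finally show ?thesis by (simp add: \<mu>.prob_space)
  qed
  have g_diff: "\<bar>g (x(j := y)) - g x\<bar> \<le> c"
    if x: "x \<in> space (Pi\<^sub>M J (\<lambda>_. \<mu>))" and j: "j \<in> J" and y: "y \<in> space \<mu>" for x j y
  proof -
    have x': "x(j := y) \<in> space (Pi\<^sub>M J (\<lambda>_. \<mu>))"
      using x j y by (auto simp: space_PiM PiE_def extensional_def Pi_def)
    have ij: "i \<noteq> j" using j insert.hyps by auto
    have "\<bar>g (x(j := y)) - g x\<bar> = \<bar>\<integral>z. F (x(j := y, i := z)) - F (x(i := z)) \<partial>\<mu>\<bar>"
      unfolding g_def using int_upd[OF x] int_upd[OF x'] by simp
    also have "\<dots> \<le> (\<integral>z. \<bar>F (x(j := y, i := z)) - F (x(i := z))\<bar> \<partial>\<mu>)"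
      by (rule integral_abs_bound)
    also have "\<dots> \<le> (\<integral>z. c \<partial>\<mu>)"
    proof (rule integral_mono)
      show "integrable \<mu> (\<lambda>z. \<bar>F (x(j := y, i := z)) - F (x(i := z))\<bar>)"
        using int_upd[OF x] int_upd[OF x'] by simp
      show "\<bar>F (x(j := y, i := z)) - F (x(i := z))\<bar> \<le> c" if "z \<in> space \<mu>" for z
        using insert.prems(3)[OF upd[OF x that], of j y] j y ij
        by (metis fun_upd_twist insertI2)
    qed simp
    finally show ?thesis by (simp add: \<mu>.prob_space)
  qed
  have "integrable (Pi\<^sub>M (insert i J) (\<lambda>_. \<mu>)) F"
    using insert.prems(2) by (intro PI.integrable_const_bound[where B = K]) auto
  then have EF: "(\<integral>z. F z \<partial>Pi\<^sub>M (insert i J) (\<lambda>_. \<mu>)) = (\<integral>x. g x \<partial>Pi\<^sub>M J (\<lambda>_. \<mu>))" (is "?EF = ?Eg")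
    unfolding g_def using insert.hyps by (intro prod.product_integral_insert)
  \<comment> \<open>with the other coordinates fixed, \<open>F\<close> ranges in an interval of length \<open>c\<close>\<close>
  have inner: "(\<integral>\<^sup>+y. exp (l * (F (x(i := y)) - g x)) \<partial>\<mu>) \<le> ennreal (exp (l\<^sup>2 * c\<^sup>2 / 8))"
    if x: "x \<in> space (Pi\<^sub>M J (\<lambda>_. \<mu>))" for x
  proof -
    define a where "a = (INF y\<in>space \<mu>. F (x(i := y)))"
    have bdd: "bdd_below ((\<lambda>y. F (x(i := y))) ` space \<mu>)"
    proof (rule bdd_belowI2)
      show "- K \<le> F (x(i := y))" if "y \<in> space \<mu>" for y
        using insert.prems(2)[OF upd[OF x that]] by linarith
    qed
    have "F (x(i := y)) \<in> {a..a + c}" if y: "y \<in> space \<mu>" for y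
    proof -
      have "a \<le> F (x(i := y))" unfolding a_def by (intro cINF_lower bdd y)
      moreover have "F (x(i := y)) - c \<le> a" unfolding a_def
      proof (rule cINF_greatest)
        show "F (x(i := y)) - c \<le> F (x(i := z))" if "z \<in> space \<mu>" for z
        proof -
          have "\<bar>F (x(i := z, i := y)) - F (x(i := z))\<bar> \<le> c"
            by (intro insert.prems(3) upd x that y) simp
          then show ?thesis by (simp only: fun_upd_upd)
        qed
      qed (use \<mu>.not_empty in auto)
      ultimately show ?thesis by auto
    qed
    then interpret interval_bounded_random_variable \<mu> "\<lambda>y. F (x(i := y))" a "a + c"
      by unfold_locales (auto simp: meas_upd[OF x])
    show ?thesis using Hoeffdings_lemma_nn_integral[OF l] by (simp add: g_def)
  qed
  have "(\<integral>\<^sup>+x. exp (l * (F x - ?EF)) \<partial>Pi\<^sub>M (insert i J) (\<lambda>_. \<mu>))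
      = (\<integral>\<^sup>+x. (\<integral>\<^sup>+y. exp (l * (F (x(i := y)) - ?EF)) \<partial>\<mu>) \<partial>Pi\<^sub>M J (\<lambda>_. \<mu>))"
    using insert.hyps by (intro prod.product_nn_integral_insert) auto
  also have "\<dots> = (\<integral>\<^sup>+x. (\<integral>\<^sup>+y. ennreal (exp (l * (g x - ?EF))) * ennreal (exp (l * (F (x(i := y)) - g x))) \<partial>\<mu>) \<partial>Pi\<^sub>M J (\<lambda>_. \<mu>))"
    by (simp flip: ennreal_mult exp_add add: algebra_simps)
  also have "\<dots> = (\<integral>\<^sup>+x. ennreal (exp (l * (g x - ?EF))) * (\<integral>\<^sup>+y. ennreal (exp (l * (F (x(i := y)) - g x))) \<partial>\<mu>) \<partial>Pi\<^sub>M J (\<lambda>_. \<mu>))"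
    using meas_upd by (intro nn_integral_cong nn_integral_cmult) measurable
  also have "\<dots> \<le> (\<integral>\<^sup>+x. ennreal (exp (l * (g x - ?EF))) * ennreal (exp (l\<^sup>2 * c\<^sup>2 / 8)) \<partial>Pi\<^sub>M J (\<lambda>_. \<mu>))"
    by (intro nn_integral_mono mult_left_mono inner) auto
  also have "\<dots> = (\<integral>\<^sup>+x. ennreal (exp (l * (g x - ?EF))) \<partial>Pi\<^sub>M J (\<lambda>_. \<mu>)) * ennreal (exp (l\<^sup>2 * c\<^sup>2 / 8))"
    by (intro nn_integral_multc) measurable
  also have "\<dots> \<le> ennreal (exp (l\<^sup>2 * (card J * c\<^sup>2) / 8)) * ennreal (exp (l\<^sup>2 * c\<^sup>2 / 8))"
    unfolding EF by (intro mult_right_mono insert.IH g_meas g_bound g_diff) auto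
  also have "\<dots> = ennreal (exp (l\<^sup>2 * (card (insert i J) * c\<^sup>2) / 8))"
    using insert.hyps by (simp flip: ennreal_mult exp_add add: field_simps)
  finally show ?case .
qed

text \<open>
  McDiarmid's inequality for independent samples from one distribution.
\<close>

theorem mcdiarmid:
  fixes F :: "('i \<Rightarrow> 'a) \<Rightarrow> real" and \<mu> :: "'a measure" and c K t :: real
  assumes \<mu>: "prob_space \<mu>" and J: "finite J" "J \<noteq> {}" and c: "c > 0" and t: "t > 0"
    and F: "F \<in> borel_measurable (Pi\<^sub>M J (\<lambda>_. \<mu>))"
    and bound: "\<And>x. x \<in> space (Pi\<^sub>M J (\<lambda>_. \<mu>)) \<Longrightarrow> \<bar>F x\<bar> \<le> K"
    and diff: "\<And>x j y. x \<in> space (Pi\<^sub>M J (\<lambda>_. \<mu>)) \<Longrightarrow> j \<in> J \<Longrightarrow> y \<in> space \<mu> \<Longrightarrow>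
                 \<bar>F (x(j := y)) - F x\<bar> \<le> c"
  shows "measure (Pi\<^sub>M J (\<lambda>_. \<mu>))
           {x \<in> space (Pi\<^sub>M J (\<lambda>_. \<mu>)). F x \<ge> (\<integral>z. F z \<partial>Pi\<^sub>M J (\<lambda>_. \<mu>)) + t}
         \<le> exp (- 2 * t\<^sup>2 / (card J * c\<^sup>2))"
proof -
  interpret P: prob_space "Pi\<^sub>M J (\<lambda>_. \<mu>)" by (intro prob_space_PiM \<mu>)
  note [measurable] = F
  let ?Q = "Pi\<^sub>M J (\<lambda>_. \<mu>)" and ?E = "\<integral>z. F z \<partial>Pi\<^sub>M J (\<lambda>_. \<mu>)"
  define d where "d = card J * c\<^sup>2"
  have d: "d > 0" using J c by (simp add: d_def card_gt_0_iff)
  \<comment> \<open>the minimiser of \<open>l\<^sup>2 * d / 8 - l * t\<close>\<close>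
  define l where "l = 4 * t / d"
  have l: "l > 0" using t d by (simp add: l_def)
  have "emeasure ?Q {x \<in> space ?Q. F x - ?E \<ge> t}
      \<le> ennreal (exp (- l * t)) * (\<integral>\<^sup>+x\<in>space ?Q. exp (l * (F x - ?E)) \<partial>?Q)"
    by (intro Chernoff_ineq_nn_integral_ge l) auto
  also have "(\<integral>\<^sup>+x\<in>space ?Q. exp (l * (F x - ?E)) \<partial>?Q) = (\<integral>\<^sup>+x. exp (l * (F x - ?E)) \<partial>?Q)"
    by (intro nn_integral_cong) auto
  also have "ennreal (exp (- l * t)) * \<dots> \<le> ennreal (exp (- l * t)) * ennreal (exp (l\<^sup>2 * d / 8))"
    unfolding d_def
    by (intro mult_left_mono mcdiarmid_exponential_moment[OF \<mu> J(1) l F bound diff]) auto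
  also have "\<dots> = ennreal (exp (- 2 * t\<^sup>2 / d))"
    using d by (simp flip: ennreal_mult exp_add add: l_def power2_eq_square field_simps)
  finally have "emeasure ?Q {x \<in> space ?Q. F x \<ge> ?E + t} \<le> ennreal (exp (- 2 * t\<^sup>2 / d))"
    by (simp add: algebra_simps)
  then show ?thesis by (simp add: P.emeasure_eq_measure d_def)
qed

section \<open>Independent samples, reweighting and Lipschitz extension\<close>

text \<open>
  By induction on the number of coordinates: the mixed term vanishes as the new summand is centred.
\<close>

lemma variance_of_sum_iid:
  fixes Y :: "'a \<Rightarrow> real" and \<mu> :: "'a measure"
  assumes \<mu>: "prob_space \<mu>" and J: "finite (J :: 'i set)"
    and Y: "Y \<in> borel_measurable \<mu>" and bound: "\<And>y. y \<in> space \<mu> \<Longrightarrow> \<bar>Y y\<bar> \<le> K"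
    and centred: "(\<integral>y. Y y \<partial>\<mu>) = 0"
  shows "(\<integral>x. (\<Sum>j\<in>J. Y (x j))\<^sup>2 \<partial>Pi\<^sub>M J (\<lambda>_. \<mu>)) = card J * (\<integral>y. (Y y)\<^sup>2 \<partial>\<mu>)"
  using J
proof (induction J rule: finite_induct)
  case (insert i J)
  interpret \<mu>: prob_space \<mu> by (rule \<mu>)
  interpret prod: product_sigma_finite "\<lambda>_::'i. \<mu>" ..
  interpret PI: prob_space "Pi\<^sub>M (insert i J) (\<lambda>_. \<mu>)" by (intro prob_space_PiM \<mu>)
  interpret PJ: prob_space "Pi\<^sub>M J (\<lambda>_. \<mu>)" by (intro prob_space_PiM \<mu>)
  note [measurable] = Y
  have intY: "integrable \<mu> Y" using bound by (intro \<mu>.integrable_const_bound[where B = K]) auto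
  have intY2: "integrable \<mu> (\<lambda>y. (Y y)\<^sup>2)"
  proof (intro \<mu>.integrable_const_bound[where B = "K\<^sup>2"] AE_I2)
    show "norm ((Y y)\<^sup>2) \<le> K\<^sup>2" if "y \<in> space \<mu>" for y
      using power_mono[OF bound[OF that], of 2] by simp
  qed measurable
  have int: "integrable (Pi\<^sub>M I (\<lambda>_. \<mu>)) (\<lambda>x. (\<Sum>j\<in>I. Y (x j))\<^sup>2)" if "finite I" for I :: "'i set"
  proof -
    interpret P: prob_space "Pi\<^sub>M I (\<lambda>_. \<mu>)" by (intro prob_space_PiM \<mu>)
    show ?thesis
    proof (intro P.integrable_const_bound[where B = "(card I * K)\<^sup>2"] AE_I2)
      fix x assume x: "x \<in> space (Pi\<^sub>M I (\<lambda>_. \<mu>))"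
      have "\<bar>\<Sum>j\<in>I. Y (x j)\<bar> \<le> (\<Sum>j\<in>I. K)"
        using x by (intro sum_abs[THEN order_trans] sum_mono bound) (auto simp: space_PiM)
      then show "norm ((\<Sum>j\<in>I. Y (x j))\<^sup>2) \<le> (card I * K)\<^sup>2"
        using power_mono[of "\<bar>\<Sum>j\<in>I. Y (x j)\<bar>" "card I * K" 2] by simp
    qed measurable
  qed
  have "(\<integral>x. (\<Sum>j\<in>insert i J. Y (x j))\<^sup>2 \<partial>Pi\<^sub>M (insert i J) (\<lambda>_. \<mu>))
      = (\<integral>x. (\<integral>y. (\<Sum>j\<in>insert i J. Y ((x(i := y)) j))\<^sup>2 \<partial>\<mu>) \<partial>Pi\<^sub>M J (\<lambda>_. \<mu>))"
    using insert.hyps by (intro prod.product_integral_insert int) auto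
  also have "\<dots> = (\<integral>x. (\<Sum>j\<in>J. Y (x j))\<^sup>2 + (\<integral>y. (Y y)\<^sup>2 \<partial>\<mu>) \<partial>Pi\<^sub>M J (\<lambda>_. \<mu>))"
  proof (rule Bochner_Integration.integral_cong[OF refl])
    fix x :: "'i \<Rightarrow> 'a"
    let ?s = "\<Sum>j\<in>J. Y (x j)"
    have "(\<Sum>j\<in>insert i J. Y ((x(i := y)) j)) = Y y + ?s" for y
    proof -
      have "(\<Sum>j\<in>J. Y ((x(i := y)) j)) = ?s" using insert.hyps by (intro sum.cong) auto
      then show ?thesis using insert.hyps by simp
    qed
    then have "(\<integral>y. (\<Sum>j\<in>insert i J. Y ((x(i := y)) j))\<^sup>2 \<partial>\<mu>)
        = (\<integral>y. (Y y)\<^sup>2 + 2 * ?s * Y y + ?s\<^sup>2 \<partial>\<mu>)"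
      by (simp add: power2_eq_square algebra_simps)
    also have "\<dots> = (\<integral>y. (Y y)\<^sup>2 \<partial>\<mu>) + 2 * ?s * (\<integral>y. Y y \<partial>\<mu>) + ?s\<^sup>2"
      using intY intY2 by (simp add: \<mu>.prob_space)
    finally show "(\<integral>y. (\<Sum>j\<in>insert i J. Y ((x(i := y)) j))\<^sup>2 \<partial>\<mu>) = ?s\<^sup>2 + (\<integral>y. (Y y)\<^sup>2 \<partial>\<mu>)"
      by (simp add: centred)
  qed
  also have "\<dots> = card (insert i J) * (\<integral>y. (Y y)\<^sup>2 \<partial>\<mu>)"
    using insert.hyps by (simp add: int insert.IH PJ.prob_space algebra_simps)
  finally show ?case .
qed simp

lemma mean_square_error_iid:
  fixes Y :: "'a \<Rightarrow> real" and \<mu> :: "'a measure"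
  assumes \<mu>: "prob_space \<mu>" and J: "finite (J :: 'i set)" "J \<noteq> {}"
    and Y: "Y \<in> borel_measurable \<mu>" and bound: "\<And>y. y \<in> space \<mu> \<Longrightarrow> \<bar>Y y\<bar> \<le> K"
  shows "(\<integral>x. ((\<Sum>j\<in>J. Y (x j)) / card J - (\<integral>y. Y y \<partial>\<mu>))\<^sup>2 \<partial>Pi\<^sub>M J (\<lambda>_. \<mu>))
           \<le> (\<integral>y. (Y y)\<^sup>2 \<partial>\<mu>) / card J"
proof -
  interpret \<mu>: prob_space \<mu> by (rule \<mu>)
  note [measurable] = Y
  define e where "e = (\<integral>y. Y y \<partial>\<mu>)"
  have n: "real (card J) > 0" using J by (simp add: card_gt_0_iff)
  have intY: "integrable \<mu> Y" using bound by (intro \<mu>.integrable_const_bound[where B = K]) auto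
  have intY2: "integrable \<mu> (\<lambda>y. (Y y)\<^sup>2)"
  proof (intro \<mu>.integrable_const_bound[where B = "K\<^sup>2"] AE_I2)
    show "norm ((Y y)\<^sup>2) \<le> K\<^sup>2" if "y \<in> space \<mu>" for y
      using power_mono[OF bound[OF that], of 2] by simp
  qed measurable
  have "(\<integral>x. ((\<Sum>j\<in>J. Y (x j)) / card J - e)\<^sup>2 \<partial>Pi\<^sub>M J (\<lambda>_. \<mu>))
      = (\<integral>x. (\<Sum>j\<in>J. Y (x j) - e)\<^sup>2 / (card J)\<^sup>2 \<partial>Pi\<^sub>M J (\<lambda>_. \<mu>))"
  proof (rule Bochner_Integration.integral_cong[OF refl])
    fix x :: "'i \<Rightarrow> 'a"
    have "(\<Sum>j\<in>J. Y (x j)) / card J - e = (\<Sum>j\<in>J. Y (x j) - e) / card J"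
      using n by (simp add: sum_subtractf diff_divide_distrib)
    then show "((\<Sum>j\<in>J. Y (x j)) / card J - e)\<^sup>2 = (\<Sum>j\<in>J. Y (x j) - e)\<^sup>2 / (card J)\<^sup>2"
      by (simp add: power_divide)
  qed
  also have "\<dots> = card J * (\<integral>y. (Y y - e)\<^sup>2 \<partial>\<mu>) / (card J)\<^sup>2"
  proof (subst variance_of_sum_iid[OF \<mu> J(1), symmetric])
    show "\<bar>Y y - e\<bar> \<le> K + \<bar>e\<bar>" if "y \<in> space \<mu>" for y using bound[OF that] by linarith
    show "(\<integral>y. Y y - e \<partial>\<mu>) = 0" using intY by (simp add: e_def \<mu>.prob_space)
  qed simp_all
  also have "\<dots> = (\<integral>y. (Y y - e)\<^sup>2 \<partial>\<mu>) / card J"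
    using n by (simp add: power2_eq_square)
  also have "\<dots> \<le> (\<integral>y. (Y y)\<^sup>2 \<partial>\<mu>) / card J"
    using \<mu>.variance_eq[OF intY intY2] by (intro divide_right_mono) (auto simp: e_def)
  finally show ?thesis by (simp add: e_def)
qed

text \<open>
  Numbers in \<open>[-M, M]\<close> are moved to numbers in \<open>[-M, M]\<close> with a prescribed mean by pulling all of them
  towards \<open>- M\<close>, or all of them towards \<open>M\<close>, by the same fraction. Since every entry moves in the same
  direction, the total movement is the error of the sum.
\<close>

lemma reweight_to_mean:
  fixes m :: "'i \<Rightarrow> real" and A M :: real
  assumes J: "finite J" and m: "\<And>j. j \<in> J \<Longrightarrow> \<bar>m j\<bar> \<le> M" and A: "\<bar>A\<bar> \<le> M"
  shows "\<exists>w. (\<forall>j\<in>J. \<bar>w j\<bar> \<le> M) \<and> (\<Sum>j\<in>J. w j) = card J * A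
           \<and> (\<Sum>j\<in>J. \<bar>w j - m j\<bar>) = \<bar>(\<Sum>j\<in>J. m j) - card J * A\<bar>"
proof -
  have down: "\<exists>w :: 'i \<Rightarrow> real. (\<forall>j\<in>J. \<bar>w j\<bar> \<le> M) \<and> (\<Sum>j\<in>J. w j) = card J * A
        \<and> (\<Sum>j\<in>J. \<bar>w j - m j\<bar>) = (\<Sum>j\<in>J. m j) - card J * A"
    if m: "\<And>j. j \<in> J \<Longrightarrow> \<bar>m j\<bar> \<le> M" and A: "\<bar>A\<bar> \<le> M" and le: "card J * A \<le> (\<Sum>j\<in>J. m j)"
    for m :: "'i \<Rightarrow> real" and A :: real
  proof -
    let ?s = "\<Sum>j\<in>J. m j + M"
    have s: "?s = (\<Sum>j\<in>J. m j) + card J * M" by (simp add: sum.distrib)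
    have Am: "0 \<le> card J * A + card J * M"
      using A mult_nonneg_nonneg[of "real (card J)" "A + M"] by (simp add: distrib_left)
    show ?thesis
    proof (cases "?s = 0")
      case True
      then have "(\<Sum>j\<in>J. m j) = card J * A" using s le Am by linarith
      then show ?thesis using m by (intro exI[of _ m]) simp
    next
      case False
      then have s0: "?s > 0" using s le Am by linarith
      define t where "t = ((\<Sum>j\<in>J. m j) - card J * A) / ?s"
      have t: "0 \<le> t" "t \<le> 1" using s0 s le Am by (auto simp: t_def)
      have ts: "t * ?s = (\<Sum>j\<in>J. m j) - card J * A" using s0 by (simp add: t_def)
      define w where "w j = m j - t * (m j + M)" for j
      have "\<bar>w j\<bar> \<le> M" if "j \<in> J" for j
      proof -
        have mj: "0 \<le> m j + M" "m j \<le> M" using m[OF that] by auto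
        have "0 \<le> t * (m j + M)" "t * (m j + M) \<le> m j + M"
          using t mj mult_left_le_one_le[of "m j + M" t] by auto
        then show ?thesis using mj unfolding w_def by linarith
      qed
      moreover have "(\<Sum>j\<in>J. w j) = card J * A"
      proof -
        have "(\<Sum>j\<in>J. w j) = (\<Sum>j\<in>J. m j) - t * ?s"
          by (simp only: w_def sum_subtractf sum_distrib_left)
        then show ?thesis by (simp add: ts)
      qed
      moreover have "(\<Sum>j\<in>J. \<bar>w j - m j\<bar>) = (\<Sum>j\<in>J. m j) - card J * A"
      proof -
        have "\<bar>w j - m j\<bar> = t * (m j + M)" if "j \<in> J" for j
          using t m[OF that] by (simp add: w_def abs_mult)
        then have "(\<Sum>j\<in>J. \<bar>w j - m j\<bar>) = t * ?s"
          by (simp add: sum_distrib_left)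
        then show ?thesis by (simp add: ts)
      qed
      ultimately show ?thesis by blast
    qed
  qed
  show ?thesis
  proof (cases "card J * A \<le> (\<Sum>j\<in>J. m j)")
    case True
    then show ?thesis using down[OF m A True] by simp
  next
    case False
    have "\<exists>w :: 'i \<Rightarrow> real. (\<forall>j\<in>J. \<bar>w j\<bar> \<le> M) \<and> (\<Sum>j\<in>J. w j) = card J * (- A)
        \<and> (\<Sum>j\<in>J. \<bar>w j - (- m j)\<bar>) = (\<Sum>j\<in>J. - m j) - card J * (- A)"
      using m A False by (intro down) (auto simp: sum_negf)
    then obtain w where w: "\<forall>j\<in>J. \<bar>w j\<bar> \<le> M" "(\<Sum>j\<in>J. w j) = card J * (- A)"
      "(\<Sum>j\<in>J. \<bar>w j - (- m j)\<bar>) = (\<Sum>j\<in>J. - m j) - card J * (- A)" by blast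
    have "(\<Sum>j\<in>J. \<bar>- w j - m j\<bar>) = (\<Sum>j\<in>J. \<bar>w j - (- m j)\<bar>)"
      by (intro sum.cong) auto
    then show ?thesis using w False
      by (intro exI[of _ "\<lambda>j. - w j"]) (auto simp: sum_negf)
  qed
qed

text \<open>
  McShane's extension. It lets all continuity and measurability arguments for a Lipschitz activation
  take place on the whole line, and it assigns a value at \<open>0\<close> that is compatible with the values on \<open>I\<close>.
\<close>

lemma lipschitz_extension_real:
  fixes \<sigma> :: "real \<Rightarrow> real"
  assumes "lipschitz_cond \<sigma> I L" and ne: "I \<noteq> {}"
  obtains \<tau> where "\<And>u v. \<bar>\<tau> u - \<tau> v\<bar> \<le> L * \<bar>u - v\<bar>" and "\<And>u. u \<in> I \<Longrightarrow> \<tau> u = \<sigma> u"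
proof
  have L: "L > 0" and lip: "\<And>u v. u \<in> I \<Longrightarrow> v \<in> I \<Longrightarrow> \<bar>\<sigma> u - \<sigma> v\<bar> \<le> L * \<bar>u - v\<bar>"
    using assms(1) by (auto simp: lipschitz_cond_def)
  define \<tau> where "\<tau> u = (INF v\<in>I. \<sigma> v + L * \<bar>u - v\<bar>)" for u
  obtain v0 where v0: "v0 \<in> I" using ne by auto
  have tri: "L * \<bar>u - w\<bar> \<le> L * \<bar>u - v\<bar> + L * \<bar>v - w\<bar>" for u v w
    using mult_left_mono[of "\<bar>u - w\<bar>" "\<bar>u - v\<bar> + \<bar>v - w\<bar>" L] L by (simp add: distrib_left)
  have bdd: "bdd_below ((\<lambda>v. \<sigma> v + L * \<bar>u - v\<bar>) ` I)" for u
  proof (rule bdd_belowI2)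
    fix v assume "v \<in> I"
    then show "\<sigma> v0 - L * \<bar>v0 - u\<bar> \<le> \<sigma> v + L * \<bar>u - v\<bar>"
      using lip[OF v0, of v] tri[of v0 v u] by linarith
  qed
  have le: "\<tau> u \<le> \<tau> v + L * \<bar>u - v\<bar>" for u v
  proof -
    have "\<tau> u - L * \<bar>u - v\<bar> \<le> \<tau> v" unfolding \<tau>_def[of v]
    proof (rule cINF_greatest[OF ne])
      fix w assume "w \<in> I"
      then have "\<tau> u \<le> \<sigma> w + L * \<bar>u - w\<bar>" unfolding \<tau>_def by (intro cINF_lower bdd)
      then show "\<tau> u - L * \<bar>u - v\<bar> \<le> \<sigma> w + L * \<bar>v - w\<bar>" using tri[of u w v] by linarith
    qed
    then show ?thesis by linarith
  qed
  show "\<bar>\<tau> u - \<tau> v\<bar> \<le> L * \<bar>u - v\<bar>" for u v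
    using le[of u v] le[of v u] by (simp add: abs_minus_commute)
  show "\<tau> u = \<sigma> u" if u: "u \<in> I" for u
  proof (rule antisym)
    show "\<tau> u \<le> \<sigma> u" unfolding \<tau>_def using cINF_lower[OF bdd u, of u] by simp
    show "\<sigma> u \<le> \<tau> u" unfolding \<tau>_def
    proof (rule cINF_greatest[OF ne])
      fix v assume "v \<in> I"
      then show "\<sigma> u \<le> \<sigma> v + L * \<bar>u - v\<bar>" using lip[OF u, of v] by linarith
    qed
  qed
qed

section \<open>Sampled parameters\<close>

lemma borel_measurable_lift1 [measurable]: "lift1 \<in> borel \<rightarrow>\<^sub>M borel"
  unfolding lift1_def[abs_def] by measurable

text \<open>
  The base network with parameters \<open>\<gamma>\<close> and coefficients \<open>\<theta>\<close>, and a density \<open>P\<close> for the samples. The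
  coefficients do not all vanish; this ensures that there is a parameter and hence a cube inside \<open>U\<close>.
\<close>

locale sampling = unif_domain B for B :: "(real^'n::finite) set" +
  fixes lam :: real and \<Upsilon> :: "'n param set" and N R :: nat
    and \<theta> :: "nat \<Rightarrow> real" and \<gamma> :: "nat \<Rightarrow> 'n param" and P :: "'n param \<Rightarrow> real"
  assumes lam: "lam > 0" and bounded_params: "bounded \<Upsilon>"
    and params: "\<And>i. i \<in> {1..N} \<Longrightarrow> \<gamma> i \<in> \<Upsilon>"
    and density: "density_on (expanded lam \<Upsilon>) P"
    and P_min_pos: "P_min (expanded lam \<Upsilon>) P > 0"
    and R: "R \<ge> 1" and nontrivial: "(\<Sum>i=1..N. \<bar>\<theta> i\<bar>) > 0"
begin

abbreviation "U \<equiv> expanded lam \<Upsilon>"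

definition mass :: real where "mass = (\<Sum>i=1..N. \<bar>\<theta> i\<bar>)"

definition signed_mass :: real where "signed_mass = (\<Sum>i=1..N. \<theta> i)"

text \<open>
  The factors by which the largest possible importance weight exceeds the sum of the moduli of the
  coefficients, for the uniform kernel and for \<open>moll_delta lam\<close>, respectively.
\<close>

definition kernel_ratio :: real where "kernel_ratio = (lam / 2) ^ (CARD('n) + 1) / P_min U P"

definition coeff_ratio :: real where "coeff_ratio = (bump_eta * lam / exp 1) ^ (CARD('n) + 1) / P_min U P"

definition \<mu> :: "'n param measure" where "\<mu> = density lborel (\<lambda>y. ennreal (P y))"

abbreviation "Q \<equiv> Pi\<^sub>M {1..R} (\<lambda>_. \<mu>)"

text \<open>
  The importance weight: sampling from \<open>P\<close> with this weight reproduces the average of the base network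
  with coefficients \<open>\<eta>\<close> over the cubes around its parameters.
\<close>

definition weight :: "(nat \<Rightarrow> real) \<Rightarrow> 'n param \<Rightarrow> real" where
  "weight \<eta> y = (\<Sum>i=1..N. \<eta> i * uniform_kernel lam (y - \<gamma> i)) / P y"

lemma mass_pos: "mass > 0" using nontrivial by (simp add: mass_def)

lemma abs_signed_mass_le: "\<bar>signed_mass\<bar> \<le> mass" unfolding signed_mass_def mass_def by (rule sum_abs)

lemma P_measurable [measurable]: "P \<in> borel_measurable borel"
  and P_nonneg: "0 \<le> P y" and P_outside: "y \<notin> U \<Longrightarrow> P y = 0"
  and P_total: "(\<integral>\<^sup>+y. ennreal (P y) \<partial>lborel) = 1"
  using density unfolding density_on_def by blast+

lemma param_near: "i \<in> {1..N} \<Longrightarrow> y - \<gamma> i \<in> cube (1 / lam) \<Longrightarrow> y \<in> U"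
  by (rule expanded_memI[OF params])

lemma some_param: obtains i where "i \<in> {1..N}"
proof -
  have "{1..N} \<noteq> {}" using nontrivial by (metis less_irrefl sum.empty)
  then show ?thesis using that by blast
qed

lemma param_mem: "i \<in> {1..N} \<Longrightarrow> \<gamma> i \<in> U"
  using lam by (intro param_near) (auto simp: cube_def)

lemma U_nonempty: "U \<noteq> {}"
  using some_param param_mem by blast

lemma U_sets [measurable]: "U \<in> sets borel"
  using compact_expanded[OF bounded_params] by (intro borel_closed compact_imp_closed)

lemma bounded_U: "bounded U"
  using compact_expanded[OF bounded_params] by (rule compact_imp_bounded)

lemma norm_le_gamma_max: "y \<in> U \<Longrightarrow> norm y \<le> gamma_max U"
  unfolding gamma_max_def
  by (rule cSUP_upper) (use bounded_U in \<open>auto simp: bdd_above_norm[symmetric] image_image\<close>)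

lemma norm_diff_le_diameter: "y \<in> U \<Longrightarrow> z \<in> U \<Longrightarrow> norm (y - z) \<le> diameter U"
  using diameter_bounded_bound[OF bounded_U] by (simp add: dist_norm)

lemma gamma_max_pos: "gamma_max U > 0"
proof -
  obtain i where i: "i \<in> {1..N}" by (rule some_param)
  have shifted: "\<gamma> i + (0, 1 / lam) \<in> U"
    using lam by (intro param_near[OF i]) (auto simp: cube_def)
  have "\<gamma> i \<noteq> 0 \<or> \<gamma> i + (0, 1 / lam) \<noteq> 0"
    using lam by (auto simp: zero_prod_def)
  then obtain y where "y \<in> U" "norm y > 0" using shifted param_mem[OF i] by (metis zero_less_norm_iff)
  then show ?thesis using norm_le_gamma_max[of y] by linarith
qed

lemma P_min_le: "y \<in> U \<Longrightarrow> P_min U P \<le> P y"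
  unfolding P_min_def by (rule cINF_lower) (auto intro!: bdd_belowI2[where m = 0] simp: P_nonneg)

lemma kernel_measurable [measurable]: "uniform_kernel lam \<in> borel_measurable (borel :: 'n param measure)"
  using averaging_kernel_uniform_kernel[OF lam, where 'n = 'n] by (simp add: averaging_kernel_def)

lemma kernel_nonneg: "0 \<le> uniform_kernel lam (y :: 'n param)"
  using lam by (simp add: uniform_kernel_def)

lemma kernel_le: "uniform_kernel lam (y :: 'n param) \<le> (lam / 2) ^ (CARD('n) + 1)"
  using lam by (simp add: uniform_kernel_def indicator_def)

lemma kernel_outside: "i \<in> {1..N} \<Longrightarrow> y \<notin> U \<Longrightarrow> uniform_kernel lam (y - \<gamma> i) = 0"
  using param_near[of i y] by (auto simp: uniform_kernel_def indicator_def)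

text \<open>
  The density \<open>P\<close> is at least \<open>P_min U P\<close> on a cube of volume \<open>(2 / lam)^(n + 1)\<close> and has total mass \<open>1\<close>.
\<close>

lemma kernel_ratio_ge_1: "1 \<le> kernel_ratio"
proof -
  obtain i where i: "i \<in> {1..N}" by (rule some_param)
  define p where "p = P_min U P / (lam / 2) ^ (CARD('n) + 1)"
  have p: "p > 0" using P_min_pos lam by (simp add: p_def)
  have le: "p * uniform_kernel lam (y - \<gamma> i) \<le> P y" for y
  proof (cases "y \<in> U")
    case True
    have "p * uniform_kernel lam (y - \<gamma> i) \<le> p * (lam / 2) ^ (CARD('n) + 1)"
      using p by (intro mult_left_mono kernel_le) auto
    also have "\<dots> = P_min U P" using lam by (simp add: p_def)
    finally show ?thesis using P_min_le[OF True] by linarith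
  qed (simp add: kernel_outside[OF i] P_nonneg)
  have "ennreal p = (\<integral>\<^sup>+y. ennreal p * ennreal (uniform_kernel lam (y - \<gamma> i)) \<partial>lborel)"
    using averaging_kernel_translate[OF averaging_kernel_uniform_kernel[OF lam], of "\<gamma> i"]
    by (subst nn_integral_cmult) auto
  also have "\<dots> \<le> (\<integral>\<^sup>+y. ennreal (P y) \<partial>lborel)"
  proof (rule nn_integral_mono)
    fix y
    have "ennreal p * ennreal (uniform_kernel lam (y - \<gamma> i)) = ennreal (p * uniform_kernel lam (y - \<gamma> i))"
      using p by (simp add: ennreal_mult kernel_nonneg)
    also have "\<dots> \<le> ennreal (P y)" by (rule ennreal_leI[OF le])
    finally show "ennreal p * ennreal (uniform_kernel lam (y - \<gamma> i)) \<le> ennreal (P y)" .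
  qed
  finally have "p \<le> 1" by (simp add: P_total)
  then show ?thesis using P_min_pos lam by (simp add: p_def kernel_ratio_def field_simps)
qed

text \<open>
  The quotient of the two ratios is \<open>(2 * bump_eta / e)^(n + 1) \<ge> (3 / 2)\<^sup>2 > 2\<close>.
\<close>

lemma twice_kernel_ratio_le: "2 * kernel_ratio \<le> coeff_ratio"
proof -
  have "(2::real) \<le> (3 / 2) ^ 2" by (simp add: power2_eq_square)
  also have "\<dots> \<le> (3 / 2) ^ (CARD('n) + 1)"
  proof (rule power_increasing)
    show "2 \<le> CARD('n) + 1" using zero_less_card_finite[where 'a = 'n] by linarith
  qed simp
  also have "\<dots> \<le> (2 * (bump_eta / exp 1)) ^ (CARD('n) + 1)"
  proof (rule power_mono)
    show "3 / 2 \<le> 2 * (bump_eta / exp 1)" using bump_eta_ge by linarith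
  qed simp
  finally have "2 * (lam / 2) ^ (CARD('n) + 1) \<le> (2 * (bump_eta / exp 1)) ^ (CARD('n) + 1) * (lam / 2) ^ (CARD('n) + 1)"
    using lam by (intro mult_right_mono) auto
  also have "\<dots> = (bump_eta * lam / exp 1) ^ (CARD('n) + 1)"
    by (simp only: power_mult_distrib[symmetric]) (simp add: field_simps)
  finally have "2 * (lam / 2) ^ (CARD('n) + 1) \<le> (bump_eta * lam / exp 1) ^ (CARD('n) + 1)" .
  from divide_right_mono[OF this less_imp_le[OF P_min_pos]] show ?thesis
    by (simp only: kernel_ratio_def coeff_ratio_def times_divide_eq_right)
qed

lemma g_max_eq: "g_max TYPE('n) lam N \<theta> / P_min U P = mass * coeff_ratio"
  unfolding g_max_def mass_def coeff_ratio_def sum_distrib_right[symmetric] by (simp only: times_divide_eq_right)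

lemma space_\<mu> [simp]: "space \<mu> = UNIV" and sets_\<mu> [measurable_cong, simp]: "sets \<mu> = sets borel"
  by (simp_all add: \<mu>_def)

lemma prob_space_\<mu>: "prob_space \<mu>"
proof
  have "emeasure \<mu> (space \<mu>) = (\<integral>\<^sup>+y. ennreal (P y) \<partial>lborel)"
    unfolding \<mu>_def by (subst emeasure_density) auto
  then show "emeasure \<mu> (space \<mu>) = 1" by (simp add: P_total)
qed

sublocale \<mu>: prob_space \<mu> by (rule prob_space_\<mu>)

sublocale Q: prob_space Q by (intro prob_space_PiM prob_space_\<mu>)

lemma AE_\<mu>_U: "AE y in \<mu>. y \<in> U"
proof -
  have "AE y in lborel. 0 < ennreal (P y) \<longrightarrow> y \<in> U"
    using P_outside by (intro AE_I2 impI) (metis ennreal_0 less_irrefl)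
  then show ?thesis unfolding \<mu>_def by (subst AE_density) auto
qed

lemma AE_Q_U: "AE x in Q. \<forall>j\<in>{1..R}. x j \<in> U"
  by (intro AE_finite_allI AE_PiM_component prob_space_\<mu> AE_\<mu>_U) auto

lemma weight_measurable [measurable]: "weight \<eta> \<in> borel_measurable borel"
  unfolding weight_def[abs_def] by measurable

lemma weight_outside: "y \<notin> U \<Longrightarrow> weight \<eta> y = 0"
  by (simp add: weight_def kernel_outside)

lemma abs_weight_le: "\<bar>weight \<eta> y\<bar> \<le> (\<Sum>i=1..N. \<bar>\<eta> i\<bar>) * kernel_ratio"
proof (cases "y \<in> U")
  case True
  have "\<bar>\<Sum>i=1..N. \<eta> i * uniform_kernel lam (y - \<gamma> i)\<bar> \<le> (\<Sum>i=1..N. \<bar>\<eta> i\<bar> * (lam / 2) ^ (CARD('n) + 1))"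
  proof (rule sum_abs[THEN order_trans], rule sum_mono)
    fix i
    have "\<bar>\<eta> i * uniform_kernel lam (y - \<gamma> i)\<bar> = \<bar>\<eta> i\<bar> * uniform_kernel lam (y - \<gamma> i)"
      by (simp add: abs_mult kernel_nonneg)
    also have "\<dots> \<le> \<bar>\<eta> i\<bar> * (lam / 2) ^ (CARD('n) + 1)" by (intro mult_left_mono kernel_le) auto
    finally show "\<bar>\<eta> i * uniform_kernel lam (y - \<gamma> i)\<bar> \<le> \<bar>\<eta> i\<bar> * (lam / 2) ^ (CARD('n) + 1)" .
  qed
  then have "\<bar>weight \<eta> y\<bar> \<le> (\<Sum>i=1..N. \<bar>\<eta> i\<bar> * (lam / 2) ^ (CARD('n) + 1)) / P_min U P"
    using P_min_le[OF True] P_min_pos P_nonneg[of y] lam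
    unfolding weight_def abs_divide
    by (intro frac_le) (auto intro!: sum_nonneg)
  then show ?thesis by (simp only: kernel_ratio_def sum_distrib_right times_divide_eq_right)
next
  case False
  then show ?thesis using kernel_ratio_ge_1 by (simp add: weight_outside sum_nonneg)
qed

lemma weight_integral:
  fixes g :: "'n param \<Rightarrow> real"
  assumes g [measurable]: "g \<in> borel_measurable borel"
    and close: "\<And>i y. i \<in> {1..N} \<Longrightarrow> y - \<gamma> i \<in> cube (1 / lam) \<Longrightarrow> \<bar>g y - g (\<gamma> i)\<bar> \<le> K"
  shows "integrable \<mu> (\<lambda>y. weight \<eta> y * g y)"
    and "\<bar>(\<integral>y. weight \<eta> y * g y \<partial>\<mu>) - (\<Sum>i=1..N. \<eta> i * g (\<gamma> i))\<bar> \<le> (\<Sum>i=1..N. \<bar>\<eta> i\<bar>) * K"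
proof -
  have pointwise: "P y * (weight \<eta> y * g y)
      = (\<Sum>i=1..N. \<eta> i * (uniform_kernel lam (y - \<gamma> i) * g y))" for y
  proof (cases "y \<in> U")
    case True
    then have "P y \<noteq> 0" using P_min_le[OF True] P_min_pos by linarith
    then show ?thesis by (simp add: weight_def sum_distrib_right mult.assoc)
  qed (simp add: P_outside kernel_outside)
  have int: "integrable lborel (\<lambda>y. uniform_kernel lam (y - \<gamma> i) * g y)"
    and near: "\<bar>(\<integral>y. uniform_kernel lam (y - \<gamma> i) * g y \<partial>lborel) - g (\<gamma> i)\<bar> \<le> K"
    if "i \<in> {1..N}" for i
    using averaging_kernel_integral[OF averaging_kernel_uniform_kernel[OF lam], of g "\<gamma> i" "g (\<gamma> i)" K]
      close[OF that] by auto
  have ints: "integrable lborel (\<lambda>y. \<Sum>i=1..N. \<eta> i * (uniform_kernel lam (y - \<gamma> i) * g y))"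
    by (intro Bochner_Integration.integrable_sum integrable_mult_right int)
  show "integrable \<mu> (\<lambda>y. weight \<eta> y * g y)"
    unfolding \<mu>_def by (subst integrable_density) (use ints in \<open>auto simp: P_nonneg pointwise\<close>)
  have "(\<integral>y. weight \<eta> y * g y \<partial>\<mu>)
      = (\<integral>y. (\<Sum>i=1..N. \<eta> i * (uniform_kernel lam (y - \<gamma> i) * g y)) \<partial>lborel)"
    unfolding \<mu>_def by (subst integral_density) (auto simp: P_nonneg pointwise)
  also have "\<dots> = (\<Sum>i=1..N. \<eta> i * (\<integral>y. uniform_kernel lam (y - \<gamma> i) * g y \<partial>lborel))"
    by (subst Bochner_Integration.integral_sum) (auto intro: int)
  finally have "(\<integral>y. weight \<eta> y * g y \<partial>\<mu>) - (\<Sum>i=1..N. \<eta> i * g (\<gamma> i))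
      = (\<Sum>i=1..N. \<eta> i * ((\<integral>y. uniform_kernel lam (y - \<gamma> i) * g y \<partial>lborel) - g (\<gamma> i)))"
    by (simp add: right_diff_distrib sum_subtractf)
  also have "\<bar>\<dots>\<bar> \<le> (\<Sum>i=1..N. \<bar>\<eta> i\<bar> * K)"
    by (intro sum_abs[THEN order_trans] sum_mono) (simp add: abs_mult near mult_left_mono)
  finally show "\<bar>(\<integral>y. weight \<eta> y * g y \<partial>\<mu>) - (\<Sum>i=1..N. \<eta> i * g (\<gamma> i))\<bar> \<le> (\<Sum>i=1..N. \<bar>\<eta> i\<bar>) * K"
    by (simp add: sum_distrib_right)
qed

lemma weight_total: "(\<integral>y. weight \<eta> y \<partial>\<mu>) = (\<Sum>i=1..N. \<eta> i)"
  and weight_integrable: "integrable \<mu> (weight \<eta>)"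
  using weight_integral[of "\<lambda>_. 1" 0 \<eta>] by auto

text \<open>
  One factor of the square is estimated by its maximum, the other by its mean.
\<close>

lemma weight_second_moment:
  "integrable \<mu> (\<lambda>y. (weight \<theta> y)\<^sup>2)" "(\<integral>y. (weight \<theta> y)\<^sup>2 \<partial>\<mu>) \<le> mass\<^sup>2 * kernel_ratio"
proof -
  let ?a = "\<lambda>i. \<bar>\<theta> i\<bar>"
  have le: "\<bar>weight \<theta> y\<bar> \<le> weight ?a y" for y
  proof -
    have "\<bar>\<Sum>i=1..N. \<theta> i * uniform_kernel lam (y - \<gamma> i)\<bar> \<le> (\<Sum>i=1..N. \<bar>\<theta> i\<bar> * uniform_kernel lam (y - \<gamma> i))"
      by (intro sum_abs[THEN order_trans] sum_mono) (simp add: abs_mult kernel_nonneg)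
    then show ?thesis by (simp add: weight_def P_nonneg divide_right_mono)
  qed
  have le2: "(weight \<theta> y)\<^sup>2 \<le> (mass * kernel_ratio) * weight ?a y" for y
  proof -
    have "(weight \<theta> y)\<^sup>2 = \<bar>weight \<theta> y\<bar> * \<bar>weight \<theta> y\<bar>" by (simp add: power2_eq_square)
    also have "\<dots> \<le> (mass * kernel_ratio) * weight ?a y"
      using abs_weight_le[of \<theta> y] le[of y] mass_pos kernel_ratio_ge_1 by (intro mult_mono) (auto simp: mass_def)
    finally show ?thesis .
  qed
  show int: "integrable \<mu> (\<lambda>y. (weight \<theta> y)\<^sup>2)"
  proof (rule Bochner_Integration.integrable_bound)
    show "integrable \<mu> (\<lambda>y. (mass * kernel_ratio) * weight ?a y)" by (intro integrable_mult_right weight_integrable)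
    show "AE y in \<mu>. norm ((weight \<theta> y)\<^sup>2) \<le> norm ((mass * kernel_ratio) * weight ?a y)"
      using le2 by (intro AE_I2) (smt (verit) real_norm_def zero_le_power2)
  qed measurable
  have "(\<integral>y. (weight \<theta> y)\<^sup>2 \<partial>\<mu>) \<le> (\<integral>y. (mass * kernel_ratio) * weight ?a y \<partial>\<mu>)"
    by (intro integral_mono int le2 integrable_mult_right weight_integrable)
  also have "\<dots> = mass\<^sup>2 * kernel_ratio" by (simp add: weight_total mass_def power2_eq_square)
  finally show "(\<integral>y. (weight \<theta> y)\<^sup>2 \<partial>\<mu>) \<le> mass\<^sup>2 * kernel_ratio" .
qed

definition coeffs :: "(nat \<Rightarrow> real) set" where
  "coeffs = {c. \<forall>j\<in>{1..R}. \<bar>c j\<bar> \<le> mass * coeff_ratio / R}"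

text \<open>
  With the equal coefficients \<open>(\<Sum>\<theta> i) / R\<close> the error is a combination of differences \<open>\<sigma> u - \<sigma> v\<close> whose
  coefficients have moduli summing up to at most \<open>mass\<close>.
\<close>

lemma oscillation_approximation:
  assumes cont: "AE u in lebesgue. isCont \<sigma> u"
    and osc: "oscillation_cond \<sigma> (preactivations U B) D"
    and x: "\<And>j. j \<in> {1..R} \<Longrightarrow> x j \<in> U"
  shows "\<exists>c\<in>coeffs. L2_norm_le B (\<lambda>y. shallow_net \<sigma> N \<theta> \<gamma> y - shallow_net \<sigma> R c x y) (mass * D)"
proof (rule bexI)
  define c where "c j = signed_mass / R" for j :: nat
  have Rp: "real R > 0" using R by simp
  have "1 \<le> coeff_ratio" using kernel_ratio_ge_1 twice_kernel_ratio_le by linarith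
  then have "\<bar>signed_mass\<bar> \<le> mass * coeff_ratio" using abs_signed_mass_le mass_pos mult_left_mono[of 1 coeff_ratio mass] by linarith
  then show "c \<in> coeffs" by (simp add: coeffs_def c_def divide_right_mono)
  show "L2_norm_le B (\<lambda>y. shallow_net \<sigma> N \<theta> \<gamma> y - shallow_net \<sigma> R c x y) (mass * D)"
  proof (rule L2_norm_le_mono[OF L2_norm_le_const])
    show "0 \<le> mass * D" using mass_pos osc by (simp add: oscillation_cond_def)
    show "(\<lambda>y. shallow_net \<sigma> N \<theta> \<gamma> y - shallow_net \<sigma> R c x y) \<in> borel_measurable (unif_meas B)"
      using borel_measurable_shallow_net[OF cont] by (intro borel_measurable_diff) auto
    fix y assume y: "y \<in> B"
    have close: "\<bar>\<sigma> (\<gamma> i \<bullet> lift1 y) - \<sigma> (x j \<bullet> lift1 y)\<bar> \<le> D" if "i \<in> {1..N}" "j \<in> {1..R}" for i j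
      using osc param_mem[OF that(1)] x[OF that(2)] y
      unfolding oscillation_cond_def preactivations_def by blast
    have "shallow_net \<sigma> R c x y = (\<Sum>j=1..R. \<Sum>i=1..N. \<theta> i / R * \<sigma> (x j \<bullet> lift1 y))"
      by (simp add: shallow_net_def c_def signed_mass_def sum_divide_distrib sum_distrib_right)
    also have "\<dots> = (\<Sum>i=1..N. \<theta> i * ((\<Sum>j=1..R. \<sigma> (x j \<bullet> lift1 y)) / R))"
      by (subst sum.swap) (simp add: sum_distrib_left sum_divide_distrib)
    finally have "shallow_net \<sigma> N \<theta> \<gamma> y - shallow_net \<sigma> R c x y
        = (\<Sum>i=1..N. \<theta> i * (\<sigma> (\<gamma> i \<bullet> lift1 y) - (\<Sum>j=1..R. \<sigma> (x j \<bullet> lift1 y)) / R))"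
      by (simp add: shallow_net_def[of \<sigma> N] sum_subtractf right_diff_distrib)
    also have "\<bar>\<dots>\<bar> \<le> (\<Sum>i=1..N. \<bar>\<theta> i\<bar> * D)"
    proof (rule sum_abs[THEN order_trans], rule sum_mono)
      fix i assume i: "i \<in> {1..N}"
      let ?u = "\<sigma> (\<gamma> i \<bullet> lift1 y)"
      have "?u - (\<Sum>j=1..R. \<sigma> (x j \<bullet> lift1 y)) / R = (\<Sum>j=1..R. ?u - \<sigma> (x j \<bullet> lift1 y)) / R"
        using Rp by (simp add: sum_subtractf diff_divide_distrib)
      also have "\<bar>\<dots>\<bar> \<le> (\<Sum>j=1..R. D) / R"
        unfolding abs_divide using i close
        by (intro frac_le sum_abs[THEN order_trans] sum_mono) (use Rp osc in \<open>auto simp: oscillation_cond_def\<close>)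
      also have "\<dots> = D" using Rp by simp
      finally show "\<bar>\<theta> i * (?u - (\<Sum>j=1..R. \<sigma> (x j \<bullet> lift1 y)) / R)\<bar> \<le> \<bar>\<theta> i\<bar> * D"
        by (simp add: abs_mult mult_left_mono)
    qed
    finally show "\<bar>shallow_net \<sigma> N \<theta> \<gamma> y - shallow_net \<sigma> R c x y\<bar> \<le> mass * D"
      by (simp add: mass_def sum_distrib_right)
  qed
qed

lemma samples_in_U: "{x \<in> space Q. \<forall>j\<in>{1..R}. x j \<in> U} \<in> sets Q"
    "measure Q {x \<in> space Q. \<forall>j\<in>{1..R}. x j \<in> U} = 1"
proof -
  show S: "{x \<in> space Q. \<forall>j\<in>{1..R}. x j \<in> U} \<in> sets Q" by measurable
  show "measure Q {x \<in> space Q. \<forall>j\<in>{1..R}. x j \<in> U} = 1"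
    using Q.prob_Collect_eq_1[OF S] AE_Q_U by simp
qed

text \<open>
  Independence turns the joint law of the samples into the product measure \<open>Q\<close>.
\<close>

lemma samples_distribution:
  fixes \<Gamma> :: "nat \<Rightarrow> 'w \<Rightarrow> 'n param"
  assumes iid: "iid_samples M R \<Gamma> P" and S: "S \<in> sets Q"
  shows "{\<omega> \<in> space M. (\<lambda>j\<in>{1..R}. \<Gamma> j \<omega>) \<in> S} \<in> sets M"
    and "measure M {\<omega> \<in> space M. (\<lambda>j\<in>{1..R}. \<Gamma> j \<omega>) \<in> S} = measure Q S"
proof -
  interpret M: prob_space M using iid by (simp add: iid_samples_def)
  let ?X = "\<lambda>\<omega>. \<lambda>j\<in>{1..R}. \<Gamma> j \<omega>"
  let ?borels = "Pi\<^sub>M {1..R} (\<lambda>_. borel :: 'n param measure)"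
  have law: "distr M borel (\<Gamma> j) = \<mu>" and rv: "\<Gamma> j \<in> borel_measurable M" if "j \<in> {1..R}" for j
  proof -
    have d: "distributed M lborel (\<Gamma> j) (\<lambda>y. ennreal (P y))" using iid that by (simp add: iid_samples_def)
    show "\<Gamma> j \<in> borel_measurable M" using distributed_measurable[OF d] by simp
    have "distr M borel (\<Gamma> j) = distr M lborel (\<Gamma> j)" by (rule distr_cong) auto
    then show "distr M borel (\<Gamma> j) = \<mu>"
      using distributed_distr_eq_density[OF d] by (simp add: \<mu>_def)
  qed
  have X [measurable]: "?X \<in> M \<rightarrow>\<^sub>M ?borels"
    by (rule measurable_restrict) (rule rv)
  have "M.indep_vars (\<lambda>_. borel) \<Gamma> {1..R}" using iid by (simp add: iid_samples_def)
  then have "distr M ?borels ?X = Pi\<^sub>M {1..R} (\<lambda>j. distr M borel (\<Gamma> j))"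
    using R by (subst (asm) M.indep_vars_iff_distr_eq_PiM') (auto intro: rv)
  also have "\<dots> = Q" by (rule PiM_cong) (simp_all add: law)
  finally have XQ: "distr M ?borels ?X = Q" .
  have "sets Q = sets ?borels" by (rule sets_PiM_cong) simp_all
  then have S': "S \<in> sets ?borels" using S by simp
  have eq: "{\<omega> \<in> space M. ?X \<omega> \<in> S} = ?X -` S \<inter> space M" by auto
  show "{\<omega> \<in> space M. ?X \<omega> \<in> S} \<in> sets M" unfolding eq by (rule measurable_sets[OF X S'])
  show "measure M {\<omega> \<in> space M. ?X \<omega> \<in> S} = measure Q S"
    unfolding eq XQ[symmetric] by (rule measure_distr[OF X S', symmetric])
qed

end

section \<open>The best coefficients for given samples\<close>

text \<open>
  Here the activation \<open>\<tau>\<close> is Lipschitz on the whole line; it will be an extension of \<open>\<sigma>\<close>.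
\<close>

locale lipschitz_sampling = sampling B lam \<Upsilon> N R \<theta> \<gamma> P
  for B :: "(real^'n::finite) set" and lam \<Upsilon> N R \<theta> \<gamma> P +
  fixes \<tau> :: "real \<Rightarrow> real" and L :: real
  assumes L: "L > 0" and lipschitz: "\<And>u v. \<bar>\<tau> u - \<tau> v\<bar> \<le> L * \<bar>u - v\<bar>"
begin

text \<open>
  The unit is normalised to vanish at preactivation \<open>0\<close>, so that its modulus is bounded by a multiple of
  the norm of the parameter.
\<close>

definition hidden_unit :: "real^'n \<Rightarrow> 'n param \<Rightarrow> real" where
  "hidden_unit x y = \<tau> (y \<bullet> lift1 x) - \<tau> 0"

lemma continuous_activation: "continuous_on UNIV \<tau>"
proof -
  have "L-lipschitz_on UNIV \<tau>"
    using L lipschitz by (intro lipschitz_onI) (auto simp: dist_real_def)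
  then show ?thesis by (rule lipschitz_on_continuous_on)
qed

lemma activation_measurable [measurable]: "\<tau> \<in> borel_measurable borel"
  by (rule borel_measurable_continuous_onI[OF continuous_activation])

lemma lift1_measurable_unif [measurable]: "lift1 \<in> unif_meas B \<rightarrow>\<^sub>M borel"
  using measurable_compose[OF measurable_ident_unif borel_measurable_lift1] by simp

lemma lipschitz_in_param: "\<bar>\<tau> (y \<bullet> lift1 x) - \<tau> (z \<bullet> lift1 x)\<bar> \<le> L * norm (y - z) * norm (lift1 x)"
proof -
  have "\<bar>\<tau> (y \<bullet> lift1 x) - \<tau> (z \<bullet> lift1 x)\<bar> \<le> L * \<bar>(y - z) \<bullet> lift1 x\<bar>"
    using lipschitz[of "y \<bullet> lift1 x" "z \<bullet> lift1 x"] by (simp add: inner_diff_left)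
  also have "\<dots> \<le> L * (norm (y - z) * norm (lift1 x))"
    using L by (intro mult_left_mono Cauchy_Schwarz_ineq2) auto
  finally show ?thesis by (simp add: mult.assoc)
qed

lemma hidden_unit_measurable [measurable]: "hidden_unit x \<in> borel_measurable borel"
  unfolding hidden_unit_def[abs_def] by measurable

lemma abs_hidden_unit_le: "\<bar>hidden_unit x y\<bar> \<le> L * norm y * norm (lift1 x)"
  using lipschitz_in_param[of y x 0] by (simp add: hidden_unit_def)

lemma abs_hidden_unit_le_U: "y \<in> U \<Longrightarrow> \<bar>hidden_unit x y\<bar> \<le> L * gamma_max U * norm (lift1 x)"
  using L norm_le_gamma_max[of y]
  by (intro order_trans[OF abs_hidden_unit_le] mult_right_mono mult_left_mono) simp_all

definition err :: "(nat \<Rightarrow> real) \<Rightarrow> (nat \<Rightarrow> 'n param) \<Rightarrow> real^'n \<Rightarrow> real" where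
  "err c g x = shallow_net \<tau> N \<theta> \<gamma> x - shallow_net \<tau> R c g x"

lemma net_measurable: "shallow_net \<tau> n c g \<in> borel_measurable (unif_meas B)"
  unfolding shallow_net_def[abs_def] by measurable

lemma net_square_integrable: "\<exists>K. L2_norm_le B (shallow_net \<tau> n c g) K"
proof -
  let ?K = "\<Sum>j=1..n. \<bar>c j\<bar> * (\<bar>\<tau> 0\<bar> + L * norm (g j))"
  have "\<bar>shallow_net \<tau> n c g x\<bar> \<le> ?K * norm (lift1 x)" for x
    unfolding shallow_net_def sum_distrib_right
  proof (rule sum_abs[THEN order_trans], rule sum_mono)
    fix j
    have "\<bar>\<tau> (g j \<bullet> lift1 x)\<bar> \<le> \<bar>\<tau> 0\<bar> * 1 + L * norm (g j) * norm (lift1 x)"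
      using abs_hidden_unit_le[of x "g j"] by (simp add: hidden_unit_def)
    also have "\<dots> \<le> \<bar>\<tau> 0\<bar> * norm (lift1 x) + L * norm (g j) * norm (lift1 x)"
      by (intro add_right_mono mult_left_mono norm_lift1_ge_1) auto
    finally have "\<bar>\<tau> (g j \<bullet> lift1 x)\<bar> \<le> (\<bar>\<tau> 0\<bar> + L * norm (g j)) * norm (lift1 x)"
      by (simp add: distrib_right)
    then show "\<bar>c j * \<tau> (g j \<bullet> lift1 x)\<bar> \<le> \<bar>c j\<bar> * (\<bar>\<tau> 0\<bar> + L * norm (g j)) * norm (lift1 x)"
      by (simp add: abs_mult mult.assoc mult_left_mono)
  qed
  moreover have "0 \<le> ?K" using L by (intro sum_nonneg) auto
  ultimately show ?thesis using L2_norm_le_lift1[OF _ net_measurable] by blast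
qed

lemma L2_norm_le_err: "L2_norm_le B (err c g) (L2_norm B (err c g))"
proof -
  obtain K1 where K1: "L2_norm_le B (shallow_net \<tau> N \<theta> \<gamma>) K1"
    using net_square_integrable by blast
  obtain K2 where K2: "L2_norm_le B (shallow_net \<tau> R (\<lambda>j. - c j) g) K2"
    using net_square_integrable by blast
  have "L2_norm_le B (err c g) (K1 + K2)"
    by (rule L2_norm_le_cong[OF L2_norm_le_add[OF K1 K2]]) (simp add: err_def shallow_net_def sum_negf)
  then show ?thesis by (simp add: L2_norm_le_def)
qed

lemma L2_norm_err_diff:
  "L2_norm B (err c g) \<le> L2_norm B (err c g') + (\<Sum>j=1..R. \<bar>c j\<bar> * (L * norm (g j - g' j))) * E_const B"
proof -
  let ?h = "\<lambda>x. shallow_net \<tau> R c g' x - shallow_net \<tau> R c g x"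
  let ?K = "\<Sum>j=1..R. \<bar>c j\<bar> * (L * norm (g j - g' j))"
  have h: "L2_norm_le B ?h (?K * E_const B)"
  proof (rule L2_norm_le_lift1)
    show "0 \<le> ?K" using L by (intro sum_nonneg) auto
    show "?h \<in> borel_measurable (unif_meas B)"
      using net_measurable[of R c g] net_measurable[of R c g'] by measurable
    fix x
    have "?h x = (\<Sum>j=1..R. c j * (\<tau> (g' j \<bullet> lift1 x) - \<tau> (g j \<bullet> lift1 x)))"
      by (simp add: shallow_net_def sum_subtractf right_diff_distrib)
    also have "\<bar>\<dots>\<bar> \<le> (\<Sum>j=1..R. \<bar>c j\<bar> * (L * norm (g j - g' j) * norm (lift1 x)))"
    proof (rule sum_abs[THEN order_trans], rule sum_mono)
      fix j
      have "\<bar>\<tau> (g' j \<bullet> lift1 x) - \<tau> (g j \<bullet> lift1 x)\<bar> \<le> L * norm (g j - g' j) * norm (lift1 x)"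
        using lipschitz_in_param[of "g' j" x "g j"] by (simp add: norm_minus_commute)
      then show "\<bar>c j * (\<tau> (g' j \<bullet> lift1 x) - \<tau> (g j \<bullet> lift1 x))\<bar>
          \<le> \<bar>c j\<bar> * (L * norm (g j - g' j) * norm (lift1 x))"
        by (simp add: abs_mult mult_left_mono)
    qed
    finally show "\<bar>?h x\<bar> \<le> ?K * norm (lift1 x)" by (simp add: sum_distrib_right mult.assoc)
  qed
  have "L2_norm_le B (err c g) (L2_norm B (err c g') + ?K * E_const B)"
    by (rule L2_norm_le_cong[OF L2_norm_le_add[OF L2_norm_le_err h]]) (simp add: err_def)
  then show ?thesis by (simp add: L2_norm_le_def)
qed

lemma continuous_L2_norm_err: "continuous_on UNIV (\<lambda>g. L2_norm B (err c g))"
  unfolding continuous_on_def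
proof
  fix g :: "nat \<Rightarrow> 'n param"
  define D where "D g' = (\<Sum>j=1..R. \<bar>c j\<bar> * (L * norm (g' j - g j))) * E_const B" for g'
  have "continuous_on UNIV D"
    unfolding D_def[abs_def] by (intro continuous_intros continuous_on_product_coordinates)
  then have "(D \<longlongrightarrow> D g) (at g within UNIV)" by (simp add: continuous_on_def)
  then have D0: "(D \<longlongrightarrow> 0) (at g within UNIV)" by (simp add: D_def)
  have "((\<lambda>g'. L2_norm B (err c g') - L2_norm B (err c g)) \<longlongrightarrow> 0) (at g within UNIV)"
  proof (rule Lim_null_comparison[OF always_eventually D0], rule allI)
    fix g' :: "nat \<Rightarrow> 'n param"
    show "norm (L2_norm B (err c g') - L2_norm B (err c g)) \<le> D g'"
      using L2_norm_err_diff[of c g' g] L2_norm_err_diff[of c g g']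
      by (simp add: D_def norm_minus_commute abs_le_iff)
  qed
  then show "((\<lambda>g. L2_norm B (err c g)) \<longlongrightarrow> L2_norm B (err c g)) (at g within UNIV)"
    by (simp add: LIM_zero_iff)
qed

definition best_error :: "(nat \<Rightarrow> 'n param) \<Rightarrow> real" where
  "best_error g = (INF c\<in>coeffs. L2_norm B (err c g))"

lemma coeff_ratio_pos: "coeff_ratio > 0" using twice_kernel_ratio_le kernel_ratio_ge_1 by linarith

lemma zero_coeffs: "(\<lambda>_. 0) \<in> coeffs"
  using mass_pos coeff_ratio_pos by (simp add: coeffs_def)

lemma bdd_below_errs: "bdd_below ((\<lambda>c. L2_norm B (err c g)) ` coeffs)"
  by (rule bdd_belowI2[where m = 0]) (rule L2_norm_nonneg)

lemma best_error_le: "c \<in> coeffs \<Longrightarrow> best_error g \<le> L2_norm B (err c g)"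
  unfolding best_error_def by (intro cINF_lower bdd_below_errs)

lemma best_error_less_iff: "best_error g < r \<longleftrightarrow> (\<exists>c\<in>coeffs. L2_norm B (err c g) < r)"
  unfolding best_error_def using zero_coeffs by (intro cINF_less_iff bdd_below_errs) auto

lemma best_error_nonneg: "0 \<le> best_error g"
  unfolding best_error_def using zero_coeffs by (intro cINF_greatest L2_norm_nonneg) auto

lemma best_error_bounded: "best_error g \<le> L2_norm B (shallow_net \<tau> N \<theta> \<gamma>)"
proof -
  have "err (\<lambda>_. 0) g = shallow_net \<tau> N \<theta> \<gamma>" by (simp add: err_def shallow_net_def fun_eq_iff)
  then show ?thesis using best_error_le[OF zero_coeffs, of g] by simp
qed

text \<open>
  The infimum ranges over uncountably many coefficient vectors, but it is upper semicontinuous in the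
  parameters, as an infimum of functions that are continuous in the product topology.
\<close>

lemma best_error_measurable: "best_error \<in> borel_measurable borel"
proof (rule borel_measurableI_less)
  fix r
  have "{g \<in> space borel. best_error g < r} = (\<Union>c\<in>coeffs. {g. L2_norm B (err c g) < r})"
    by (auto simp: best_error_less_iff)
  moreover have "open (\<Union>c\<in>coeffs. {g. L2_norm B (err c g) < r})"
    by (intro open_UN ballI open_Collect_less continuous_L2_norm_err continuous_on_const)
  ultimately show "{g \<in> space borel. best_error g < r} \<in> sets borel" by simp
qed

text \<open>
  The same coefficients are admissible for \<open>g\<close> and for \<open>g'\<close>, and for each of them the two errors differ
  only through the term with index \<open>j\<close>.
\<close>

lemma best_error_diff:
  assumes eq: "\<And>i. i \<in> {1..R} - {j} \<Longrightarrow> g i = g' i" and j: "j \<in> {1..R}"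
    and near: "norm (g j - g' j) \<le> D"
  shows "best_error g \<le> best_error g' + mass * coeff_ratio / R * L * D * E_const B"
proof -
  have "best_error g - mass * coeff_ratio / R * L * D * E_const B \<le> best_error g'"
    unfolding best_error_def[of g']
  proof (rule cINF_greatest)
    fix c assume c: "c \<in> coeffs"
    have "(\<Sum>i=1..R. \<bar>c i\<bar> * (L * norm (g i - g' i))) = \<bar>c j\<bar> * (L * norm (g j - g' j))"
      using eq by (subst sum.remove[OF _ j]) (auto intro!: sum.neutral)
    also have "\<dots> \<le> mass * coeff_ratio / R * (L * D)"
      using c j near L by (intro mult_mono) (auto simp: coeffs_def)
    finally have "(\<Sum>i=1..R. \<bar>c i\<bar> * (L * norm (g i - g' i))) * E_const B \<le> mass * coeff_ratio / R * (L * D) * E_const B"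
      using E_const_ge_1 by (intro mult_right_mono) auto
    then show "best_error g - mass * coeff_ratio / R * L * D * E_const B \<le> L2_norm B (err c g')"
      using best_error_le[OF c, of g] L2_norm_err_diff[of c g g'] by (simp add: mult.assoc)
  qed (use zero_coeffs in auto)
  then show ?thesis by simp
qed

text \<open>
  Samples lie in \<open>U\<close> almost surely only. Replacing the others by a point of \<open>U\<close> makes the bounded
  difference property hold everywhere; the value \<open>0\<close> outside \<open>{1..R}\<close> turns the extensional functions
  of the product measure into points of the product topology on all functions.
\<close>

definition into_U :: "(nat \<Rightarrow> 'n param) \<Rightarrow> nat \<Rightarrow> 'n param" where
  "into_U x j = (if j \<in> {1..R} then if x j \<in> U then x j else (SOME y. y \<in> U) else 0)"

lemma into_U_mem: "j \<in> {1..R} \<Longrightarrow> into_U x j \<in> U"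
  using U_nonempty by (auto simp: into_U_def intro: someI)

lemma into_U_eq: "j \<in> {1..R} \<Longrightarrow> x j \<in> U \<Longrightarrow> into_U x j = x j"
  by (simp add: into_U_def)

lemma into_U_measurable: "into_U \<in> Q \<rightarrow>\<^sub>M borel"
proof -
  have "into_U \<in> Q \<rightarrow>\<^sub>M (Pi\<^sub>M UNIV (\<lambda>_. borel))"
  proof (rule measurable_PiM_single')
    fix j
    show "(\<lambda>x. into_U x j) \<in> borel_measurable Q"
    proof (cases "j \<in> {1..R}")
      case True
      then have [measurable]: "(\<lambda>x. x j) \<in> Q \<rightarrow>\<^sub>M borel"
        using measurable_component_singleton[of j "{1..R}" "\<lambda>_. \<mu>"] by (simp cong: measurable_cong_sets)
      have "(\<lambda>x. if x j \<in> U then x j else (SOME y. y \<in> U)) \<in> borel_measurable Q"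
        by measurable
      then show ?thesis using True by (simp add: into_U_def)
    next
      case False
      then have "(\<lambda>x. into_U x j) = (\<lambda>_. 0)" by (auto simp: into_U_def)
      then show ?thesis by simp
    qed
  qed auto
  then show ?thesis
    using measurable_cong_sets[OF refl sets_PiM_equal_borel] by blast
qed

definition sample_error :: "(nat \<Rightarrow> 'n param) \<Rightarrow> real" where "sample_error x = best_error (into_U x)"

lemma sample_error_measurable [measurable]: "sample_error \<in> borel_measurable Q"
  unfolding sample_error_def[abs_def] by (rule measurable_compose[OF into_U_measurable best_error_measurable])

lemma sample_error_bounded: "\<bar>sample_error x\<bar> \<le> L2_norm B (shallow_net \<tau> N \<theta> \<gamma>)"
  using best_error_nonneg best_error_bounded by (simp add: sample_error_def)

lemma sample_error_diff:
  assumes j: "j \<in> {1..R}"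
  shows "\<bar>sample_error (x(j := y)) - sample_error x\<bar> \<le> mass * coeff_ratio / R * L * diameter U * E_const B"
proof -
  have eq: "i \<in> {1..R} - {j} \<Longrightarrow> into_U (x(j := y)) i = into_U x i" for i
    by (simp add: into_U_def)
  have near: "norm (into_U a j - into_U b j) \<le> diameter U" for a b
    by (intro norm_diff_le_diameter into_U_mem j)
  have "sample_error (x(j := y)) \<le> sample_error x + mass * coeff_ratio / R * L * diameter U * E_const B"
    unfolding sample_error_def by (intro best_error_diff[where j = j] eq j near)
  moreover have "sample_error x \<le> sample_error (x(j := y)) + mass * coeff_ratio / R * L * diameter U * E_const B"
    unfolding sample_error_def by (intro best_error_diff[where j = j] eq[symmetric] j near)
  ultimately show ?thesis by linarith
qed

end

section \<open>Importance weights\<close>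

context lipschitz_sampling
begin

text \<open>
  The two contributions to the expected error: the error of averaging over cubes, and the random
  fluctuation of the importance weighted network together with that of the sum of its weights.
\<close>

definition bias :: real where
  "bias = mass * (L * (sqrt (CARD('n) + 1) / lam)) * E_const B"

definition spread :: real where
  "spread = 2 * mass * sqrt kernel_ratio * (L * gamma_max U) * E_const B / sqrt R"

lemma bias_pos: "bias > 0" and spread_pos: "spread > 0"
  using mass_pos L lam kernel_ratio_ge_1 gamma_max_pos E_const_ge_1 R by (simp_all add: bias_def spread_def)

text \<open>
  From \<open>1 \<le> kernel_ratio\<close> follows \<open>2 * sqrt kernel_ratio \<le> 2 * kernel_ratio \<le> coeff_ratio\<close>.
\<close>

lemma spread_le: "spread \<le> mass * coeff_ratio * (L * gamma_max U) * E_const B / sqrt R"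
proof -
  have "sqrt kernel_ratio \<le> kernel_ratio" using kernel_ratio_ge_1 by (simp add: real_le_lsqrt power2_eq_square)
  then have "2 * sqrt kernel_ratio \<le> coeff_ratio" using twice_kernel_ratio_le by linarith
  then have "mass * (2 * sqrt kernel_ratio) * (L * gamma_max U) * E_const B / sqrt R
      \<le> mass * coeff_ratio * (L * gamma_max U) * E_const B / sqrt R"
    using mass_pos L gamma_max_pos E_const_ge_1
    by (intro divide_right_mono mult_right_mono mult_left_mono) auto
  then show ?thesis by (simp add: spread_def mult_ac)
qed

text \<open>
  The fluctuations of the importance weighted network with activation \<open>hidden_unit\<close> and of the sum of
  the weights. The second one is scaled by the bound for \<open>hidden_unit\<close>, as in the effect that a
  correction of the sum has on the network.
\<close>

definition unit_deviation :: "(nat \<Rightarrow> 'n param) \<Rightarrow> real^'n \<Rightarrow> real" where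
  "unit_deviation x y = (\<Sum>j=1..R. weight \<theta> (x j) * hidden_unit y (x j)) / R - (\<integral>z. weight \<theta> z * hidden_unit y z \<partial>\<mu>)"

definition mass_deviation :: "(nat \<Rightarrow> 'n param) \<Rightarrow> real^'n \<Rightarrow> real" where
  "mass_deviation x y = ((\<Sum>j=1..R. weight \<theta> (x j)) / R - signed_mass) * (L * gamma_max U * norm (lift1 y))"

lemma abs_weight_le_mass: "\<bar>weight \<theta> z\<bar> \<le> mass * kernel_ratio"
  using abs_weight_le[of \<theta> z] by (simp add: mass_def)

lemma abs_weight_unit_le: "\<bar>weight \<theta> z * hidden_unit y z\<bar> \<le> \<bar>weight \<theta> z\<bar> * (L * gamma_max U * norm (lift1 y))"
  by (cases "z \<in> U") (auto simp: abs_mult weight_outside intro!: mult_left_mono abs_hidden_unit_le_U)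

lemma abs_weight_unit_le_mass: "\<bar>weight \<theta> z * hidden_unit y z\<bar> \<le> mass * kernel_ratio * (L * gamma_max U * norm (lift1 y))"
  using L gamma_max_pos
  by (intro order_trans[OF abs_weight_unit_le] mult_right_mono abs_weight_le_mass) simp

lemma mean_square_unit_deviation:
  "(\<integral>x. (unit_deviation x y)\<^sup>2 \<partial>Q) \<le> mass\<^sup>2 * kernel_ratio * (L * gamma_max U * norm (lift1 y))\<^sup>2 / R"
proof -
  let ?c = "L * gamma_max U * norm (lift1 y)"
  have "(\<integral>x. (unit_deviation x y)\<^sup>2 \<partial>Q) \<le> (\<integral>z. (weight \<theta> z * hidden_unit y z)\<^sup>2 \<partial>\<mu>) / R"
    using mean_square_error_iid[OF prob_space_\<mu>, of "{1..R}" "\<lambda>z. weight \<theta> z * hidden_unit y z" "mass * kernel_ratio * ?c"]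
      abs_weight_unit_le_mass R
    by (simp add: unit_deviation_def)
  also have "\<dots> \<le> (\<integral>z. (weight \<theta> z)\<^sup>2 * ?c\<^sup>2 \<partial>\<mu>) / R"
  proof (intro divide_right_mono integral_mono')
    show "integrable \<mu> (\<lambda>z. (weight \<theta> z)\<^sup>2 * ?c\<^sup>2)" using weight_second_moment(1) by simp
    fix z
    have "\<bar>weight \<theta> z * hidden_unit y z\<bar>\<^sup>2 \<le> (\<bar>weight \<theta> z\<bar> * ?c)\<^sup>2"
      by (intro power_mono abs_weight_unit_le) simp
    then show "(weight \<theta> z * hidden_unit y z)\<^sup>2 \<le> (weight \<theta> z)\<^sup>2 * ?c\<^sup>2"
      by (simp add: power_mult_distrib)
  qed simp_all
  also have "\<dots> = (\<integral>z. (weight \<theta> z)\<^sup>2 \<partial>\<mu>) * ?c\<^sup>2 / R" by simp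
  also have "\<dots> \<le> mass\<^sup>2 * kernel_ratio * ?c\<^sup>2 / R"
    by (intro divide_right_mono mult_right_mono weight_second_moment(2)) auto
  finally show ?thesis .
qed

lemma mean_square_mass_deviation:
  "(\<integral>x. (mass_deviation x y)\<^sup>2 \<partial>Q) \<le> mass\<^sup>2 * kernel_ratio * (L * gamma_max U * norm (lift1 y))\<^sup>2 / R"
proof -
  let ?c = "L * gamma_max U * norm (lift1 y)"
  have "(\<integral>x. (mass_deviation x y)\<^sup>2 \<partial>Q) = (\<integral>x. ((\<Sum>j=1..R. weight \<theta> (x j)) / R - signed_mass)\<^sup>2 \<partial>Q) * ?c\<^sup>2"
    by (simp add: mass_deviation_def power_mult_distrib)
  also have "\<dots> \<le> (\<integral>z. (weight \<theta> z)\<^sup>2 \<partial>\<mu>) / R * ?c\<^sup>2"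
    using mean_square_error_iid[OF prob_space_\<mu>, of "{1..R}" "weight \<theta>" "mass * kernel_ratio"] abs_weight_le_mass R
    by (intro mult_right_mono) (simp_all add: weight_total signed_mass_def)
  also have "\<dots> \<le> mass\<^sup>2 * kernel_ratio / R * ?c\<^sup>2"
    by (intro divide_right_mono mult_right_mono weight_second_moment(2)) auto
  finally show ?thesis by simp
qed

lemma component_measurable [measurable]: "j \<in> {1..R} \<Longrightarrow> (\<lambda>x. x j) \<in> Q \<rightarrow>\<^sub>M borel"
  using measurable_component_singleton[of j "{1..R}" "\<lambda>_. \<mu>"] by (simp cong: measurable_cong_sets)

lemma unit_deviation_measurable: "(\<lambda>(x, y). unit_deviation x y) \<in> borel_measurable (Q \<Otimes>\<^sub>M unif_meas B)"
proof -
  have "(\<lambda>p. \<integral>z. weight \<theta> z * hidden_unit (snd p) z \<partial>\<mu>) \<in> borel_measurable (Q \<Otimes>\<^sub>M unif_meas B)"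
    unfolding hidden_unit_def by measurable
  moreover have "(\<lambda>p. \<Sum>j=1..R. weight \<theta> (fst p j) * hidden_unit (snd p) (fst p j)) \<in> borel_measurable (Q \<Otimes>\<^sub>M unif_meas B)"
    unfolding hidden_unit_def
  proof (rule borel_measurable_sum)
    fix j assume j [measurable]: "j \<in> {1..R}"
    show "(\<lambda>p. weight \<theta> (fst p j) * (\<tau> (fst p j \<bullet> lift1 (snd p)) - \<tau> 0)) \<in> borel_measurable (Q \<Otimes>\<^sub>M unif_meas B)"
      by measurable
  qed
  ultimately show ?thesis unfolding unit_deviation_def case_prod_beta' by measurable
qed

lemma mass_deviation_measurable: "(\<lambda>(x, y). mass_deviation x y) \<in> borel_measurable (Q \<Otimes>\<^sub>M unif_meas B)"
proof -
  have "(\<lambda>p. \<Sum>j=1..R. weight \<theta> (fst p j)) \<in> borel_measurable (Q \<Otimes>\<^sub>M unif_meas B)"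
  proof (rule borel_measurable_sum)
    fix j assume j [measurable]: "j \<in> {1..R}"
    show "(\<lambda>p. weight \<theta> (fst p j)) \<in> borel_measurable (Q \<Otimes>\<^sub>M unif_meas B)"
      by measurable
  qed
  then show ?thesis unfolding mass_deviation_def case_prod_beta' by measurable
qed

definition deviation :: "(nat \<Rightarrow> 'n param) \<Rightarrow> real^'n \<Rightarrow> real" where
  "deviation x y = 2 * (unit_deviation x y)\<^sup>2 + 2 * (mass_deviation x y)\<^sup>2"

lemma deviation_measurable: "(\<lambda>(x, y). deviation x y) \<in> borel_measurable (Q \<Otimes>\<^sub>M unif_meas B)"
  using unit_deviation_measurable mass_deviation_measurable unfolding deviation_def case_prod_beta' by measurable

lemma deviations_bounded: "\<exists>K. \<forall>x. \<forall>y\<in>B. \<bar>unit_deviation x y\<bar> \<le> K \<and> \<bar>mass_deviation x y\<bar> \<le> K"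
proof -
  obtain C where C: "C > 0" "\<And>y. y \<in> B \<Longrightarrow> norm (lift1 y) \<le> C" by (rule lift1_bounded) blast
  define K where "K = mass * kernel_ratio * (L * gamma_max U * C)"
  have Rp: "real R > 0" using R by simp
  have "\<bar>unit_deviation x y\<bar> \<le> 2 * K \<and> \<bar>mass_deviation x y\<bar> \<le> 2 * K" if y: "y \<in> B" for x y
  proof -
    let ?c = "L * gamma_max U * norm (lift1 y)"
    have c: "?c \<le> L * gamma_max U * C" "0 \<le> ?c"
      using C(2)[OF y] L gamma_max_pos by (auto intro: mult_left_mono)
    have TH: "0 \<le> mass * kernel_ratio" using mass_pos kernel_ratio_ge_1 by simp
    have one: "\<bar>weight \<theta> z * hidden_unit y z\<bar> \<le> K" for z
      using abs_weight_unit_le_mass[of z y] mult_left_mono[OF c(1) TH] by (simp add: K_def)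
    have "\<bar>\<Sum>j=1..R. weight \<theta> (x j) * hidden_unit y (x j)\<bar> \<le> (\<Sum>j=1..R. K)"
      by (intro sum_abs[THEN order_trans] sum_mono one)
    then have "\<bar>(\<Sum>j=1..R. weight \<theta> (x j) * hidden_unit y (x j)) / R\<bar> \<le> K"
      using Rp by (simp add: field_simps)
    moreover have "\<bar>\<integral>z. weight \<theta> z * hidden_unit y z \<partial>\<mu>\<bar> \<le> K"
    proof -
      have "\<bar>\<integral>z. weight \<theta> z * hidden_unit y z \<partial>\<mu>\<bar> \<le> (\<integral>z. \<bar>weight \<theta> z * hidden_unit y z\<bar> \<partial>\<mu>)"
        by (rule integral_abs_bound)
      also have "\<dots> \<le> (\<integral>z. K \<partial>\<mu>)"
        using one order_trans[OF abs_ge_zero one] by (intro integral_mono') auto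
      finally show ?thesis using \<mu>.prob_space by simp
    qed
    ultimately have 1: "\<bar>unit_deviation x y\<bar> \<le> 2 * K" unfolding unit_deviation_def by linarith
    have "\<bar>\<Sum>j=1..R. weight \<theta> (x j)\<bar> \<le> (\<Sum>j=1..R. mass * kernel_ratio)"
      by (intro sum_abs[THEN order_trans] sum_mono abs_weight_le_mass)
    then have "\<bar>(\<Sum>j=1..R. weight \<theta> (x j)) / R\<bar> \<le> mass * kernel_ratio"
      using Rp by (simp add: field_simps)
    moreover have "\<bar>signed_mass\<bar> \<le> mass * kernel_ratio" using abs_signed_mass_le kernel_ratio_ge_1 mass_pos mult_left_mono[of 1 kernel_ratio mass] by linarith
    ultimately have "\<bar>(\<Sum>j=1..R. weight \<theta> (x j)) / R - signed_mass\<bar> \<le> 2 * (mass * kernel_ratio)" by linarith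
    then have "\<bar>mass_deviation x y\<bar> \<le> 2 * (mass * kernel_ratio) * (L * gamma_max U * C)"
      unfolding mass_deviation_def abs_mult using c TH L gamma_max_pos by (intro mult_mono) (auto simp: abs_mult)
    then have 2: "\<bar>mass_deviation x y\<bar> \<le> 2 * K" by (simp add: K_def)
    show ?thesis using 1 2 by simp
  qed
  then show ?thesis by blast
qed

lemma deviation_integrable: "integrable (Q \<Otimes>\<^sub>M unif_meas B) (\<lambda>(x, y). deviation x y)"
proof -
  interpret pair_prob_space Q "unif_meas B" ..
  obtain K where K: "\<And>x y. y \<in> B \<Longrightarrow> \<bar>unit_deviation x y\<bar> \<le> K \<and> \<bar>mass_deviation x y\<bar> \<le> K"
    using deviations_bounded by blast
  have le: "deviation x y \<le> 4 * K\<^sup>2" if "y \<in> B" for x y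
    using K[OF that, of x] power_mono[of "\<bar>unit_deviation x y\<bar>" K 2] power_mono[of "\<bar>mass_deviation x y\<bar>" K 2]
    by (simp add: deviation_def)
  show ?thesis
  proof (intro integrable_const_bound[where B = "4 * K\<^sup>2"] AE_I2 deviation_measurable)
    fix p assume "p \<in> space (Q \<Otimes>\<^sub>M unif_meas B)"
    then have "snd p \<in> B" by (auto simp: space_pair_measure)
    moreover have "0 \<le> deviation (fst p) (snd p)" by (simp add: deviation_def)
    ultimately show "norm (case p of (x, y) \<Rightarrow> deviation x y) \<le> 4 * K\<^sup>2"
      using le[of "snd p" "fst p"] by (simp add: case_prod_beta')
  qed
qed

lemma expected_deviation: "integrable Q (\<lambda>x. \<integral>y. deviation x y \<partial>unif_meas B)"
  "(\<integral>x. (\<integral>y. deviation x y \<partial>unif_meas B) \<partial>Q) \<le> spread\<^sup>2"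
proof -
  interpret pair_prob_space Q "unif_meas B" ..
  show "integrable Q (\<lambda>x. \<integral>y. deviation x y \<partial>unif_meas B)"
    using integrable_fst[OF deviation_integrable] .
  let ?c = "4 * mass\<^sup>2 * kernel_ratio * (L * gamma_max U)\<^sup>2 / R"
  have "(\<integral>x. (\<integral>y. deviation x y \<partial>unif_meas B) \<partial>Q) = (\<integral>y. (\<integral>x. deviation x y \<partial>Q) \<partial>unif_meas B)"
    using Fubini_integral[OF deviation_integrable] by simp
  also have "\<dots> \<le> (\<integral>y. ?c * (norm (lift1 y))\<^sup>2 \<partial>unif_meas B)"
  proof (rule integral_mono')
    show "integrable (unif_meas B) (\<lambda>y. ?c * (norm (lift1 y))\<^sup>2)"
      using integrable_norm_lift1_square by simp
    show "0 \<le> ?c * (norm (lift1 y))\<^sup>2" for y :: "real^'n" using kernel_ratio_ge_1 by simp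
    fix y assume "y \<in> space (unif_meas B)"
    then have y: "y \<in> B" by simp
    obtain K where K: "\<And>x. \<bar>unit_deviation x y\<bar> \<le> K \<and> \<bar>mass_deviation x y\<bar> \<le> K"
      using deviations_bounded y by blast
    have [measurable]: "(\<lambda>x. unit_deviation x y) \<in> borel_measurable Q" "(\<lambda>x. mass_deviation x y) \<in> borel_measurable Q"
      using measurable_Pair1[OF unit_deviation_measurable, of y] measurable_Pair1[OF mass_deviation_measurable, of y] y
      by simp_all
    have "\<bar>unit_deviation x y\<bar>\<^sup>2 \<le> K\<^sup>2" "\<bar>mass_deviation x y\<bar>\<^sup>2 \<le> K\<^sup>2" for x
      using K[of x] power_mono[of "\<bar>unit_deviation x y\<bar>" K 2] power_mono[of "\<bar>mass_deviation x y\<bar>" K 2] by auto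
    then have sq: "norm ((unit_deviation x y)\<^sup>2) \<le> K\<^sup>2" "norm ((mass_deviation x y)\<^sup>2) \<le> K\<^sup>2" for x
      by simp_all
    have "integrable Q (\<lambda>x. (unit_deviation x y)\<^sup>2)"
      by (rule Q.integrable_const_bound[OF AE_I2[OF sq(1)]]) measurable
    moreover have "integrable Q (\<lambda>x. (mass_deviation x y)\<^sup>2)"
      by (rule Q.integrable_const_bound[OF AE_I2[OF sq(2)]]) measurable
    ultimately have "(\<integral>x. deviation x y \<partial>Q) = 2 * (\<integral>x. (unit_deviation x y)\<^sup>2 \<partial>Q) + 2 * (\<integral>x. (mass_deviation x y)\<^sup>2 \<partial>Q)"
      by (simp add: deviation_def)
    also have "\<dots> \<le> 4 * (mass\<^sup>2 * kernel_ratio * (L * gamma_max U * norm (lift1 y))\<^sup>2 / R)"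
      using mean_square_unit_deviation[of y] mean_square_mass_deviation[of y] by linarith
    also have "\<dots> = ?c * (norm (lift1 y))\<^sup>2" by (simp add: power_mult_distrib)
    finally show "(\<integral>x. deviation x y \<partial>Q) \<le> ?c * (norm (lift1 y))\<^sup>2" .
  qed
  also have "\<dots> = ?c * (E_const B)\<^sup>2" by (simp add: E_const_square)
  also have "\<dots> = spread\<^sup>2"
    using kernel_ratio_ge_1 by (simp add: spread_def power_mult_distrib power_divide)
  finally show "(\<integral>x. (\<integral>y. deviation x y \<partial>unif_meas B) \<partial>Q) \<le> spread\<^sup>2" .
qed

end

section \<open>The random approximation for a Lipschitz activation\<close>

context lipschitz_sampling
begin

lemma bias_pointwise:
  "\<bar>(\<integral>z. weight \<theta> z * hidden_unit y z \<partial>\<mu>) - (\<Sum>i=1..N. \<theta> i * hidden_unit y (\<gamma> i))\<bar>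
     \<le> mass * (L * (sqrt (CARD('n) + 1) / lam)) * norm (lift1 y)"
proof -
  have "\<bar>hidden_unit y z - hidden_unit y (\<gamma> i)\<bar> \<le> L * (sqrt (CARD('n) + 1) * (1 / lam)) * norm (lift1 y)"
    if "z - \<gamma> i \<in> cube (1 / lam)" for i z
  proof -
    have "\<bar>hidden_unit y z - hidden_unit y (\<gamma> i)\<bar> \<le> L * norm (z - \<gamma> i) * norm (lift1 y)"
      using lipschitz_in_param[of z y "\<gamma> i"] by (simp add: hidden_unit_def)
    also have "\<dots> \<le> L * (sqrt (CARD('n) + 1) * (1 / lam)) * norm (lift1 y)"
      using norm_cube_le[OF that] L by (intro mult_right_mono mult_left_mono) auto
    finally show ?thesis .
  qed
  from weight_integral(2)[OF hidden_unit_measurable this, of \<theta>] show ?thesis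
    by (simp add: mass_def mult.assoc)
qed

text \<open>
  The best error is compared with the error of the importance weights after their sum has been
  corrected. Then the constant \<open>\<tau> 0\<close> cancels, and pointwise the error is at most the bias plus the two
  deviations.
\<close>

lemma sample_error_square_le:
  assumes x: "\<And>j. j \<in> {1..R} \<Longrightarrow> x j \<in> U"
  shows "(sample_error x)\<^sup>2 \<le> (1 + spread / bias) * bias\<^sup>2 + (1 + bias / spread) * (\<integral>y. deviation x y \<partial>unif_meas B)"
proof -
  have Rp: "real R > 0" using R by simp
  have "\<bar>signed_mass\<bar> \<le> mass * kernel_ratio" using abs_signed_mass_le kernel_ratio_ge_1 mass_pos mult_left_mono[of 1 kernel_ratio mass] by linarith
  from reweight_to_mean[OF finite_atLeastAtMost abs_weight_le_mass this]
  obtain w where w: "\<forall>j\<in>{1..R}. \<bar>w j\<bar> \<le> mass * kernel_ratio" and w_sum: "(\<Sum>j\<in>{1..R}. w j) = card {1..R} * signed_mass"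
    and w_near: "(\<Sum>j\<in>{1..R}. \<bar>w j - weight \<theta> (x j)\<bar>) = \<bar>(\<Sum>j\<in>{1..R}. weight \<theta> (x j)) - card {1..R} * signed_mass\<bar>"
    by blast
  define c where "c j = w j / R" for j
  have "c \<in> coeffs"
    unfolding coeffs_def c_def
  proof (rule CollectI, rule ballI)
    fix j assume j: "j \<in> {1..R}"
    have "mass * kernel_ratio \<le> mass * coeff_ratio" using mass_pos twice_kernel_ratio_le kernel_ratio_ge_1 by (intro mult_left_mono) auto
    then have "\<bar>w j\<bar> / R \<le> mass * coeff_ratio / R" using bspec[OF w j] by (intro divide_right_mono) auto
    then show "\<bar>w j / real R\<bar> \<le> mass * coeff_ratio / real R" by simp
  qed
  then have "sample_error x \<le> L2_norm B (err c (into_U x))" unfolding sample_error_def by (rule best_error_le)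
  also have "err c (into_U x) = err c x"
    using x by (intro ext) (simp add: err_def shallow_net_def into_U_eq)
  finally have Fle: "sample_error x \<le> L2_norm B (err c x)" .
  let ?c = "L * gamma_max U"
  let ?b = "mass * (L * (sqrt (CARD('n) + 1) / lam))"
  have pointwise: "\<bar>err c x y\<bar> \<le> ?b * norm (lift1 y) + (\<bar>unit_deviation x y\<bar> + \<bar>mass_deviation x y\<bar>)" for y
  proof -
    let ?S = "\<Sum>j=1..R. weight \<theta> (x j) * hidden_unit y (x j)"
    let ?I = "\<integral>z. weight \<theta> z * hidden_unit y z \<partial>\<mu>"
    let ?V = "\<Sum>i=1..N. \<theta> i * hidden_unit y (\<gamma> i)"
    let ?W = "\<Sum>j=1..R. w j * hidden_unit y (x j)"
    have "shallow_net \<tau> N \<theta> \<gamma> y = ?V + signed_mass * \<tau> 0"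
      by (simp add: shallow_net_def hidden_unit_def signed_mass_def right_diff_distrib sum_subtractf sum_distrib_right)
    moreover have "shallow_net \<tau> R c x y = ?W / R + signed_mass * \<tau> 0"
    proof -
      have "shallow_net \<tau> R c x y = (?W + (\<Sum>j=1..R. w j) * \<tau> 0) / R"
        by (simp add: shallow_net_def hidden_unit_def c_def right_diff_distrib sum_subtractf sum_distrib_right
            sum_divide_distrib diff_divide_distrib add_divide_distrib)
      then show ?thesis using w_sum Rp by (simp add: add_divide_distrib)
    qed
    ultimately have "err c x y = (?V - ?I) - unit_deviation x y + (?S - ?W) / R"
      by (simp add: err_def unit_deviation_def diff_divide_distrib)
    moreover have "\<bar>?V - ?I\<bar> \<le> ?b * norm (lift1 y)"
      using bias_pointwise[of y] by (simp add: abs_minus_commute)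
    moreover have "\<bar>(?S - ?W) / R\<bar> \<le> \<bar>mass_deviation x y\<bar>"
    proof -
      have "?W - ?S = (\<Sum>j=1..R. (w j - weight \<theta> (x j)) * hidden_unit y (x j))"
        by (simp add: left_diff_distrib sum_subtractf)
      also have "\<bar>\<dots>\<bar> \<le> (\<Sum>j=1..R. \<bar>w j - weight \<theta> (x j)\<bar> * (?c * norm (lift1 y)))"
        using x by (intro sum_abs[THEN order_trans] sum_mono)
          (auto simp: abs_mult intro!: mult_left_mono abs_hidden_unit_le_U)
      also have "\<dots> = \<bar>(\<Sum>j=1..R. weight \<theta> (x j)) - R * signed_mass\<bar> * (?c * norm (lift1 y))"
        using w_near by (simp flip: sum_distrib_right)
      finally have "\<bar>?W - ?S\<bar> / R \<le> \<bar>(\<Sum>j=1..R. weight \<theta> (x j)) - R * signed_mass\<bar> * (?c * norm (lift1 y)) / R"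
        by (intro divide_right_mono) auto
      also have "\<dots> = \<bar>((\<Sum>j=1..R. weight \<theta> (x j)) - R * signed_mass) / R\<bar> * (?c * norm (lift1 y))"
        by simp
      also have "((\<Sum>j=1..R. weight \<theta> (x j)) - R * signed_mass) / R = (\<Sum>j=1..R. weight \<theta> (x j)) / R - signed_mass"
        using Rp by (simp add: diff_divide_distrib)
      also have "\<bar>(\<Sum>j=1..R. weight \<theta> (x j)) / R - signed_mass\<bar> * (?c * norm (lift1 y)) = \<bar>mass_deviation x y\<bar>"
        using L gamma_max_pos by (simp add: mass_deviation_def abs_mult)
      finally show ?thesis by (simp add: abs_minus_commute)
    qed
    ultimately show ?thesis by linarith
  qed
  have square: "(err c x y)\<^sup>2 \<le> (1 + spread / bias) * (?b\<^sup>2 * (norm (lift1 y))\<^sup>2) + (1 + bias / spread) * deviation x y" for y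
  proof -
    have "(err c x y)\<^sup>2 \<le> (?b * norm (lift1 y) + (\<bar>unit_deviation x y\<bar> + \<bar>mass_deviation x y\<bar>))\<^sup>2"
      using power_mono[OF pointwise[of y], of 2] by simp
    also have "\<dots> \<le> (1 + spread / bias) * (?b * norm (lift1 y))\<^sup>2
                 + (1 + bias / spread) * (\<bar>unit_deviation x y\<bar> + \<bar>mass_deviation x y\<bar>)\<^sup>2"
      by (rule square_add_le_weighted[OF bias_pos spread_pos])
    also have "\<dots> \<le> (1 + spread / bias) * (?b * norm (lift1 y))\<^sup>2 + (1 + bias / spread) * deviation x y"
      using square_add_le_weighted[of 1 1 "\<bar>unit_deviation x y\<bar>" "\<bar>mass_deviation x y\<bar>"] bias_pos spread_pos
      by (intro add_left_mono mult_left_mono) (auto simp: deviation_def)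
    finally show ?thesis by (simp only: power_mult_distrib[of ?b])
  qed
  have deviation_int: "integrable (unif_meas B) (deviation x)"
  proof -
    obtain K where K: "\<And>y. y \<in> B \<Longrightarrow> \<bar>unit_deviation x y\<bar> \<le> K \<and> \<bar>mass_deviation x y\<bar> \<le> K"
      using deviations_bounded by blast
    have "deviation (restrict x {1..R}) \<in> borel_measurable (unif_meas B)"
      using measurable_Pair2[OF deviation_measurable, of "restrict x {1..R}"] by (simp add: space_PiM)
    moreover have "deviation (restrict x {1..R}) = deviation x" by (simp add: deviation_def unit_deviation_def mass_deviation_def fun_eq_iff)
    ultimately have m: "deviation x \<in> borel_measurable (unif_meas B)" by simp
    show ?thesis
    proof (intro unif.integrable_const_bound[where B = "4 * K\<^sup>2"] AE_I2 m)
      fix y assume "y \<in> space (unif_meas B)"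
      then show "norm (deviation x y) \<le> 4 * K\<^sup>2"
        using K[of y] power_mono[of "\<bar>unit_deviation x y\<bar>" K 2] power_mono[of "\<bar>mass_deviation x y\<bar>" K 2]
        by (simp add: deviation_def)
    qed
  qed
  have "(sample_error x)\<^sup>2 \<le> (L2_norm B (err c x))\<^sup>2"
    using Fle best_error_nonneg by (intro power_mono) (simp_all add: sample_error_def)
  also have "\<dots> = (\<integral>y. (err c x y)\<^sup>2 \<partial>unif_meas B)" by (simp add: L2_norm_def)
  also have "\<dots> \<le> (\<integral>y. (1 + spread / bias) * (?b\<^sup>2 * (norm (lift1 y))\<^sup>2) + (1 + bias / spread) * deviation x y \<partial>unif_meas B)"
    using L2_norm_le_err[of c x] square deviation_int integrable_norm_lift1_square
    by (intro integral_mono) (auto simp: L2_norm_le_square)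
  also have "\<dots> = (1 + spread / bias) * (?b\<^sup>2 * (E_const B)\<^sup>2) + (1 + bias / spread) * (\<integral>y. deviation x y \<partial>unif_meas B)"
    using deviation_int integrable_norm_lift1_square by (simp add: E_const_square)
  also have "?b\<^sup>2 * (E_const B)\<^sup>2 = bias\<^sup>2" unfolding bias_def by (rule power_mult_distrib[symmetric])
  finally show ?thesis .
qed

text \<open>
  A bound for the second moment yields one for the mean through \<open>2 * s * z \<le> z\<^sup>2 + s\<^sup>2\<close>, here with
  \<open>s = bias + spread\<close>.
\<close>

lemma expected_sample_error: "(\<integral>x. sample_error x \<partial>Q) \<le> bias + spread"
proof -
  let ?s = "bias + spread"
  have s: "?s > 0" using bias_pos spread_pos by simp
  let ?h = "\<lambda>x. (1 + spread / bias) * bias\<^sup>2 + (1 + bias / spread) * (\<integral>y. deviation x y \<partial>unif_meas B) + ?s\<^sup>2"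
  have hint: "integrable Q ?h"
    by (intro Bochner_Integration.integrable_add integrable_mult_right expected_deviation(1) Q.integrable_const)
  have le: "2 * ?s * sample_error x \<le> ?h x" if "\<forall>j\<in>{1..R}. x j \<in> U" for x
  proof -
    have "0 \<le> (sample_error x - ?s)\<^sup>2" by simp
    also have "\<dots> = (sample_error x)\<^sup>2 + ?s\<^sup>2 - 2 * ?s * sample_error x" by (simp add: power2_eq_square algebra_simps)
    finally show ?thesis using sample_error_square_le[of x] that by auto
  qed
  have "(\<integral>x. 2 * ?s * sample_error x \<partial>Q) \<le> (\<integral>x. ?h x \<partial>Q)"
  proof (rule integral_mono_AE)
    have "AE x in Q. norm (sample_error x) \<le> L2_norm B (shallow_net \<tau> N \<theta> \<gamma>)"
      by (intro AE_I2) (simp only: real_norm_def sample_error_bounded)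
    then show "integrable Q (\<lambda>x. 2 * ?s * sample_error x)"
      by (intro integrable_mult_right Q.integrable_const_bound[OF _ sample_error_measurable])
    show "AE x in Q. 2 * ?s * sample_error x \<le> ?h x" using AE_Q_U by eventually_elim (rule le)
  qed (rule hint)
  also have "(\<integral>x. ?h x \<partial>Q) = (1 + spread / bias) * bias\<^sup>2
      + (1 + bias / spread) * (\<integral>x. (\<integral>y. deviation x y \<partial>unif_meas B) \<partial>Q) + ?s\<^sup>2"
    using expected_deviation(1) Q.prob_space by (simp del: One_nat_def)
  also have "\<dots> \<le> (1 + spread / bias) * bias\<^sup>2 + (1 + bias / spread) * spread\<^sup>2 + ?s\<^sup>2"
    using expected_deviation(2) bias_pos spread_pos by (intro add_mono mult_left_mono) auto
  also have "\<dots> = 2 * ?s * ?s"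
    using weighted_squares_eq[OF bias_pos spread_pos] by (simp add: power2_eq_square)
  finally show ?thesis using s by simp
qed

text \<open>
  McDiarmid's inequality for the best error. Where the infimum over the coefficients exceeds its
  mean by less than \<open>t\<close>, it lies strictly below the stated bound, so some admissible coefficients obey it.
\<close>

theorem random_lipschitz_approximation:
  assumes \<nu>: "0 < \<nu>" "\<nu> < 1"
  defines "K \<equiv> gamma_max U * E_const B
             + (diameter U + 2 * gamma_max U) * E_const B * sqrt (1/2 * ln (1/\<nu>))"
  shows "\<exists>S\<in>sets Q. measure Q S > 1 - \<nu> \<and> (\<forall>x\<in>S. (\<forall>j\<in>{1..R}. x j \<in> U) \<and>
     (\<exists>c\<in>coeffs. L2_norm B (err c x) \<le> bias + mass * coeff_ratio * L * K / sqrt R))"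
proof -
  define s where "s = sqrt (1/2 * ln (1/\<nu>))"
  have ln: "ln (1 / \<nu>) > 0" using \<nu> by simp
  have s: "s > 0" "2 * s\<^sup>2 = ln (1 / \<nu>)" using ln by (simp_all add: s_def)
  have Rp: "real R > 0" using R by simp
  let ?D = "diameter U + gamma_max U" and ?D' = "diameter U + 2 * gamma_max U"
  let ?M = "mass * coeff_ratio * L * E_const B"
  have M: "?M > 0" using mass_pos coeff_ratio_pos L E_const_ge_1 by simp
  have diam: "0 \<le> diameter U" by (rule diameter_ge_0[OF bounded_U])
  have D: "0 < ?D" "?D < ?D'" using gamma_max_pos diam by auto
  \<comment> \<open>the differences are bounded by \<open>c\<close>, and the gap between \<open>?D\<close> and \<open>?D'\<close> makes the failure probability strictly smaller than \<open>\<nu>\<close>\<close>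
  define c where "c = ?M * ?D / R"
  define t where "t = ?M * ?D' * s / sqrt R"
  have c: "c > 0" using M D Rp by (simp add: c_def)
  have t: "t > 0" using M D s Rp by (simp add: t_def)
  have "measure Q {x \<in> space Q. sample_error x \<ge> (\<integral>z. sample_error z \<partial>Q) + t} \<le> exp (- 2 * t\<^sup>2 / (card {1..R} * c\<^sup>2))"
  proof (rule mcdiarmid[OF prob_space_\<mu> _ _ c t sample_error_measurable])
    show "\<bar>sample_error x\<bar> \<le> L2_norm B (shallow_net \<tau> N \<theta> \<gamma>)" for x by (rule sample_error_bounded)
    fix x :: "nat \<Rightarrow> 'n param" and j :: nat and y :: "'n param" assume j: "j \<in> {1..R}"
    have "mass * coeff_ratio / R * L * diameter U * E_const B = ?M * diameter U / R" by simp
    also have "\<dots> \<le> c" unfolding c_def using M gamma_max_pos by (intro divide_right_mono mult_left_mono) auto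
    finally show "\<bar>sample_error (x(j := y)) - sample_error x\<bar> \<le> c" using sample_error_diff[OF j, of x y] by linarith
  qed (use R in auto)
  also have "- 2 * t\<^sup>2 / (card {1..R} * c\<^sup>2) = - (2 * s\<^sup>2) * (?D' / ?D)\<^sup>2"
  proof -
    have t2: "t\<^sup>2 = ?M\<^sup>2 * ?D'\<^sup>2 * s\<^sup>2 / R" by (simp add: t_def power_mult_distrib power_divide)
    have c2: "card {1..R} * c\<^sup>2 = ?M\<^sup>2 * ?D\<^sup>2 / R"
      using Rp by (simp add: c_def power_mult_distrib power_divide power2_eq_square)
    have cancel: "- 2 * (m * p * q / r) / (m * z / r) = - (2 * q) * (p / z)"
      if "m \<noteq> 0" "r \<noteq> 0" for m p q r z :: real
      using that by simp
    show ?thesis unfolding t2 c2 power_divide by (rule cancel) (use M Rp in auto)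
  qed
  also have "exp \<dots> < exp (- (2 * s\<^sup>2))"
  proof -
    have "1 < (?D' / ?D)\<^sup>2" using D by (intro one_less_power) auto
    then have "2 * s\<^sup>2 * 1 < 2 * s\<^sup>2 * (?D' / ?D)\<^sup>2" using s(1) by (intro mult_strict_left_mono) simp_all
    then show ?thesis by simp
  qed
  also have "\<dots> = \<nu>" unfolding s(2) using \<nu> by (simp add: ln_div)
  finally have fail: "measure Q {x \<in> space Q. sample_error x \<ge> (\<integral>z. sample_error z \<partial>Q) + t} < \<nu>" .
  let ?S = "{x \<in> space Q. sample_error x < (\<integral>z. sample_error z \<partial>Q) + t \<and> (\<forall>j\<in>{1..R}. x j \<in> U)}"
  have S: "?S \<in> sets Q" by measurable
  have "1 - measure Q {x \<in> space Q. sample_error x \<ge> (\<integral>z. sample_error z \<partial>Q) + t}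
      = measure Q {x \<in> space Q. \<not> sample_error x \<ge> (\<integral>z. sample_error z \<partial>Q) + t}"
    by (subst Q.prob_neg) measurable
  also have "\<dots> = measure Q ?S"
  proof (rule Q.finite_measure_eq_AE)
    show "AE x in Q. (x \<in> {x \<in> space Q. \<not> sample_error x \<ge> (\<integral>z. sample_error z \<partial>Q) + t}) = (x \<in> ?S)"
      using AE_Q_U by eventually_elim auto
    show "{x \<in> space Q. \<not> sample_error x \<ge> (\<integral>z. sample_error z \<partial>Q) + t} \<in> sets Q" by measurable
  qed (rule S)
  finally have prob: "measure Q ?S > 1 - \<nu>" using fail by linarith
  have bound: "(\<integral>z. sample_error z \<partial>Q) + t \<le> bias + mass * coeff_ratio * L * K / sqrt R"
  proof -
    have "mass * coeff_ratio * L * K / sqrt R = mass * coeff_ratio * (L * gamma_max U) * E_const B / sqrt R + t"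
      unfolding K_def s_def[symmetric] t_def by (simp add: algebra_simps add_divide_distrib)
    then show ?thesis using expected_sample_error spread_le by linarith
  qed
  have "(\<forall>j\<in>{1..R}. x j \<in> U) \<and> (\<exists>c\<in>coeffs. L2_norm B (err c x) \<le> bias + mass * coeff_ratio * L * K / sqrt R)"
    if x: "x \<in> ?S" for x
  proof -
    have xU: "\<forall>j\<in>{1..R}. x j \<in> U" and "best_error (into_U x) < (\<integral>z. sample_error z \<partial>Q) + t"
      using x by (auto simp: sample_error_def)
    then obtain c where "c \<in> coeffs" "L2_norm B (err c (into_U x)) < (\<integral>z. sample_error z \<partial>Q) + t"
      by (auto simp: best_error_less_iff)
    moreover have "err c (into_U x) = err c x"
      using xU by (intro ext) (simp add: err_def shallow_net_def into_U_eq)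
    ultimately show ?thesis using xU bound by (intro conjI bexI[of _ c]) auto
  qed
  then show ?thesis using S prob by (intro bexI[of _ ?S]) auto
qed

end

section \<open>The approximation bounds\<close>

lemma (in unif_domain) oscillation_mollification_error:
  assumes lam: "lam > 0" and cont: "AE u in lebesgue. isCont \<sigma> u" and \<Upsilon>: "bounded \<Upsilon>"
    and \<gamma>: "\<And>i. i \<in> {1..N} \<Longrightarrow> \<gamma> i \<in> \<Upsilon>"
    and osc: "oscillation_cond \<sigma> (preactivations (expanded lam \<Upsilon>) B) D"
  shows "L2_norm_le B (\<lambda>x. shallow_net \<sigma> N \<theta> \<gamma> x - mollified_net lam \<Upsilon> \<sigma> N \<theta> \<gamma> x)
           ((\<Sum>i=1..N. \<bar>\<theta> i\<bar>) * D)"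
proof (rule L2_norm_le_mono[OF L2_norm_le_const])
  show "0 \<le> (\<Sum>i=1..N. \<bar>\<theta> i\<bar>) * D"
    using osc by (intro mult_nonneg_nonneg sum_nonneg) (auto simp: oscillation_cond_def)
  have close: "\<bar>\<sigma> (\<phi> \<bullet> lift1 x) - \<sigma> (\<gamma> i \<bullet> lift1 x)\<bar> \<le> D"
    if "x \<in> B" "i \<in> {1..N}" "\<phi> - \<gamma> i \<in> cube (1 / lam)" for x i \<phi>
  proof -
    have "\<gamma> i \<in> expanded lam \<Upsilon>"
      using lam by (intro expanded_memI[OF \<gamma>[OF that(2)]]) (simp add: cube_def)
    moreover have "\<phi> \<in> expanded lam \<Upsilon>" by (rule expanded_memI[OF \<gamma>[OF that(2)] that(3)])
    ultimately show ?thesis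
      using osc that(1) unfolding oscillation_cond_def preactivations_def by blast
  qed
  show "(\<lambda>x. shallow_net \<sigma> N \<theta> \<gamma> x - mollified_net lam \<Upsilon> \<sigma> N \<theta> \<gamma> x) \<in> borel_measurable (unif_meas B)"
    by (rule mollification_error(1)[OF lam cont \<Upsilon> \<gamma> close])
  show "\<bar>shallow_net \<sigma> N \<theta> \<gamma> x - mollified_net lam \<Upsilon> \<sigma> N \<theta> \<gamma> x\<bar> \<le> (\<Sum>i=1..N. \<bar>\<theta> i\<bar>) * D"
    if "x \<in> B" for x
    by (rule mollification_error(2)[OF lam cont \<Upsilon> \<gamma> close that])
qed

lemma (in unif_domain) lipschitz_mollification_error:
  fixes \<gamma> :: "nat \<Rightarrow> 'n param"
  assumes lam: "lam > 0" and cont: "AE u in lebesgue. isCont \<sigma> u" and \<Upsilon>: "bounded \<Upsilon>"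
    and \<gamma>: "\<And>i. i \<in> {1..N} \<Longrightarrow> \<gamma> i \<in> \<Upsilon>"
    and lip: "lipschitz_cond \<sigma> (preactivations (expanded lam \<Upsilon>) B) L"
  shows "L2_norm_le B (\<lambda>x. shallow_net \<sigma> N \<theta> \<gamma> x - mollified_net lam \<Upsilon> \<sigma> N \<theta> \<gamma> x)
           ((\<Sum>i=1..N. \<bar>\<theta> i\<bar>) * (L * sqrt (CARD('n) + 1) / lam) * E_const B)"
proof (rule L2_norm_le_lift1)
  have L: "L > 0" using lip by (simp add: lipschitz_cond_def)
  let ?K = "L * sqrt (CARD('n) + 1) / lam"
  show "0 \<le> (\<Sum>i=1..N. \<bar>\<theta> i\<bar>) * ?K"
    using L lam by (intro mult_nonneg_nonneg sum_nonneg) auto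
  have close: "\<bar>\<sigma> (\<phi> \<bullet> lift1 x) - \<sigma> (\<gamma> i \<bullet> lift1 x)\<bar> \<le> ?K * norm (lift1 x)"
    if "x \<in> B" "i \<in> {1..N}" "\<phi> - \<gamma> i \<in> cube (1 / lam)" for x i \<phi>
  proof -
    have "\<gamma> i \<in> expanded lam \<Upsilon>"
      using lam by (intro expanded_memI[OF \<gamma>[OF that(2)]]) (simp add: cube_def)
    moreover have "\<phi> \<in> expanded lam \<Upsilon>" by (rule expanded_memI[OF \<gamma>[OF that(2)] that(3)])
    ultimately have "\<bar>\<sigma> (\<phi> \<bullet> lift1 x) - \<sigma> (\<gamma> i \<bullet> lift1 x)\<bar> \<le> L * \<bar>\<phi> \<bullet> lift1 x - \<gamma> i \<bullet> lift1 x\<bar>"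
      using lip that(1) unfolding lipschitz_cond_def preactivations_def by blast
    also have "\<dots> = L * \<bar>(\<phi> - \<gamma> i) \<bullet> lift1 x\<bar>" by (simp add: inner_diff_left)
    also have "\<dots> \<le> L * (norm (\<phi> - \<gamma> i) * norm (lift1 x))"
      using L by (intro mult_left_mono Cauchy_Schwarz_ineq2) auto
    also have "\<dots> \<le> L * ((sqrt (CARD('n) + 1) * (1 / lam)) * norm (lift1 x))"
      using L by (intro mult_left_mono mult_right_mono norm_cube_le that(3)) auto
    finally show ?thesis by simp
  qed
  show "(\<lambda>x. shallow_net \<sigma> N \<theta> \<gamma> x - mollified_net lam \<Upsilon> \<sigma> N \<theta> \<gamma> x) \<in> borel_measurable (unif_meas B)"
    by (rule mollification_error(1)[OF lam cont \<Upsilon> \<gamma> close])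
  show "\<bar>shallow_net \<sigma> N \<theta> \<gamma> x - mollified_net lam \<Upsilon> \<sigma> N \<theta> \<gamma> x\<bar> \<le> (\<Sum>i=1..N. \<bar>\<theta> i\<bar>) * ?K * norm (lift1 x)"
    if "x \<in> B" for x
    unfolding mult.assoc[of _ ?K] by (rule mollification_error(2)[OF lam cont \<Upsilon> \<gamma> close that])
qed

context sampling
begin

lemma coeffs_iff: "c \<in> coeffs \<longleftrightarrow> (\<forall>j\<in>{1..R}. \<bar>c j\<bar> \<le> g_max TYPE('n) lam N \<theta> / (P_min U P * R))"
proof -
  have "g_max TYPE('n) lam N \<theta> / (P_min U P * R) = mass * coeff_ratio / R"
    by (simp only: g_max_eq[symmetric] divide_divide_eq_left)
  then show ?thesis by (simp add: coeffs_def)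
qed

text \<open>
  The constant \<open>K_lip\<close> contains the coefficient bound up to the power of \<open>lam\<close>.
\<close>

lemma coeff_ratio_K_lip_eq:
  "coeff_ratio * (gamma_max U * E_const B + \<bar>\<sigma> 0\<bar> / L
        + ((diameter U + 2 * gamma_max U) * E_const B + 2 * (\<bar>\<sigma> 0\<bar> / L)) * sqrt (1/2 * ln (1/\<nu>)))
   = lam ^ (CARD('n) + 1) * K_lip U B P \<sigma> L \<nu>"
proof -
  have "coeff_ratio = lam ^ (CARD('n) + 1) * (bump_eta ^ (CARD('n) + 1) / (exp 1 ^ (CARD('n) + 1) * P_min U P))"
    by (simp only: coeff_ratio_def power_mult_distrib power_divide divide_divide_eq_left times_divide_eq_right mult.commute)
  then show ?thesis by (simp only: K_lip_def mult.assoc)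
qed

text \<open>
  The Lipschitz extension of \<open>\<sigma>\<close> agrees with \<open>\<sigma>\<close> at all preactivations, so it may replace \<open>\<sigma>\<close> in both
  networks as long as the samples lie in \<open>U\<close>.
\<close>

lemma lipschitz_approximation:
  assumes lip: "lipschitz_cond \<sigma> (preactivations U B) L" and \<nu>: "0 < \<nu>" "\<nu> < 1"
  shows "\<exists>S\<in>sets Q. measure Q S > 1 - \<nu> \<and> (\<forall>x\<in>S. \<exists>c\<in>coeffs.
     L2_norm_le B (\<lambda>y. shallow_net \<sigma> N \<theta> \<gamma> y - shallow_net \<sigma> R c x y)
       (mass * L * (sqrt (CARD('n) + 1) / lam * E_const B + lam ^ (CARD('n) + 1) / sqrt R * K_lip U B P \<sigma> L \<nu>)))"
proof -
  have L: "L > 0" using lip by (simp add: lipschitz_cond_def)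
  have "B \<noteq> {}" using unif.not_empty by simp
  then have "preactivations U B \<noteq> {}" using U_nonempty by (auto simp: preactivations_def)
  from lipschitz_extension_real[OF lip this]
  obtain \<tau> where \<tau>: "\<And>u v. \<bar>\<tau> u - \<tau> v\<bar> \<le> L * \<bar>u - v\<bar>" and ext: "\<And>u. u \<in> preactivations U B \<Longrightarrow> \<tau> u = \<sigma> u"
    by metis
  interpret lipschitz_sampling B lam \<Upsilon> N R \<theta> \<gamma> P \<tau> L
    by unfold_locales (rule L, rule \<tau>)
  define K where "K = gamma_max U * E_const B
             + (diameter U + 2 * gamma_max U) * E_const B * sqrt (1/2 * ln (1/\<nu>))"
  have ln: "0 \<le> sqrt (1/2 * ln (1/\<nu>))" using \<nu> by simp
  have "K \<le> gamma_max U * E_const B + \<bar>\<sigma> 0\<bar> / L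
        + ((diameter U + 2 * gamma_max U) * E_const B + 2 * (\<bar>\<sigma> 0\<bar> / L)) * sqrt (1/2 * ln (1/\<nu>))"
    unfolding K_def using L ln by (intro add_mono mult_right_mono) auto
  then have "coeff_ratio * K \<le> lam ^ (CARD('n) + 1) * K_lip U B P \<sigma> L \<nu>"
    unfolding coeff_ratio_K_lip_eq[symmetric] using coeff_ratio_pos by (intro mult_left_mono) auto
  then have "mass * L * (coeff_ratio * K) / sqrt R \<le> mass * L * (lam ^ (CARD('n) + 1) * K_lip U B P \<sigma> L \<nu>) / sqrt R"
    using mass_pos L by (intro divide_right_mono mult_left_mono) auto
  then have le: "bias + mass * coeff_ratio * L * K / sqrt R
      \<le> mass * L * (sqrt (CARD('n) + 1) / lam * E_const B + lam ^ (CARD('n) + 1) / sqrt R * K_lip U B P \<sigma> L \<nu>)"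
    by (simp add: bias_def distrib_left mult_ac)
  obtain S where S: "S \<in> sets Q" "measure Q S > 1 - \<nu>"
    and good: "\<And>x. x \<in> S \<Longrightarrow> (\<forall>j\<in>{1..R}. x j \<in> U) \<and>
      (\<exists>c\<in>coeffs. L2_norm B (err c x) \<le> bias + mass * coeff_ratio * L * K / sqrt R)"
    using random_lipschitz_approximation[OF \<nu>] unfolding K_def by blast
  have "\<exists>c\<in>coeffs. L2_norm_le B (\<lambda>y. shallow_net \<sigma> N \<theta> \<gamma> y - shallow_net \<sigma> R c x y)
       (mass * L * (sqrt (CARD('n) + 1) / lam * E_const B + lam ^ (CARD('n) + 1) / sqrt R * K_lip U B P \<sigma> L \<nu>))"
    if x: "x \<in> S" for x
  proof -
    obtain c where c: "c \<in> coeffs" "L2_norm B (err c x) \<le> bias + mass * coeff_ratio * L * K / sqrt R"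
      using good[OF x] by blast
    have "L2_norm_le B (err c x)
       (mass * L * (sqrt (CARD('n) + 1) / lam * E_const B + lam ^ (CARD('n) + 1) / sqrt R * K_lip U B P \<sigma> L \<nu>))"
      by (rule L2_norm_le_weaken[OF L2_norm_le_err order_trans[OF c(2) le]])
    then have "L2_norm_le B (\<lambda>y. shallow_net \<sigma> N \<theta> \<gamma> y - shallow_net \<sigma> R c x y)
       (mass * L * (sqrt (CARD('n) + 1) / lam * E_const B + lam ^ (CARD('n) + 1) / sqrt R * K_lip U B P \<sigma> L \<nu>))"
    proof (rule L2_norm_le_cong)
      show "shallow_net \<sigma> N \<theta> \<gamma> y - shallow_net \<sigma> R c x y = err c x y" if y: "y \<in> B" for y
      proof -
        have "\<tau> (z \<bullet> lift1 y) = \<sigma> (z \<bullet> lift1 y)" if "z \<in> U" for z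
          using ext[of "z \<bullet> lift1 y"] that y unfolding preactivations_def by blast
        then show ?thesis using good[OF x] param_mem by (simp add: err_def shallow_net_def)
      qed
    qed
    then show ?thesis using c(1) by blast
  qed
  then show ?thesis using S by blast
qed

end

lemma K_osc_nonneg:
  assumes "P_min U P > 0" and "D > 0" and "0 < \<nu>" "\<nu> < 1"
  shows "0 \<le> K_osc U P \<sigma> D \<nu>"
  using assms bump_eta_pos by (simp add: K_osc_def)

lemma K_lip_nonneg:
  assumes dens: "density_on U P" and U: "bounded U" and pmin: "P_min U P > 0" and L: "L > 0"
    and E: "0 \<le> E_const B" and \<nu>: "0 < \<nu>" "\<nu> < 1"
  shows "0 \<le> K_lip U B P \<sigma> L \<nu>"
proof -
  have "U \<noteq> {}"
  proof
    assume "U = {}"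
    then have "P = (\<lambda>_. 0)" using dens by (auto simp: density_on_def)
    then show False using dens by (simp add: density_on_def)
  qed
  then obtain y where y: "y \<in> U" by blast
  have "bdd_above (norm ` U)" using U by (simp add: bdd_above_norm)
  then have "norm y \<le> gamma_max U" unfolding gamma_max_def by (rule cSUP_upper[OF y])
  then have "0 \<le> gamma_max U" using order_trans[OF norm_ge_zero] by blast
  moreover have "0 \<le> diameter U" by (rule diameter_ge_0[OF U])
  moreover have "0 \<le> sqrt (1/2 * ln (1/\<nu>))" using \<nu> by simp
  ultimately show ?thesis
    using E L bump_eta_pos pmin unfolding K_lip_def
    by (intro mult_nonneg_nonneg add_nonneg_nonneg) auto
qed

theorem theorem2:
  fixes N R :: nat
    and lam D L S \<epsilon> b :: real
    and B :: "(real^'n::finite) set"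
    and \<Upsilon> :: "'n param set"
    and \<sigma> :: "real \<Rightarrow> real"
    and f :: "real^'n \<Rightarrow> real"
    and a :: "real^'n"
    and \<theta> :: "nat \<Rightarrow> real"
    and \<gamma> :: "nat \<Rightarrow> 'n param"
  defines "U \<equiv> expanded lam \<Upsilon>"
  defines "I \<equiv> preactivations (expanded lam \<Upsilon>) B"
  defines "f' \<equiv> (\<lambda>x. f x - a \<bullet> x - b)"
  defines "fN \<equiv> shallow_net \<sigma> N \<theta> \<gamma>"
  assumes "R \<ge> 1" and "lam > 0"
    and "bounded B" and "0 \<in> B" and "B \<in> sets lebesgue" and "emeasure lebesgue B > 0"
    and "bounded \<Upsilon>" and "\<Upsilon> \<subseteq> (UNIV - {0}) \<times> UNIV"
    and "\<not> linear \<sigma>" and "AE u in lebesgue. isCont \<sigma> u"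
    and "oscillation_cond \<sigma> I D \<or> lipschitz_cond \<sigma> I L"
    and "continuous_on B f"
    and "\<forall>i\<in>{1..N}. \<gamma> i \<in> \<Upsilon>"
    and "(\<Sum>i=1..N. \<bar>\<theta> i\<bar>) \<le> S"
    and "\<epsilon> > 0" and "L2_norm_le B (\<lambda>x. f' x - fN x) \<epsilon>"
  shows "(oscillation_cond \<sigma> I D \<longrightarrow>
            L2_norm_le B (\<lambda>x. fN x - mollified_net lam \<Upsilon> \<sigma> N \<theta> \<gamma> x) (S * D))
       \<and> (lipschitz_cond \<sigma> I L \<longrightarrow>
            L2_norm_le B (\<lambda>x. fN x - mollified_net lam \<Upsilon> \<sigma> N \<theta> \<gamma> x)
              (S * (L * sqrt (CARD('n) + 1) / lam) * E_const B))
       \<and> (\<forall>(P :: 'n param \<Rightarrow> real) (M :: 'w measure) (\<Gamma> :: nat \<Rightarrow> 'w \<Rightarrow> 'n param).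
            density_on U P \<and> P_min U P > 0 \<and> iid_samples M R \<Gamma> P \<longrightarrow>
            (\<forall>\<nu>\<in>{0<..<1}. \<exists>A\<in>sets M. measure M A > 1 - \<nu> \<and>
              (\<forall>\<omega>\<in>A. \<exists>c :: nat \<Rightarrow> real.
                 (\<forall>j\<in>{1..R}. \<bar>c j\<bar> \<le> g_max TYPE('n) lam N \<theta> / (P_min U P * R)) \<and>
                 (oscillation_cond \<sigma> I D \<longrightarrow>
                    L2_norm_le B (\<lambda>x. f' x - shallow_net \<sigma> R c (\<lambda>j. \<Gamma> j \<omega>) x)
                      (\<epsilon> + S * D * (1 + lam ^ (CARD('n) + 1) / sqrt R * K_osc U P \<sigma> D \<nu>))) \<and>
                 (lipschitz_cond \<sigma> I L \<longrightarrow>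
                    L2_norm_le B (\<lambda>x. f' x - shallow_net \<sigma> R c (\<lambda>j. \<Gamma> j \<omega>) x)
                      (\<epsilon> + S * L * (sqrt (CARD('n) + 1) / lam * E_const B
                                    + lam ^ (CARD('n) + 1) / sqrt R * K_lip U B P \<sigma> L \<nu>))))))"
proof -
  interpret unif_domain B
    using \<open>bounded B\<close> \<open>B \<in> sets lebesgue\<close> \<open>emeasure lebesgue B > 0\<close> by unfold_locales
  note cont = \<open>AE u in lebesgue. isCont \<sigma> u\<close>
  have params: "\<And>i. i \<in> {1..N} \<Longrightarrow> \<gamma> i \<in> \<Upsilon>"
    using \<open>\<forall>i\<in>{1..N}. \<gamma> i \<in> \<Upsilon>\<close> by blast
  define T where "T = (\<Sum>i=1..N. \<bar>\<theta> i\<bar>)"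
  have T: "0 \<le> T" "T \<le> S" using \<open>(\<Sum>i=1..N. \<bar>\<theta> i\<bar>) \<le> S\<close> by (auto simp: T_def sum_nonneg)
  have E: "0 \<le> E_const B" using E_const_ge_1 by simp
  have moll_osc: "L2_norm_le B (\<lambda>x. fN x - mollified_net lam \<Upsilon> \<sigma> N \<theta> \<gamma> x) (S * D)"
    if osc: "oscillation_cond \<sigma> I D"
  proof (rule L2_norm_le_weaken)
    show "L2_norm_le B (\<lambda>x. fN x - mollified_net lam \<Upsilon> \<sigma> N \<theta> \<gamma> x) (T * D)"
      unfolding fN_def T_def
      by (rule oscillation_mollification_error[OF \<open>lam > 0\<close> cont \<open>bounded \<Upsilon>\<close> params osc[unfolded I_def]])
    show "T * D \<le> S * D" using T osc by (intro mult_right_mono) (auto simp: oscillation_cond_def)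
  qed
  have moll_lip: "L2_norm_le B (\<lambda>x. fN x - mollified_net lam \<Upsilon> \<sigma> N \<theta> \<gamma> x)
      (S * (L * sqrt (CARD('n) + 1) / lam) * E_const B)" if lip: "lipschitz_cond \<sigma> I L"
  proof (rule L2_norm_le_weaken)
    show "L2_norm_le B (\<lambda>x. fN x - mollified_net lam \<Upsilon> \<sigma> N \<theta> \<gamma> x)
        (T * (L * sqrt (CARD('n) + 1) / lam) * E_const B)"
      unfolding fN_def T_def
      by (rule lipschitz_mollification_error[OF \<open>lam > 0\<close> cont \<open>bounded \<Upsilon>\<close> params lip[unfolded I_def]])
    show "T * (L * sqrt (CARD('n) + 1) / lam) * E_const B \<le> S * (L * sqrt (CARD('n) + 1) / lam) * E_const B"
      using T lip E \<open>lam > 0\<close> by (intro mult_right_mono) (auto simp: lipschitz_cond_def)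
  qed
  have random: "\<exists>A\<in>sets M. measure M A > 1 - \<nu> \<and> (\<forall>\<omega>\<in>A. \<exists>c :: nat \<Rightarrow> real.
       (\<forall>j\<in>{1..R}. \<bar>c j\<bar> \<le> g_max TYPE('n) lam N \<theta> / (P_min U P * R)) \<and>
       (oscillation_cond \<sigma> I D \<longrightarrow>
          L2_norm_le B (\<lambda>x. f' x - shallow_net \<sigma> R c (\<lambda>j. \<Gamma> j \<omega>) x)
            (\<epsilon> + S * D * (1 + lam ^ (CARD('n) + 1) / sqrt R * K_osc U P \<sigma> D \<nu>))) \<and>
       (lipschitz_cond \<sigma> I L \<longrightarrow>
          L2_norm_le B (\<lambda>x. f' x - shallow_net \<sigma> R c (\<lambda>j. \<Gamma> j \<omega>) x)
            (\<epsilon> + S * L * (sqrt (CARD('n) + 1) / lam * E_const B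
                          + lam ^ (CARD('n) + 1) / sqrt R * K_lip U B P \<sigma> L \<nu>))))"
    if dens: "density_on U P" and pmin: "P_min U P > 0" and iid: "iid_samples M R \<Gamma> P"
      and \<nu>: "0 < \<nu>" "\<nu> < 1"
    for P :: "'n param \<Rightarrow> real" and M :: "'w measure" and \<Gamma> :: "nat \<Rightarrow> 'w \<Rightarrow> 'n param" and \<nu> :: real
  proof -
    interpret M: prob_space M using iid by (simp add: iid_samples_def)
    define rosc where "rosc = D * (1 + lam ^ (CARD('n) + 1) / sqrt R * K_osc U P \<sigma> D \<nu>)"
    define rlip where "rlip = L * (sqrt (CARD('n) + 1) / lam * E_const B
                          + lam ^ (CARD('n) + 1) / sqrt R * K_lip U B P \<sigma> L \<nu>)"
    have rosc: "D \<le> rosc" if "oscillation_cond \<sigma> I D"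
    proof -
      have D: "D > 0" using that by (simp add: oscillation_cond_def)
      have "0 \<le> lam ^ (CARD('n) + 1) / sqrt R * K_osc U P \<sigma> D \<nu>"
        using K_osc_nonneg[OF pmin D \<nu>] \<open>lam > 0\<close> by (intro mult_nonneg_nonneg) auto
      then have "D * 1 \<le> D * (1 + lam ^ (CARD('n) + 1) / sqrt R * K_osc U P \<sigma> D \<nu>)"
        using D by (intro mult_left_mono) linarith+
      then show ?thesis unfolding rosc_def by simp
    qed
    have rlip: "0 \<le> rlip" if "lipschitz_cond \<sigma> I L"
    proof -
      have L: "L > 0" using that by (simp add: lipschitz_cond_def)
      have "bounded U" unfolding U_def by (rule compact_imp_bounded[OF compact_expanded[OF \<open>bounded \<Upsilon>\<close>]])
      then have "0 \<le> K_lip U B P \<sigma> L \<nu>" by (rule K_lip_nonneg[OF dens _ pmin L E \<nu>])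
      then show ?thesis using L E \<open>lam > 0\<close> unfolding rlip_def
        by (intro mult_nonneg_nonneg add_nonneg_nonneg) auto
    qed
    \<comment> \<open>one error level \<open>e\<close> that serves whichever of the two conditions hold\<close>
    have "\<exists>e A. A \<in> sets M \<and> measure M A > 1 - \<nu> \<and>
        (oscillation_cond \<sigma> I D \<longrightarrow> e \<le> S * rosc) \<and> (lipschitz_cond \<sigma> I L \<longrightarrow> e \<le> S * rlip) \<and>
        (\<forall>\<omega>\<in>A. \<exists>c. (\<forall>j\<in>{1..R}. \<bar>c j\<bar> \<le> g_max TYPE('n) lam N \<theta> / (P_min U P * R)) \<and>
           L2_norm_le B (\<lambda>x. fN x - shallow_net \<sigma> R c (\<lambda>j. \<Gamma> j \<omega>) x) e)"
    \<comment> \<open>all coefficients vanish, and the zero network is exact\<close>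
    proof (cases "T = 0")
      case True
      then have zero: "\<theta> i = 0" if "i \<in> {1..N}" for i
        using that by (simp add: T_def sum_nonneg_eq_0_iff)
      have "fN x - shallow_net \<sigma> R (\<lambda>_. 0) (\<lambda>j. \<Gamma> j \<omega>) x = 0" for x \<omega>
        using zero by (simp add: fN_def shallow_net_def)
      then have "L2_norm_le B (\<lambda>x. fN x - shallow_net \<sigma> R (\<lambda>_. 0) (\<lambda>j. \<Gamma> j \<omega>) x) 0" for \<omega>
        using L2_norm_le_const[of 0] by simp
      moreover have "g_max TYPE('n) lam N \<theta> = 0" using zero by (simp add: g_max_def)
      moreover have "0 \<le> S * rosc" if "oscillation_cond \<sigma> I D"
        using T rosc[OF that] that by (simp add: oscillation_cond_def)
      moreover have "0 \<le> S * rlip" if "lipschitz_cond \<sigma> I L"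
        using T rlip[OF that] by simp
      ultimately show ?thesis using \<nu>
        by (intro exI[of _ 0] exI[of _ "space M"]) (auto simp: M.prob_space intro!: exI[of _ "\<lambda>_. 0"])
    next
      case False
      then have "T > 0" using T by simp
      then interpret smp: sampling B lam \<Upsilon> N R \<theta> \<gamma> P
        using \<open>lam > 0\<close> \<open>bounded \<Upsilon>\<close> params dens pmin \<open>R \<ge> 1\<close>
        by unfold_locales (auto simp: U_def T_def)
      have TT: "smp.mass = T" by (simp add: T_def smp.mass_def)
      have transfer: ?thesis
        if Z: "Z \<in> sets smp.Q" "measure smp.Q Z > 1 - \<nu>"
          and e: "oscillation_cond \<sigma> I D \<longrightarrow> e \<le> S * rosc" "lipschitz_cond \<sigma> I L \<longrightarrow> e \<le> S * rlip"
          and good: "\<And>x. x \<in> Z \<Longrightarrow> \<exists>c\<in>smp.coeffs. L2_norm_le B (\<lambda>y. shallow_net \<sigma> N \<theta> \<gamma> y - shallow_net \<sigma> R c x y) e"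
        for Z e
      proof (rule exI[of _ e], rule exI[of _ "{\<omega> \<in> space M. (\<lambda>j\<in>{1..R}. \<Gamma> j \<omega>) \<in> Z}"], intro conjI e ballI)
        let ?X = "\<lambda>\<omega>. \<lambda>j\<in>{1..R}. \<Gamma> j \<omega>"
        show "{\<omega> \<in> space M. ?X \<omega> \<in> Z} \<in> sets M" by (rule smp.samples_distribution(1)[OF iid Z(1)])
        show "measure M {\<omega> \<in> space M. ?X \<omega> \<in> Z} > 1 - \<nu>"
          using smp.samples_distribution(2)[OF iid Z(1)] Z(2) by simp
        fix \<omega> assume "\<omega> \<in> {\<omega> \<in> space M. ?X \<omega> \<in> Z}"
        then obtain c where c: "c \<in> smp.coeffs"
          and near: "L2_norm_le B (\<lambda>y. shallow_net \<sigma> N \<theta> \<gamma> y - shallow_net \<sigma> R c (?X \<omega>) y) e"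
          using good by blast
        have "shallow_net \<sigma> R c (?X \<omega>) = shallow_net \<sigma> R c (\<lambda>j. \<Gamma> j \<omega>)"
          by (simp add: shallow_net_def fun_eq_iff)
        then show "\<exists>c. (\<forall>j\<in>{1..R}. \<bar>c j\<bar> \<le> g_max TYPE('n) lam N \<theta> / (P_min U P * R)) \<and>
           L2_norm_le B (\<lambda>x. fN x - shallow_net \<sigma> R c (\<lambda>j. \<Gamma> j \<omega>) x) e"
          using c near unfolding smp.coeffs_iff U_def fN_def by (intro exI[of _ c]) simp
      qed
      show ?thesis
      proof (cases "lipschitz_cond \<sigma> I L \<and> (oscillation_cond \<sigma> I D \<longrightarrow> rlip \<le> rosc)")
        case True
        then have lip: "lipschitz_cond \<sigma> I L" by blast
        obtain Z where Z: "Z \<in> sets smp.Q" "measure smp.Q Z > 1 - \<nu>"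
          and good: "\<And>x. x \<in> Z \<Longrightarrow> \<exists>c\<in>smp.coeffs.
            L2_norm_le B (\<lambda>y. shallow_net \<sigma> N \<theta> \<gamma> y - shallow_net \<sigma> R c x y) (T * rlip)"
          using smp.lipschitz_approximation[OF lip[unfolded I_def] \<nu>]
          unfolding TT rlip_def U_def mult.assoc by blast
        have le: "T * rlip \<le> S * rlip" using T rlip[OF lip] by (intro mult_right_mono)
        have "T * rlip \<le> S * rosc" if "oscillation_cond \<sigma> I D"
          using le True that T mult_left_mono[of rlip rosc S] by auto
        then show ?thesis using transfer[OF Z _ _ good] le by blast
      next
        case False
        then have osc: "oscillation_cond \<sigma> I D"
          and less: "lipschitz_cond \<sigma> I L \<Longrightarrow> rosc < rlip"
          using \<open>oscillation_cond \<sigma> I D \<or> lipschitz_cond \<sigma> I L\<close> by auto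
        have D: "D > 0" using osc by (simp add: oscillation_cond_def)
        have le: "T * D \<le> S * rosc" using T D rosc[OF osc] by (intro mult_mono) auto
        have "T * D \<le> S * rlip" if "lipschitz_cond \<sigma> I L"
          using le less[OF that] T mult_left_mono[of rosc rlip S] by linarith
        moreover have "\<exists>c\<in>smp.coeffs. L2_norm_le B (\<lambda>y. shallow_net \<sigma> N \<theta> \<gamma> y - shallow_net \<sigma> R c x y) (T * D)"
          if "x \<in> {x \<in> space smp.Q. \<forall>j\<in>{1..R}. x j \<in> smp.U}" for x
          using smp.oscillation_approximation[OF cont osc[unfolded I_def], of x] that unfolding TT by blast
        ultimately show ?thesis
          using transfer[OF smp.samples_in_U(1) _ _ _] smp.samples_in_U(2) \<nu> le by auto
      qed
    qed
    then obtain e A where A: "A \<in> sets M" "measure M A > 1 - \<nu>"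
      and e: "oscillation_cond \<sigma> I D \<Longrightarrow> e \<le> S * rosc" "lipschitz_cond \<sigma> I L \<Longrightarrow> e \<le> S * rlip"
      and good: "\<And>\<omega>. \<omega> \<in> A \<Longrightarrow> \<exists>c. (\<forall>j\<in>{1..R}. \<bar>c j\<bar> \<le> g_max TYPE('n) lam N \<theta> / (P_min U P * R)) \<and>
           L2_norm_le B (\<lambda>x. fN x - shallow_net \<sigma> R c (\<lambda>j. \<Gamma> j \<omega>) x) e"
      by blast
    show ?thesis
    proof (intro bexI[OF _ A(1)] conjI A(2) ballI)
      fix \<omega> assume "\<omega> \<in> A"
      then obtain c where c: "\<forall>j\<in>{1..R}. \<bar>c j\<bar> \<le> g_max TYPE('n) lam N \<theta> / (P_min U P * R)"
        and near: "L2_norm_le B (\<lambda>x. fN x - shallow_net \<sigma> R c (\<lambda>j. \<Gamma> j \<omega>) x) e"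
        using good by blast
      have "L2_norm_le B (\<lambda>x. f' x - shallow_net \<sigma> R c (\<lambda>j. \<Gamma> j \<omega>) x) (\<epsilon> + e)"
        using L2_norm_le_add[OF \<open>L2_norm_le B (\<lambda>x. f' x - fN x) \<epsilon>\<close> near] by simp
      then have "L2_norm_le B (\<lambda>x. f' x - shallow_net \<sigma> R c (\<lambda>j. \<Gamma> j \<omega>) x) r" if "\<epsilon> + e \<le> r" for r
        using that by (rule L2_norm_le_weaken)
      then show "\<exists>c :: nat \<Rightarrow> real.
       (\<forall>j\<in>{1..R}. \<bar>c j\<bar> \<le> g_max TYPE('n) lam N \<theta> / (P_min U P * R)) \<and>
       (oscillation_cond \<sigma> I D \<longrightarrow>
          L2_norm_le B (\<lambda>x. f' x - shallow_net \<sigma> R c (\<lambda>j. \<Gamma> j \<omega>) x)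
            (\<epsilon> + S * D * (1 + lam ^ (CARD('n) + 1) / sqrt R * K_osc U P \<sigma> D \<nu>))) \<and>
       (lipschitz_cond \<sigma> I L \<longrightarrow>
          L2_norm_le B (\<lambda>x. f' x - shallow_net \<sigma> R c (\<lambda>j. \<Gamma> j \<omega>) x)
            (\<epsilon> + S * L * (sqrt (CARD('n) + 1) / lam * E_const B
                          + lam ^ (CARD('n) + 1) / sqrt R * K_lip U B P \<sigma> L \<nu>)))"
        using c e unfolding rosc_def rlip_def mult.assoc[of S] by (intro exI[of _ c]) simp
    qed
  qed
  show ?thesis
    using moll_osc moll_lip random by (intro conjI impI allI ballI) auto
qed

end
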